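(* Let $\Bbbk$ be an arbitrary field, let $X=(x_{i,j})$ be a $k\times\ell$ matrix of distinct indeterminates, and let $$f=f(X)=\prod_{j=0}^{k-2}\left[\det\left(X_{[1,j+1]}^{[1,j+1]}\right)\det\left(X_{[\ell-j,\ell]}^{[k-j,k]}\right)\right]\prod_{j=1}^{\ell-k+1}\det\left(X_{[j,k+j-1]}\right)\in\Bbbk[X].$$ Let $w$ be a $k\times\ell$ partial permutation and let $I_w\subseteq\Bbbk[X]$ be its corresponding Schubert determinantal ideal. Then $I_w\in\mathcal{C}_f$. In particular, $\mathrm{in}_\prec(I_w)$ is a squarefree monomial ideal for any antidiagonal term order $\prec$, and Schubert determinantal ideals define $F$-pure rings in positive characteristic (i.e. $\Bbbk[X]/I_w$ is $F$-pure if $\Bbbk$ has positive characteristic).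
   Context: $\Bbbk[X]$ is the polynomial ring over $\Bbbk$ in the entries of $X$. $X_{[a,b]}^{[c,d]}$ is the submatrix of $X$ with column indices $a,\ldots,b$ and row indices $c,\ldots,d$; $X_{[a,b]}=X_{[a,b]}^{[1,k]}$; for any $k\times\ell$ matrix $Z$, $Z_{r\times s}$ is its northwest $r\times s$ submatrix. A partial permutation is a $k\times\ell$ matrix $w$ over $\Bbbk$ with all entries $0$ except for at most one entry equal to $1$ in each row and column. The Schubert determinantal ideal $I_w$ is the ideal of $\Bbbk[X]$ generated by the $(\mathrm{rank}(w_{r\times s})+1)$-minors of $X_{r\times s}$ for every $1\le r\le k$, $1\le s\le\ell$. Antidiagonal term order: a term order on $\Bbbk[X]$ such that the initial term of every minor with rows $i_1<\cdots<i_r$ and columns $j_1<\cdots<j_r$ is its antidiagonal term $x_{i_1,j_r}x_{i_2,j_{r-1}}\cdots x_{i_r,j_1}$. With respect to an antidiagonal term order, the initial term of $f(X)$ is $\prod_{1\le i\le k,\,1\le j\le\ell}x_{i,j}$. For an ideal $I$, $\mathrm{in}_\prec(I)$ is its initial ideal with respect to $\prec$. Knutson ideals: for $R$ a polynomial ring over a field and $f\in R$ a homogeneous polynomial whose leading term with respect to some term order is a squarefree monomial, $\mathcal{C}_f$ is the smallest set of ideals of $R$ such that: (i) $(f)\in\mathcal{C}_f$; (ii) if $I\in\mathcal{C}_f$ then $(I:J)\in\mathcal{C}_f$ for every ideal $J\subseteq R$; (iii) if $I,J\in\mathcal{C}_f$ then $I+J\in\mathcal{C}_f$ and $I\cap J\in\mathcal{C}_f$.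 A ring $S$ of characteristic $p>0$ is $F$-pure if the Frobenius map $S\to F_*S$ is pure, i.e. remains injective after tensoring with any $S$-module.
   Formalization: Membership of I_w in C_f is claimed only for I_w ≠ (0), since every ideal in C_f contains f ≠ 0 (e.g. k = l = 1, w = (1) gives I_w = (0)); sizes are 1 ≤ k ≤ ℓ+1, ℓ ≥ 1, exactly those for which all blocks in f lie inside X. *)

theory Defs
  imports
    "HOL-Library.Poly_Mapping"
    "HOL-Algebra.QuotRing"
    "HOL-Algebra.Module"
    "HOL-Algebra.Multiplicative_Group"
    "HOL-Algebra.Free_Abelian_Groups"
    "Jordan_Normal_Form.DL_Rank_Submatrix"
begin

section \<open>The polynomial ring and the generic matrix\<close>

text \<open>
  Monomials are identified with their exponent vectors.  The indeterminate in row \<open>i\<close> and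
  column \<open>j\<close> (counted from 1) is labelled \<open>(i - 1, j - 1)\<close>, because matrix entries are indexed
  from 0 in the library.  The type of polynomials has infinitely many indeterminates; the
  polynomial ring in finitely many of them is a ring record with restricted carrier.
\<close>

type_synonym mon = "(nat \<times> nat) \<Rightarrow>\<^sub>0 nat"
type_synonym 'a mpoly = "mon \<Rightarrow>\<^sub>0 'a"

definition monomials :: "(nat \<times> nat) set \<Rightarrow> mon set" where
  "monomials V = {m. Poly_Mapping.keys m \<subseteq> V}"

definition mpoly_ring :: "(nat \<times> nat) set \<Rightarrow> 'a::comm_ring_1 mpoly ring" where
  "mpoly_ring V =
     \<lparr>carrier = {p. Poly_Mapping.keys p \<subseteq> monomials V}, monoid.mult = (*), one = 1,
      ring.zero = 0, add = (+)\<rparr>"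

definition monom :: "mon \<Rightarrow> 'a::comm_ring_1 mpoly" where
  "monom m = Poly_Mapping.single m 1"

abbreviation vars :: "nat \<Rightarrow> nat \<Rightarrow> (nat \<times> nat) set" where
  "vars k l \<equiv> {..<k} \<times> {..<l}"

definition generic_matrix :: "nat \<Rightarrow> nat \<Rightarrow> 'a::comm_ring_1 mpoly mat" where
  "generic_matrix k l = mat k l (\<lambda>(i, j). monom (Poly_Mapping.single (i, j) 1))"

lemma cring_mpoly_ring: "cring (mpoly_ring V :: 'a::comm_ring_1 mpoly ring)"
proof -
  have mult: "Poly_Mapping.keys (p * q) \<subseteq> monomials V"
    if "Poly_Mapping.keys p \<subseteq> monomials V" "Poly_Mapping.keys q \<subseteq> monomials V"
    for p q :: "'a mpoly"
  proof
    fix m assume "m \<in> Poly_Mapping.keys (p * q)"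
    then obtain a b where "m = a + b" "a \<in> Poly_Mapping.keys p" "b \<in> Poly_Mapping.keys q"
      using keys_mult[of p q] by blast
    then show "m \<in> monomials V"
      using that Poly_Mapping.keys_add[of a b] unfolding monomials_def by blast
  qed
  have add: "Poly_Mapping.keys (p + q) \<subseteq> monomials V"
    if "Poly_Mapping.keys p \<subseteq> monomials V" "Poly_Mapping.keys q \<subseteq> monomials V"
    for p q :: "'a mpoly"
    using that Poly_Mapping.keys_add[of p q] by blast
  show ?thesis
  proof (rule cringI)
    show "abelian_group (mpoly_ring V :: 'a mpoly ring)"
    proof (rule abelian_groupI)
      fix x :: "'a mpoly" assume "x \<in> carrier (mpoly_ring V)"
      then show "\<exists>y\<in>carrier (mpoly_ring V). y \<oplus>\<^bsub>mpoly_ring V\<^esub> x = \<zero>\<^bsub>mpoly_ring V\<^esub>"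
        by (intro bexI[of _ "- x"]) (auto simp: mpoly_ring_def)
    qed (auto simp: mpoly_ring_def add.assoc add.commute intro: add[THEN subsetD])
    show "Group.comm_monoid (mpoly_ring V :: 'a mpoly ring)"
      by (rule comm_monoidI)
         (auto simp: mpoly_ring_def monomials_def mult.assoc mult.commute intro: 
            mult[unfolded monomials_def, THEN subsetD, THEN CollectD, THEN subsetD])
  qed (auto simp: mpoly_ring_def algebra_simps)
qed

section \<open>Submatrices, minors and Schubert determinantal ideals\<close>

text \<open>
  \<open>block A a b c d\<close> is $A_{[a,b]}^{[c,d]}$: columns \<open>a, \<dots>, b\<close> and rows \<open>c, \<dots>, d\<close>, counted from 1.
\<close>

definition block :: "'b mat \<Rightarrow> nat \<Rightarrow> nat \<Rightarrow> nat \<Rightarrow> nat \<Rightarrow> 'b mat" where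
  "block A a b c d = submatrix A {i. c \<le> Suc i \<and> Suc i \<le> d} {j. a \<le> Suc j \<and> Suc j \<le> b}"

definition northwest :: "'b mat \<Rightarrow> nat \<Rightarrow> nat \<Rightarrow> 'b mat" where
  "northwest A r s = block A 1 s 1 r"

definition minors :: "nat \<Rightarrow> 'b::comm_ring_1 mat \<Rightarrow> 'b set" where
  "minors t A = {det (submatrix A I J) | I J.
     I \<subseteq> {..<dim_row A} \<and> J \<subseteq> {..<dim_col A} \<and> card I = t \<and> card J = t}"

definition mat_rank :: "'a::field mat \<Rightarrow> nat" where
  "mat_rank A = vec_space.rank (dim_row A) A"

definition partial_permutation :: "nat \<Rightarrow> nat \<Rightarrow> 'a::field mat \<Rightarrow> bool" where
  "partial_permutation k l w \<longleftrightarrow>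
     w \<in> carrier_mat k l \<and>
     (\<forall>i<k. \<forall>j<l. w $$ (i, j) = 0 \<or> w $$ (i, j) = 1) \<and>
     (\<forall>i<k. \<forall>j<l. \<forall>j'<l. w $$ (i, j) = 1 \<and> w $$ (i, j') = 1 \<longrightarrow> j = j') \<and>
     (\<forall>j<l. \<forall>i<k. \<forall>i'<k. w $$ (i, j) = 1 \<and> w $$ (i', j) = 1 \<longrightarrow> i = i')"

definition schubert_ideal :: "nat \<Rightarrow> nat \<Rightarrow> 'a::field mat \<Rightarrow> 'a mpoly set" where
  "schubert_ideal k l w =
     genideal (mpoly_ring (vars k l))
       (\<Union>r\<in>{1..k}. \<Union>s\<in>{1..l}.
          minors (mat_rank (northwest w r s) + 1) (northwest (generic_matrix k l) r s))"

text \<open>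
  For \<open>1 \<le> k \<le> l + 1\<close> all blocks below lie inside the matrix and none of the subtractions is
  truncated, except that \<open>{..<k - 1}\<close> is the (possibly empty) range \<open>0, \<dots>, k - 2\<close>.
\<close>

definition knutson_poly :: "nat \<Rightarrow> nat \<Rightarrow> 'a::field mpoly" where
  "knutson_poly k l =
     (let X = generic_matrix k l in
       (\<Prod>j<k - 1. det (block X 1 (j + 1) 1 (j + 1)) * det (block X (l - j) l (k - j) k)) *
       (\<Prod>j=1..l + 1 - k. det (block X j (k + j - 1) 1 k)))"

section \<open>Knutson ideals\<close>

definition ideal_colon :: "('b, 'c) ring_scheme \<Rightarrow> 'b set \<Rightarrow> 'b set \<Rightarrow> 'b set" where
  "ideal_colon R I J = {x \<in> carrier R. \<forall>y\<in>J. x \<otimes>\<^bsub>R\<^esub> y \<in> I}"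

inductive_set knutson_ideals :: "('b, 'c) ring_scheme \<Rightarrow> 'b \<Rightarrow> 'b set set"
  for R :: "('b, 'c) ring_scheme" and f :: 'b where
  principal: "PIdl\<^bsub>R\<^esub> f \<in> knutson_ideals R f"
| colon: "I \<in> knutson_ideals R f \<Longrightarrow> ideal J R \<Longrightarrow> ideal_colon R I J \<in> knutson_ideals R f"
| add: "I \<in> knutson_ideals R f \<Longrightarrow> J \<in> knutson_ideals R f \<Longrightarrow> I <+>\<^bsub>R\<^esub> J \<in> knutson_ideals R f"
| inter: "I \<in> knutson_ideals R f \<Longrightarrow> J \<in> knutson_ideals R f \<Longrightarrow> I \<inter> J \<in> knutson_ideals R f"

section \<open>Term orders and initial ideals\<close>

text \<open>A pair \<open>(m, n)\<close> belongs to the order \<open>ord\<close> iff \<open>m\<close> is less than or equal to \<open>n\<close>.\<close>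

definition term_order :: "(nat \<times> nat) set \<Rightarrow> (mon \<times> mon) set \<Rightarrow> bool" where
  "term_order V ord \<longleftrightarrow>
     linear_order_on (monomials V) ord \<and>
     (\<forall>m\<in>monomials V. (0, m) \<in> ord) \<and>
     (\<forall>m\<in>monomials V. \<forall>n\<in>monomials V. \<forall>u\<in>monomials V.
        (m, n) \<in> ord \<longrightarrow> (m + u, n + u) \<in> ord)"

definition lead_mon :: "(mon \<times> mon) set \<Rightarrow> 'a::field mpoly \<Rightarrow> mon" where
  "lead_mon ord p =
     (THE m. m \<in> Poly_Mapping.keys p \<and> (\<forall>n\<in>Poly_Mapping.keys p. (n, m) \<in> ord))"

text \<open>Initial terms are taken without their coefficient.\<close>

definition initial_ideal ::
    "(nat \<times> nat) set \<Rightarrow> (mon \<times> mon) set \<Rightarrow> 'a::field mpoly set \<Rightarrow> 'a mpoly set" where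
  "initial_ideal V ord I =
     genideal (mpoly_ring V) {monom (lead_mon ord p) | p. p \<in> I \<and> p \<noteq> 0}"

text \<open>
  \<open>pick I a\<close> is the \<open>a\<close>-th smallest element of \<open>I\<close>, counted from 0.  The field is an argument
  because the minors have coefficients in it.
\<close>

definition antidiagonal_term_order ::
    "'a::field itself \<Rightarrow> nat \<Rightarrow> nat \<Rightarrow> (mon \<times> mon) set \<Rightarrow> bool" where
  "antidiagonal_term_order _ k l ord \<longleftrightarrow>
     term_order (vars k l) ord \<and>
     (\<forall>I J. I \<subseteq> {..<k} \<longrightarrow> J \<subseteq> {..<l} \<longrightarrow> card I = card J \<longrightarrow>
        lead_mon ord (det (submatrix (generic_matrix k l :: 'a mpoly mat) I J)) =
        (\<Sum>a<card I. Poly_Mapping.single (pick I a, pick J (card I - 1 - a)) 1))"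

definition squarefree_mon :: "mon \<Rightarrow> bool" where
  "squarefree_mon m \<longleftrightarrow> (\<forall>v. Poly_Mapping.lookup m v \<le> 1)"

definition squarefree_monomial_ideal :: "(nat \<times> nat) set \<Rightarrow> 'a::field mpoly set \<Rightarrow> bool" where
  "squarefree_monomial_ideal V I \<longleftrightarrow>
     (\<exists>M \<subseteq> monomials V. (\<forall>m\<in>M. squarefree_mon m) \<and> I = genideal (mpoly_ring V) (monom ` M))"

section \<open>Tensor products, purity and \<open>F\<close>-purity\<close>

text \<open>
  The tensor product of two modules is the quotient of the free abelian group on the pairs by
  the subgroup of bilinearity relations.
\<close>

definition tensor_free ::
    "('r, 'm, 'c) module_scheme \<Rightarrow> ('r, 'n, 'd) module_scheme \<Rightarrow> ('m \<times> 'n \<Rightarrow>\<^sub>0 int) monoid" where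
  "tensor_free M N = free_Abelian_group (carrier M \<times> carrier N)"

definition tensor_relations ::
    "('r, 'e) ring_scheme \<Rightarrow> ('r, 'm, 'c) module_scheme \<Rightarrow> ('r, 'n, 'd) module_scheme \<Rightarrow>
     ('m \<times> 'n \<Rightarrow>\<^sub>0 int) set" where
  "tensor_relations S M N =
     generate (tensor_free M N)
      ({frag_of (x \<oplus>\<^bsub>M\<^esub> x', y) - frag_of (x, y) - frag_of (x', y) | x x' y.
          x \<in> carrier M \<and> x' \<in> carrier M \<and> y \<in> carrier N} \<union>
       {frag_of (x, y \<oplus>\<^bsub>N\<^esub> y') - frag_of (x, y) - frag_of (x, y') | x y y'.
          x \<in> carrier M \<and> y \<in> carrier N \<and> y' \<in> carrier N} \<union>
       {frag_of (a \<odot>\<^bsub>M\<^esub> x, y) - frag_of (x, a \<odot>\<^bsub>N\<^esub> y) | a x y.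
          a \<in> carrier S \<and> x \<in> carrier M \<and> y \<in> carrier N})"

definition tensor_product ::
    "('r, 'e) ring_scheme \<Rightarrow> ('r, 'm, 'c) module_scheme \<Rightarrow> ('r, 'n, 'd) module_scheme \<Rightarrow>
     ('m \<times> 'n \<Rightarrow>\<^sub>0 int) set monoid" where
  "tensor_product S M N = tensor_free M N Mod tensor_relations S M N"

text \<open>
  The map \<open>id \<otimes> \<phi> : M \<otimes> N \<rightarrow> M \<otimes> N'\<close> on cosets.  The image of a coset under the map of free
  abelian groups lies in a single coset of the relations, and adding the relations to it yields
  that coset.
\<close>

definition tensor_map ::
    "('r, 'e) ring_scheme \<Rightarrow> ('r, 'm, 'c) module_scheme \<Rightarrow> ('r, 'n', 'd) module_scheme \<Rightarrow>
     ('n \<Rightarrow> 'n') \<Rightarrow> ('m \<times> 'n \<Rightarrow>\<^sub>0 int) set \<Rightarrow> ('m \<times> 'n' \<Rightarrow>\<^sub>0 int) set" where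
  "tensor_map S M N' \<phi> C =
     tensor_relations S M N' <#>\<^bsub>tensor_free M N'\<^esub>
       (frag_extend (\<lambda>(x, y). frag_of (x, \<phi> y)) ` C)"

text \<open>
  HOL cannot quantify over all types inside a formula, so the modules range over those with
  carrier in a given type \<open>'m\<close>; a theorem with \<open>'m\<close> free speaks about all modules.
\<close>

definition pure_map ::
    "'m itself \<Rightarrow> ('r, 'e) ring_scheme \<Rightarrow> ('r, 'n, 'c) module_scheme \<Rightarrow>
     ('r, 'n', 'd) module_scheme \<Rightarrow> ('n \<Rightarrow> 'n') \<Rightarrow> bool" where
  "pure_map _ S N N' \<phi> \<longleftrightarrow>
     (\<forall>M :: ('r, 'm) module. module S M \<longrightarrow>
        inj_on (tensor_map S M N' \<phi>) (carrier (tensor_product S M N)))"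

definition ring_char :: "('r, 'e) ring_scheme \<Rightarrow> nat" where
  "ring_char S = group.ord (add_monoid S) \<one>\<^bsub>S\<^esub>"

definition frobenius :: "('r, 'e) ring_scheme \<Rightarrow> 'r \<Rightarrow> 'r" where
  "frobenius S x = x [^]\<^bsub>S\<^esub> ring_char S"

text \<open>\<open>S\<close> as a module over itself, with scalars acting through a map \<open>\<psi>\<close>.\<close>

definition module_via :: "('r, 'e) ring_scheme \<Rightarrow> ('r \<Rightarrow> 'r) \<Rightarrow> ('r, 'r) module" where
  "module_via S \<psi> =
     \<lparr>carrier = carrier S, monoid.mult = monoid.mult S, one = one S, ring.zero = ring.zero S,
      add = add S, smult = (\<lambda>a x. \<psi> a \<otimes>\<^bsub>S\<^esub> x)\<rparr>"

text \<open>The codomain \<open>module_via S (frobenius S)\<close> is $F_*S$.\<close>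

definition F_pure :: "'m itself \<Rightarrow> ('r, 'e) ring_scheme \<Rightarrow> bool" where
  "F_pure T S \<longleftrightarrow>
     0 < ring_char S \<and>
     pure_map T S (module_via S id) (module_via S (frobenius S)) (frobenius S)"

end

(*
  All ideals involved are sums of determinantal ideals I(r, s, t), generated by the (t+1)-minors of the
  northwest r x s block.

  Substituting a generic matrix of rank t for the block maps the monomials without antidiagonals of
  length t+1 to linearly independent polynomials: such a monomial splits into t antidiagonal-free
  pieces, and these are minimal among the monomials with the same row and column degrees.  So
  I(r, s, t) is the kernel of the substitution, hence prime, and the minors are a Groebner basis.

  Let g be the minor on the antidiagonal through the cells (r-t, s) and (r, s-t).  Modulo
  I(r-1, s, t) + I(r, s-1, t), a Schur complement computation turns g into a product of the minor at the
  corner (r, s) with factors outside I(r, s, t), up to such factors.  Therefore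
  I(r, s, t) = (I(r-1, s, t) + I(r, s-1, t) + (g)) : h for some h, and induction gives membership
  in the Knutson class.

  In characteristic p the map x -> Tr(f^(p-1) x), with f the product of the minors g, is up to a unit a
  splitting of Frobenius.  The ideals it preserves are closed under sums, intersections and
  quotients, so they contain the Schubert ideals, which gives F-purity.  Since f has the product of all
  indeterminates as leading monomial, initial ideals of preserved ideals are radical; hence
  taking initial ideals commutes with intersections and sums of them, and the minors form a
  Groebner basis of the Schubert ideal.  In characteristic zero an element with a bad leading monomial
  would specialise to one over the integers, and then to one modulo a large prime.
*)

theory Submission
  imports
    Defs
    "HOL-Library.Product_Lexorder"
    "HOL-Computational_Algebra.Primes"
begin

text \<open>The antidiagonal of the (t + 1)-minor in the southeast corner of the r x s block lies on
  a line i + j = d, and each such line carries exactly one factor g of f; this is why a single g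
  suffices at each step of the induction. Turning the Schur complement identity into an ideal
  quotient needs two things: I(r, s, t) is prime, by the rank parametrisation, and the denominators
  are outside it, by evaluation at a zero-one matrix whose block has rank t.

  The obstacle that remains is that a leading monomial of a sum of ideals usually leads in none of
  the summands. Frobenius supplies the missing step: if m + m is a leading exponent in a preserved
  ideal, so is m. Products of elements then settle intersections, and intersections settle sums by a
  cancellation argument.

  The zero ideal is set apart because every ideal built from (f) by the three operations contains f,
  which is nonzero.\<close>

abbreviation lookup where "lookup \<equiv> Poly_Mapping.lookup"
abbreviation keys where "keys \<equiv> Poly_Mapping.keys"
abbreviation single where "single \<equiv> Poly_Mapping.single"

abbreviation mpolys :: "(nat \<times> nat) set \<Rightarrow> 'a::comm_ring_1 mpoly set" where
  "mpolys V \<equiv> carrier (mpoly_ring V)"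

abbreviation gen :: "(nat \<times> nat) set \<Rightarrow> 'a::comm_ring_1 mpoly set \<Rightarrow> 'a mpoly set" where
  "gen V \<equiv> genideal (mpoly_ring V)"

section \<open>Polynomials and ideals\<close>

lemma monomials_iff: "m \<in> monomials V \<longleftrightarrow> (\<forall>v. v \<notin> V \<longrightarrow> lookup m v = 0)"
  by (auto simp: monomials_def in_keys_iff)

lemma monomials_zero [simp, intro]: "0 \<in> monomials V"
  by (simp add: monomials_iff)

lemma monomials_add [intro]: "m \<in> monomials V \<Longrightarrow> n \<in> monomials V \<Longrightarrow> m + n \<in> monomials V"
  by (simp add: monomials_iff lookup_add)

lemma monomials_minus [intro]: "m \<in> monomials V \<Longrightarrow> m - n \<in> monomials V"
  by (simp add: monomials_iff lookup_minus)

lemma monomials_single [intro]: "v \<in> V \<Longrightarrow> single v c \<in> monomials V"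
  by (auto simp: monomials_iff lookup_single when_def)

lemma monomials_sum [intro]: "(\<And>a. a \<in> A \<Longrightarrow> f a \<in> monomials V) \<Longrightarrow> sum f A \<in> monomials V"
  by (simp add: monomials_iff lookup_sum)

lemma mpolys_iff: "p \<in> mpolys V \<longleftrightarrow> keys p \<subseteq> monomials V"
  by (simp add: mpoly_ring_def)

lemma mpoly_ring_simps [simp]:
  "\<zero>\<^bsub>mpoly_ring V\<^esub> = 0" "\<one>\<^bsub>mpoly_ring V\<^esub> = 1"
  "x \<oplus>\<^bsub>mpoly_ring V\<^esub> y = x + y" "x \<otimes>\<^bsub>mpoly_ring V\<^esub> y = x * y"
  by (simp_all add: mpoly_ring_def)

interpretation mpoly_ring: cring "mpoly_ring V :: 'a::comm_ring_1 mpoly ring" for V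
  by (rule cring_mpoly_ring)

lemma mpolys_zero [simp, intro]: "0 \<in> mpolys V"
  and mpolys_one [simp, intro]: "1 \<in> mpolys V"
  and mpolys_add [intro]: "x \<in> mpolys V \<Longrightarrow> y \<in> mpolys V \<Longrightarrow> x + y \<in> mpolys V"
  and mpolys_mult [intro]: "x \<in> mpolys V \<Longrightarrow> y \<in> mpolys V \<Longrightarrow> x * y \<in> mpolys V"
  using mpoly_ring.zero_closed[of V] mpoly_ring.one_closed[of V]
    mpoly_ring.add.m_closed[of x V y] mpoly_ring.m_closed[of x V y] by simp_all

lemma mpolys_uminus [intro]: "x \<in> mpolys V \<Longrightarrow> - x \<in> mpolys V"
  by (simp add: mpolys_iff subset_iff in_keys_iff)

lemma mpolys_diff [intro]: "x \<in> mpolys V \<Longrightarrow> y \<in> mpolys V \<Longrightarrow> x - y \<in> mpolys V"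
  using mpolys_add[of x V "- y"] by auto

lemma mpolys_single [intro]: "m \<in> monomials V \<Longrightarrow> single m c \<in> mpolys V"
  by (simp add: mpolys_iff)

lemma mpolys_monom [intro]: "m \<in> monomials V \<Longrightarrow> monom m \<in> mpolys V"
  by (simp add: monom_def mpolys_single)

lemma mpolys_sum [intro]: "(\<And>a. a \<in> A \<Longrightarrow> f a \<in> mpolys V) \<Longrightarrow> sum f A \<in> mpolys V"
  by (induction A rule: infinite_finite_induct) auto

lemma mpolys_prod [intro]: "(\<And>a. a \<in> A \<Longrightarrow> f a \<in> mpolys V) \<Longrightarrow> prod f A \<in> mpolys V"
  by (induction A rule: infinite_finite_induct) auto

lemma mpolys_power [intro]: "x \<in> mpolys V \<Longrightarrow> x ^ n \<in> mpolys V"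
  by (induction n) auto

lemma mpolys_of_int [simp, intro]: "of_int z \<in> mpolys V"
  by (metis single_of_int monomials_zero mpolys_single)

lemma mpolys_det [intro]:
  assumes "A \<in> carrier_mat n n" "\<And>i j. i < n \<Longrightarrow> j < n \<Longrightarrow> A $$ (i, j) \<in> mpolys V"
  shows "det A \<in> mpolys V"
  unfolding det_def'[OF assms(1)]
  by (intro mpolys_sum mpolys_mult mpolys_prod)
    (auto simp: sign_def assms(2) dest: permutes_in_image intro!: mpolys_uminus assms(2))

section \<open>Coefficients of sums and products\<close>

lemma poly_mapping_sum_single: "p = (\<Sum>m\<in>keys p. single m (lookup p m))"
proof (rule poly_mapping_eqI)
  fix k
  have "lookup (\<Sum>m\<in>keys p. single m (lookup p m)) k =
      (\<Sum>m\<in>keys p. if m = k then lookup p k else 0)"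
    unfolding lookup_sum by (intro sum.cong) (auto simp: lookup_single when_def)
  also have "\<dots> = lookup p k"
    by (auto simp: in_keys_iff)
  finally show "lookup p k = lookup (\<Sum>m\<in>keys p. single m (lookup p m)) k" by simp
qed

lemma lookup_mult_sum:
  fixes p q :: "'m::comm_monoid_add \<Rightarrow>\<^sub>0 'b::comm_semiring_0"
  shows "lookup (p * q) w =
    (\<Sum>(a, b) | a \<in> keys p \<and> b \<in> keys q \<and> a + b = w. lookup p a * lookup q b)"
proof -
  have "p * q = (\<Sum>a\<in>keys p. \<Sum>b\<in>keys q. single (a + b) (lookup p a * lookup q b))"
    by (subst (1) poly_mapping_sum_single[of p], subst (1) poly_mapping_sum_single[of q])
      (simp add: sum_product mult_single)
  also have "\<dots> = (\<Sum>(a, b)\<in>keys p \<times> keys q. single (a + b) (lookup p a * lookup q b))"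
    by (simp add: sum.cartesian_product)
  finally have "lookup (p * q) w =
      (\<Sum>(a, b)\<in>keys p \<times> keys q. lookup p a * lookup q b when a + b = w)"
    by (simp add: lookup_sum lookup_single case_prod_unfold)
  also have "\<dots> = (\<Sum>x\<in>keys p \<times> keys q. if fst x + snd x = w then lookup p (fst x) * lookup q (snd x) else 0)"
    by (intro sum.cong) (auto simp: when_def)
  also have "\<dots> = (\<Sum>x | x \<in> keys p \<times> keys q \<and> fst x + snd x = w. lookup p (fst x) * lookup q (snd x))"
    by (simp add: sum.If_cases Int_def)
  finally show ?thesis
    by (simp add: case_prod_unfold mem_Times_iff conj_assoc)
qed

lemma lookup_single_mult:
  fixes p :: "'m::cancel_comm_monoid_add \<Rightarrow>\<^sub>0 'b::comm_semiring_0"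
  shows "lookup (single u c * p) (u + w) = c * lookup p w"
proof (cases "c = 0 \<or> lookup p w = 0")
  case True
  then have *: "{(a, b). a \<in> keys (single u c) \<and> b \<in> keys p \<and> a + b = u + w} = {}"
    by (auto simp: in_keys_iff lookup_single when_def split: if_splits)
  show ?thesis unfolding lookup_mult_sum * using True by auto
next
  case False
  then have *: "{(a, b). a \<in> keys (single u c) \<and> b \<in> keys p \<and> a + b = u + w} = {(u, w)}"
    by (auto simp: in_keys_iff lookup_single when_def split: if_splits)
  show ?thesis unfolding lookup_mult_sum * by simp
qed

lemma lookup_single_mult_eq_0:
  fixes p :: "'m::comm_monoid_add \<Rightarrow>\<^sub>0 'b::comm_semiring_0"
  assumes "\<And>n. w \<noteq> u + n"
  shows "lookup (single u c * p) w = 0"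
proof -
  have *: "{(a, b). a \<in> keys (single u c) \<and> b \<in> keys p \<and> a + b = w} = {}"
    using assms by (auto simp: in_keys_iff lookup_single when_def split: if_splits)
  show ?thesis unfolding lookup_mult_sum * by simp
qed

lemma lookup_const_mult:
  fixes p :: "'a::comm_ring_1 mpoly"
  shows "lookup (single 0 c * p) w = c * lookup p w"
  using lookup_single_mult[of 0 c p w] by simp

text \<open>Applied to polynomials that vanish modulo \<open>\<pi>\<close>; the bound on the keys
  keeps the quotient in the same polynomial ring.\<close>

lemma mpolys_factor_const:
  fixes g :: "'a::comm_ring_1 mpoly"
  assumes "\<And>m. c dvd lookup g m"
  obtains h where "g = single 0 c * h" "keys h \<subseteq> keys g"
proof -
  define q where "q m = (SOME d. lookup g m = c * d)" for m
  have q: "lookup g m = c * q m" for m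
    unfolding q_def using assms[of m] by (rule someI_ex[OF dvdE]) auto
  define h where "h = (\<Sum>m\<in>keys g. single m (q m))"
  have "g = single 0 c * h"
    by (subst poly_mapping_sum_single) (simp add: h_def sum_distrib_left mult_single q)
  moreover have "keys h \<subseteq> keys g"
  proof
    fix n assume "n \<in> keys h"
    then have "lookup h n \<noteq> 0" by (simp add: in_keys_iff)
    then obtain m where "m \<in> keys g" "lookup (single m (q m)) n \<noteq> 0"
      unfolding h_def lookup_sum using sum.not_neutral_contains_not_neutral by blast
    then show "n \<in> keys g" by (auto simp: lookup_single when_def split: if_splits)
  qed
  ultimately show ?thesis using that by blast
qed

section \<open>Ideals of the polynomial ring and their generators\<close>

lemma mpoly_idealI:
  fixes I :: "'a::comm_ring_1 mpoly set"
  assumes "I \<subseteq> mpolys V" "0 \<in> I" "\<And>x y. x \<in> I \<Longrightarrow> y \<in> I \<Longrightarrow> x + y \<in> I"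
    "\<And>c x. c \<in> mpolys V \<Longrightarrow> x \<in> I \<Longrightarrow> c * x \<in> I"
  shows "ideal I (mpoly_ring V)"
proof -
  have neg: "\<ominus>\<^bsub>mpoly_ring V\<^esub> x = - x" if "x \<in> mpolys V" for x :: "'a mpoly"
    by (rule mpoly_ring.minus_equality) (use that in auto)
  show ?thesis
  proof (rule idealI)
    show "ring (mpoly_ring V :: 'a mpoly ring)" by (rule mpoly_ring.ring_axioms)
    show "subgroup I (add_monoid (mpoly_ring V))"
    proof (rule subgroup.intro)
      fix x assume "x \<in> I"
      then have "x \<in> mpolys V" "- x \<in> I"
        using assms(1) assms(4)[OF mpolys_uminus[OF mpolys_one], of x] by auto
      then have "\<ominus>\<^bsub>mpoly_ring V\<^esub> x \<in> I"
        using neg by metis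
      then show "inv\<^bsub>add_monoid (mpoly_ring V)\<^esub> x \<in> I"
        by (simp only: a_inv_def)
    qed (use assms in auto)
  next
    fix a x :: "'a mpoly" assume "a \<in> I" "x \<in> mpolys V"
    then have "x * a \<in> I" by (rule assms(4)[rotated])
    then show "x \<otimes>\<^bsub>mpoly_ring V\<^esub> a \<in> I" "a \<otimes>\<^bsub>mpoly_ring V\<^esub> x \<in> I"
      by (simp_all add: mult.commute)
  qed
qed

lemma mpoly_ideal:
  fixes I :: "'a::comm_ring_1 mpoly set"
  assumes "ideal I (mpoly_ring V)"
  shows mpoly_ideal_subset: "I \<subseteq> mpolys V"
    and mpoly_ideal_zero: "0 \<in> I"
    and mpoly_ideal_add: "x \<in> I \<Longrightarrow> y \<in> I \<Longrightarrow> x + y \<in> I"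
    and mpoly_ideal_mult: "c \<in> mpolys V \<Longrightarrow> x \<in> I \<Longrightarrow> c * x \<in> I"
    and mpoly_ideal_uminus: "x \<in> I \<Longrightarrow> - x \<in> I"
    and mpoly_ideal_diff: "x \<in> I \<Longrightarrow> y \<in> I \<Longrightarrow> x - y \<in> I"
    and mpoly_ideal_sum: "(\<And>a. a \<in> A \<Longrightarrow> f a \<in> I) \<Longrightarrow> sum f A \<in> I"
proof -
  interpret ideal I "mpoly_ring V" by fact
  show sub: "I \<subseteq> mpolys V" using a_subset .
  show z: "0 \<in> I" using zero_closed by simp
  show add: "x + y \<in> I" if "x \<in> I" "y \<in> I" for x y using a_closed[OF that] by simp
  show mult: "c * x \<in> I" if "c \<in> mpolys V" "x \<in> I" for c x
    using I_l_closed[OF that(2,1)] by simp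
  show neg: "- x \<in> I" if "x \<in> I" for x
    using mult[of "-1" x] that by auto
  show "x - y \<in> I" if "x \<in> I" "y \<in> I" using add[of x "-y"] neg that by simp
  show "sum f A \<in> I" if "\<And>a. a \<in> A \<Longrightarrow> f a \<in> I"
    using that by (induction A rule: infinite_finite_induct) (auto intro: z add)
qed

lemma mpoly_ideal_eq:
  assumes "ideal I (mpoly_ring V)" "x - y \<in> I"
  shows "x \<in> I \<longleftrightarrow> y \<in> I"
  using mpoly_ideal_add[OF assms(1), of "x - y" y] mpoly_ideal_diff[OF assms(1), of x "x - y"] assms(2)
  by auto

lemma ideal_gen: "G \<subseteq> mpolys V \<Longrightarrow> ideal (gen V G) (mpoly_ring V)"
  by (rule mpoly_ring.genideal_ideal)

lemma gen_self: "G \<subseteq> mpolys V \<Longrightarrow> x \<in> G \<Longrightarrow> x \<in> gen V G"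
  using mpoly_ring.genideal_self by blast

lemma gen_minimal: "ideal I (mpoly_ring V) \<Longrightarrow> G \<subseteq> I \<Longrightarrow> gen V G \<subseteq> I"
  by (rule mpoly_ring.genideal_minimal)

lemma gen_mono: "H \<subseteq> mpolys V \<Longrightarrow> G \<subseteq> H \<Longrightarrow> gen V G \<subseteq> gen V H"
  by (meson gen_minimal gen_self ideal_gen subset_iff)

text \<open>Tailored to additive properties: splitting a multiplier into its terms leaves only one
  term times one generator to be treated. The auxiliary set demands \<open>P\<close> of all
  multiples of x, which makes it an ideal.\<close>

lemma gen_induct [consumes 2, case_names zero add single]:
  fixes G :: "'a::comm_ring_1 mpoly set"
  assumes "x \<in> gen V G" "G \<subseteq> mpolys V" and zero: "P 0"
    and add: "\<And>x y. x \<in> gen V G \<Longrightarrow> y \<in> gen V G \<Longrightarrow> P x \<Longrightarrow> P y \<Longrightarrow> P (x + y)"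
    and single: "\<And>u c g. u \<in> monomials V \<Longrightarrow> g \<in> G \<Longrightarrow> P (single u c * g)"
  shows "P x"
proof -
  let ?S = "{x \<in> gen V G. \<forall>c\<in>mpolys V. P (c * x)}"
  note I = ideal_gen[OF assms(2)]
  have "ideal ?S (mpoly_ring V)"
  proof (rule mpoly_idealI)
    show "?S \<subseteq> mpolys V" using mpoly_ideal_subset[OF I] by auto
    show "0 \<in> ?S" using zero mpoly_ideal_zero[OF I] by simp
    show "x + y \<in> ?S" if "x \<in> ?S" "y \<in> ?S" for x y
      using that add mpoly_ideal_mult[OF I] mpoly_ideal_add[OF I] by (auto simp: distrib_left)
    show "c * x \<in> ?S" if "c \<in> mpolys V" "x \<in> ?S" for c x
      using that mpoly_ideal_mult[OF I] by (auto simp flip: mult.assoc)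
  qed
  moreover have "G \<subseteq> ?S"
  proof (safe)
    fix g assume g: "g \<in> G"
    show gi: "g \<in> gen V G" using gen_self[OF assms(2) g] .
    fix c :: "'a mpoly" assume c: "c \<in> mpolys V"
    have "P (\<Sum>m\<in>M. single m (lookup c m) * g) \<and> (\<Sum>m\<in>M. single m (lookup c m) * g) \<in> gen V G"
      if "M \<subseteq> keys c" for M
      using finite_subset[OF that finite_keys] that
    proof (induction M rule: finite_induct)
      case (insert m M)
      then have "m \<in> monomials V" using c by (auto simp: mpolys_iff)
      then show ?case
        using insert single[OF _ g] mpoly_ideal_mult[OF I _ gi, of "single m (lookup c m)"]
          mpoly_ideal_add[OF I] by (auto intro!: add)
    qed (simp add: zero mpoly_ideal_zero[OF I])
    from this[of "keys c"] show "P (c * g)"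
      by (subst poly_mapping_sum_single) (simp add: sum_distrib_right)
  qed
  ultimately have "x \<in> ?S" using gen_minimal assms(1) by blast
  then show ?thesis using mpolys_one[of V] by (metis (no_types, lifting) mem_Collect_eq mult_1)
qed

lemma set_add_mpoly: "I <+>\<^bsub>mpoly_ring V\<^esub> J = {x + y | x y. x \<in> I \<and> y \<in> J}"
  by (auto simp: set_add_def' mpoly_ring_simps)

lemma ideal_mpoly_set_add:
  assumes "ideal I (mpoly_ring V)" "ideal J (mpoly_ring V)"
  shows "ideal (I <+>\<^bsub>mpoly_ring V\<^esub> J) (mpoly_ring V)"
  by (rule mpoly_ring.add_ideals[OF assms])

lemma gen_Un:
  assumes "G \<subseteq> mpolys V" "H \<subseteq> mpolys V"
  shows "gen V (G \<union> H) = gen V G <+>\<^bsub>mpoly_ring V\<^esub> gen V H"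
proof
  note I = ideal_gen[OF assms(1)] ideal_gen[OF assms(2)]
  show "gen V (G \<union> H) \<subseteq> gen V G <+>\<^bsub>mpoly_ring V\<^esub> gen V H"
  proof (rule gen_minimal[OF ideal_mpoly_set_add[OF I]], safe)
    fix x assume "x \<in> G" then show "x \<in> gen V G <+>\<^bsub>mpoly_ring V\<^esub> gen V H"
      unfolding set_add_mpoly using gen_self[OF assms(1)] mpoly_ideal_zero[OF I(2)]
      by (metis (mono_tags, lifting) add.right_neutral mem_Collect_eq)
  next
    fix x assume "x \<in> H" then show "x \<in> gen V G <+>\<^bsub>mpoly_ring V\<^esub> gen V H"
      unfolding set_add_mpoly using gen_self[OF assms(2)] mpoly_ideal_zero[OF I(1)]
      by (metis (mono_tags, lifting) add.left_neutral mem_Collect_eq)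
  qed
  have GH: "G \<union> H \<subseteq> mpolys V" using assms by blast
  show "gen V G <+>\<^bsub>mpoly_ring V\<^esub> gen V H \<subseteq> gen V (G \<union> H)"
    unfolding set_add_mpoly
    using gen_mono[OF GH Un_upper1] gen_mono[OF GH Un_upper2] mpoly_ideal_add[OF ideal_gen[OF GH]]
    by blast
qed

lemma prod_diff_in_ideal:
  fixes f g :: "'i \<Rightarrow> 'a::comm_ring_1 mpoly"
  assumes I: "ideal I (mpoly_ring V)" and "finite A"
    and "\<And>a. a \<in> A \<Longrightarrow> f a \<in> mpolys V" "\<And>a. a \<in> A \<Longrightarrow> g a \<in> mpolys V"
    and "\<And>a. a \<in> A \<Longrightarrow> f a - g a \<in> I"
  shows "prod f A - prod g A \<in> I"
  using assms(2-)
proof (induction A rule: finite_induct)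
  case (insert a A)
  have "prod f (insert a A) - prod g (insert a A) =
      prod f A * (f a - g a) + g a * (prod f A - prod g A)"
    using insert by (simp add: algebra_simps)
  moreover have "prod f A * (f a - g a) \<in> I"
    using insert by (intro mpoly_ideal_mult[OF I] mpolys_prod) auto
  moreover have "g a * (prod f A - prod g A) \<in> I"
    using insert by (intro mpoly_ideal_mult[OF I]) auto
  ultimately show ?case using mpoly_ideal_add[OF I] by metis
qed (use mpoly_ideal_zero[OF I] in auto)

lemma det_diff_in_ideal:
  fixes A B :: "'a::comm_ring_1 mpoly mat"
  assumes I: "ideal I (mpoly_ring V)"
    and A: "A \<in> carrier_mat n n" "\<And>i j. i < n \<Longrightarrow> j < n \<Longrightarrow> A $$ (i, j) \<in> mpolys V"
    and B: "B \<in> carrier_mat n n" "\<And>i j. i < n \<Longrightarrow> j < n \<Longrightarrow> B $$ (i, j) \<in> mpolys V"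
    and AB: "\<And>i j. i < n \<Longrightarrow> j < n \<Longrightarrow> A $$ (i, j) - B $$ (i, j) \<in> I"
  shows "det A - det B \<in> I"
proof -
  have "det A - det B = (\<Sum>p | p permutes {0..<n}. signof p *
      ((\<Prod>i = 0..<n. A $$ (i, p i)) - (\<Prod>i = 0..<n. B $$ (i, p i))))"
    unfolding det_def'[OF A(1)] det_def'[OF B(1)]
    by (simp add: sum_subtractf right_diff_distrib)
  also have "\<dots> \<in> I"
  proof (intro mpoly_ideal_sum[OF I] mpoly_ideal_mult[OF I] prod_diff_in_ideal[OF I])
    fix p assume "p \<in> {p. p permutes {0..<n}}"
    then have p: "i < n \<Longrightarrow> p i < n" for i using permutes_in_image[of p "{0..<n}" i] by auto
    fix i assume "i \<in> {0..<n}"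
    then show "A $$ (i, p i) \<in> mpolys V" "B $$ (i, p i) \<in> mpolys V" "A $$ (i, p i) - B $$ (i, p i) \<in> I"
      using p A B AB by auto
  qed (auto simp: sign_def)
  finally show ?thesis .
qed

section \<open>Substitution\<close>

definition mon_eval :: "(nat \<times> nat \<Rightarrow> 'b::comm_ring_1) \<Rightarrow> mon \<Rightarrow> 'b" where
  "mon_eval s m = (\<Prod>v\<in>keys m. s v ^ lookup m v)"

lemma mon_eval_superset:
  assumes "finite A" "keys m \<subseteq> A"
  shows "mon_eval s m = (\<Prod>v\<in>A. s v ^ lookup m v)"
  unfolding mon_eval_def using assms
  by (intro prod.mono_neutral_left) (auto simp: in_keys_iff)

lemma mon_eval_add: "mon_eval s (m + n) = mon_eval s m * mon_eval s n"
proof -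
  have "keys (m + n) \<subseteq> keys m \<union> keys n" by (rule Poly_Mapping.keys_add)
  then show ?thesis
    by (simp add: mon_eval_superset[of "keys m \<union> keys n"] lookup_add power_add prod.distrib)
qed

lemma mon_eval_zero [simp]: "mon_eval s 0 = 1"
  by (simp add: mon_eval_def)

lemma mon_eval_single [simp]: "mon_eval s (single v n) = s v ^ n"
  by (cases "n = 0") (simp_all add: mon_eval_def)

definition subst :: "(nat \<times> nat \<Rightarrow> 'a::comm_ring_1 mpoly) \<Rightarrow> 'a mpoly \<Rightarrow> 'a mpoly" where
  "subst s p = (\<Sum>m\<in>keys p. single 0 (lookup p m) * mon_eval s m)"

lemma subst_superset:
  assumes "finite A" "keys p \<subseteq> A"
  shows "subst s p = (\<Sum>m\<in>A. single 0 (lookup p m) * mon_eval s m)"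
  unfolding subst_def using assms
  by (intro sum.mono_neutral_left) (auto simp: in_keys_iff)

lemma subst_add: "subst s (p + q) = subst s p + subst s q"
proof -
  have "keys (p + q) \<subseteq> keys p \<union> keys q" by (rule Poly_Mapping.keys_add)
  then show ?thesis
    by (simp add: subst_superset[of "keys p \<union> keys q"] lookup_add single_add distrib_right
        sum.distrib)
qed

lemma subst_zero [simp]: "subst s 0 = 0"
  by (simp add: subst_def)

lemma subst_sum: "subst s (sum f A) = (\<Sum>a\<in>A. subst s (f a))"
  by (induction A rule: infinite_finite_induct) (auto simp: subst_add)

lemma subst_single: "subst s (single m c) = single 0 c * mon_eval s m"
  by (cases "c = 0") (simp_all add: subst_def)

lemma subst_mult: "subst s (p * q) = subst s p * subst s q"
proof -
  have "subst s (p * q) =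
      (\<Sum>a\<in>keys p. \<Sum>b\<in>keys q. subst s (single a (lookup p a) * single b (lookup q b)))"
    by (subst (1) poly_mapping_sum_single[of p], subst (1) poly_mapping_sum_single[of q])
      (simp add: sum_product subst_sum)
  also have "\<dots> = (\<Sum>a\<in>keys p. \<Sum>b\<in>keys q.
      subst s (single a (lookup p a)) * subst s (single b (lookup q b)))"
    by (simp add: mult_single subst_single mon_eval_add mult_ac flip: mult_single[of 0 _ 0 _, simplified])
  also have "\<dots> = subst s p * subst s q"
    unfolding subst_single by (simp add: subst_def sum_product)
  finally show ?thesis .
qed

lemma subst_one [simp]: "subst s 1 = 1"
  using subst_single[of s 0 1] by simp

interpretation subst: comm_ring_hom "subst s"
  by unfold_locales (simp_all add: subst_add subst_mult)

lemma subst_const [simp]: "subst s (single 0 c) = single 0 c"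
  by (simp add: subst_single)

lemma subst_var [simp]: "subst s (monom (single v 1)) = s v"
  by (simp add: subst_single monom_def)

lemma mpolys_subst:
  assumes "\<And>v. v \<in> V \<Longrightarrow> s v \<in> mpolys W" "p \<in> mpolys V"
  shows "subst s p \<in> mpolys W"
  unfolding subst_def mon_eval_def
proof (intro mpolys_sum mpolys_mult mpolys_prod mpolys_power)
  fix m v assume "m \<in> keys p" "v \<in> keys m"
  then have "v \<in> V" using assms(2) by (auto simp: mpolys_iff monomials_def)
  then show "s v \<in> mpolys W" by (rule assms(1))
qed auto

section \<open>Term orders\<close>

lemma mono_subseq_nat:
  fixes f :: "nat \<Rightarrow> nat"
  shows "\<exists>r::nat \<Rightarrow> nat. strict_mono r \<and> (\<forall>i j. i \<le> j \<longrightarrow> f (r i) \<le> f (r j))"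
proof -
  obtain g :: "nat \<Rightarrow> nat" where g: "strict_mono g" "monoseq (\<lambda>n. f (g n))"
    using seq_monosub by blast
  from g(2) have "(\<forall>m. \<forall>n\<ge>m. f (g m) \<le> f (g n)) \<or> (\<forall>m. \<forall>n\<ge>m. f (g n) \<le> f (g m))"
    unfolding monoseq_def .
  then show ?thesis
  proof
    assume "\<forall>m. \<forall>n\<ge>m. f (g m) \<le> f (g n)"
    then show ?thesis using g(1) by (intro exI[of _ g]) simp
  next
    assume 2: "\<forall>m. \<forall>n\<ge>m. f (g n) \<le> f (g m)"
    \<comment> \<open>In a nonincreasing sequence of naturals all terms from a minimal one on are
      equal.\<close>
    obtain N where N: "\<And>n. f (g N) \<le> f (g n)"
      using ex_has_least_nat[of "\<lambda>_. True" 0 "\<lambda>n. f (g n)"] by auto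
    have "f (g (N + i)) = f (g N)" for i
      using N[of "N + i"] 2 by (simp add: le_antisym)
    moreover have "strict_mono (\<lambda>i. g (N + i))"
      using g(1) by (auto simp: strict_mono_def)
    ultimately show ?thesis by (intro exI[of _ "\<lambda>i. g (N + i)"]) auto
  qed
qed

text \<open>One coordinate at a time: thinning out a sequence to make a new coordinate nondecreasing
  keeps the earlier coordinates nondecreasing.\<close>

lemma dickson:
  fixes f :: "nat \<Rightarrow> 'v \<Rightarrow> nat"
  assumes "finite V"
  shows "\<exists>r::nat \<Rightarrow> nat. strict_mono r \<and> (\<forall>v\<in>V. \<forall>i j. i \<le> j \<longrightarrow> f (r i) v \<le> f (r j) v)"
  using assms
proof (induction V rule: finite_induct)
  case empty
  show ?case by (intro exI[of _ id]) (auto simp: strict_mono_def)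
next
  case (insert v V)
  from insert.IH obtain r :: "nat \<Rightarrow> nat" where r: "strict_mono r"
    "\<And>v i j. v \<in> V \<Longrightarrow> i \<le> j \<Longrightarrow> f (r i) v \<le> f (r j) v"
    by auto
  obtain q :: "nat \<Rightarrow> nat" where q: "strict_mono q" "\<And>i j. i \<le> j \<Longrightarrow> f (r (q i)) v \<le> f (r (q j)) v"
    using mono_subseq_nat[of "\<lambda>i. f (r i) v"] by blast
  have "strict_mono (\<lambda>i. r (q i))" using r(1) q(1) by (auto simp: strict_mono_def)
  moreover have "q i \<le> q j" if "i \<le> j" for i j
    using q(1) that by (simp add: strict_mono_less_eq)
  ultimately show ?case using r(2) q(2) by (intro exI[of _ "\<lambda>i. r (q i)"]) auto
qed

abbreviation strict_part :: "(mon \<times> mon) set \<Rightarrow> (mon \<times> mon) set" where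
  "strict_part ord \<equiv> {(m, n). (m, n) \<in> ord \<and> m \<noteq> n}"

lemma term_orderD:
  assumes "term_order V ord"
  shows term_order_carrier: "(m, n) \<in> ord \<Longrightarrow> m \<in> monomials V \<and> n \<in> monomials V"
    and term_order_refl: "m \<in> monomials V \<Longrightarrow> (m, m) \<in> ord"
    and term_order_antisym: "(m, n) \<in> ord \<Longrightarrow> (n, m) \<in> ord \<Longrightarrow> m = n"
    and term_order_trans: "(m, n) \<in> ord \<Longrightarrow> (n, q) \<in> ord \<Longrightarrow> (m, q) \<in> ord"
    and term_order_total: "m \<in> monomials V \<Longrightarrow> n \<in> monomials V \<Longrightarrow> (m, n) \<in> ord \<or> (n, m) \<in> ord"
    and term_order_zero: "m \<in> monomials V \<Longrightarrow> (0, m) \<in> ord"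
    and term_order_add: "(m, n) \<in> ord \<Longrightarrow> u \<in> monomials V \<Longrightarrow> (m + u, n + u) \<in> ord"
proof -
  have lin: "ord \<subseteq> monomials V \<times> monomials V" "refl_on (monomials V) ord" "trans ord" "antisym ord"
      "total_on (monomials V) ord"
    using assms by (auto simp: term_order_def linear_order_on_def partial_order_on_def preorder_on_def)
  show carrier: "(m, n) \<in> ord \<Longrightarrow> m \<in> monomials V \<and> n \<in> monomials V" for m n using lin(1) by blast
  show "m \<in> monomials V \<Longrightarrow> (m, m) \<in> ord" using lin(2) by (auto simp: refl_on_def)
  show "(m, n) \<in> ord \<Longrightarrow> (n, m) \<in> ord \<Longrightarrow> m = n" using lin(4) by (auto simp: antisym_def)
  show "(m, n) \<in> ord \<Longrightarrow> (n, q) \<in> ord \<Longrightarrow> (m, q) \<in> ord" using lin(3) by (auto simp: trans_def)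
  show "m \<in> monomials V \<Longrightarrow> n \<in> monomials V \<Longrightarrow> (m, n) \<in> ord \<or> (n, m) \<in> ord"
    using lin(2,5) by (cases "m = n") (auto simp: total_on_def refl_on_def)
  show "m \<in> monomials V \<Longrightarrow> (0, m) \<in> ord" using assms by (simp add: term_order_def)
  show "(m, n) \<in> ord \<Longrightarrow> u \<in> monomials V \<Longrightarrow> (m + u, n + u) \<in> ord"
    using assms carrier by (simp add: term_order_def)
qed

context
  fixes V ord
  assumes T: "term_order V ord"
begin

lemma term_order_add_mono:
  assumes "(m, n) \<in> ord" "(m', n') \<in> ord"
  shows "(m + m', n + n') \<in> ord"
proof (rule term_order_trans[OF T])
  show "(m + m', n + m') \<in> ord"
    using term_order_add[OF T assms(1)] term_order_carrier[OF T assms(2)] by blast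
  show "(n + m', n + n') \<in> ord"
    using term_order_add[OF T assms(2), of n] term_order_carrier[OF T assms(1)] by (simp add: add.commute)
qed

text \<open>Cancellation makes addition strictly monotone, so among the pairs bounded by (n, n')
  only (n, n') itself reaches n + n'. This isolates the leading coefficient of a product.\<close>

lemma term_order_add_eq:
  assumes "(m, n) \<in> ord" "(m', n') \<in> ord" "m + m' = n + n'"
  shows "m = n" "m' = n'"
proof -
  have "(n + m', n + n') \<in> ord"
    using term_order_add_mono[OF _ assms(2), of n n] term_order_refl[OF T] term_order_carrier[OF T assms(1)]
    by blast
  moreover have "(m + m', n + m') \<in> ord"
    using term_order_add_mono[OF assms(1), of m' m'] term_order_refl[OF T] term_order_carrier[OF T assms(2)]
    by blast
  ultimately have "n + m' = n + n'" using assms(3) term_order_antisym[OF T, of "n + m'" "n + n'"] by simp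
  then show "m' = n'" by simp
  then show "m = n" using assms(3) by simp
qed

lemma term_order_sum_mono:
  assumes "finite A" "\<And>a. a \<in> A \<Longrightarrow> (f a, g a) \<in> ord"
  shows "(sum f A, sum g A) \<in> ord"
  using assms
  by (induction A rule: finite_induct) (auto intro: term_order_add_mono term_order_refl[OF T])

lemma term_order_sum_eq:
  assumes "finite A" "\<And>a. a \<in> A \<Longrightarrow> (f a, g a) \<in> ord" "sum f A = sum g A" "a \<in> A"
  shows "f a = g a"
proof -
  have "(sum f (A - {a}), sum g (A - {a})) \<in> ord"
    by (rule term_order_sum_mono) (use assms in auto)
  from term_order_add_eq(1)[OF assms(2)[OF assms(4)] this] show ?thesis
    using assms by (simp add: sum.remove[of A a])
qed

lemma term_order_le_add:
  assumes "m \<in> monomials V" "u \<in> monomials V"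
  shows "(m, m + u) \<in> ord"
  using term_order_add[OF T term_order_zero[OF T assms(2)] assms(1)] by (simp add: add.commute)

lemma term_order_max:
  assumes "finite S" "S \<noteq> {}" "S \<subseteq> monomials V"
  obtains m where "m \<in> S" "\<And>n. n \<in> S \<Longrightarrow> (n, m) \<in> ord"
proof -
  have "\<exists>m\<in>S. \<forall>n\<in>S. (n, m) \<in> ord"
    using assms
  proof (induction S rule: finite_ne_induct)
    case (singleton x) then show ?case using term_order_refl[OF T] by auto
  next
    case (insert x S)
    then obtain m where m: "m \<in> S" "\<forall>n\<in>S. (n, m) \<in> ord" by auto
    with insert consider "(x, m) \<in> ord" | "(m, x) \<in> ord" using term_order_total[OF T, of x m] by auto
    then show ?case
    proof cases
      case 1 then show ?thesis using m by auto
    next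
      case 2
          then have "(n, x) \<in> ord" if "n \<in> insert x S" for n
        using that m(2) term_order_trans[OF T _ 2, of n] term_order_refl[OF T, of x] insert.prems by blast
      then show ?thesis by blast
    qed
  qed
  then show ?thesis using that by blast
qed

text \<open>By Dickson's lemma an infinite descent would contain two members the earlier of which
  divides the later, whereas divisors are smaller in a term order.\<close>

lemma wf_term_order:
  assumes "finite V"
  shows "wf (strict_part ord)"
  unfolding wf_iff_no_infinite_down_chain
proof
  assume "\<exists>f. \<forall>i. (f (Suc i), f i) \<in> strict_part ord"
  then obtain f where f: "\<And>i. (f (Suc i), f i) \<in> ord" "\<And>i. f (Suc i) \<noteq> f i" by auto
  have mon: "f i \<in> monomials V" for i using f(1) term_order_carrier[OF T] by blast
  have desc: "(f (i + d), f i) \<in> ord" for i d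
  proof (induction d)
    case 0 then show ?case using mon term_order_refl[OF T] by simp
  next
    case (Suc d)
    from term_order_trans[OF T f(1)[of "i + d"] Suc.IH] show ?case by simp
  qed
  obtain r :: "nat \<Rightarrow> nat" where r: "strict_mono r" "\<forall>v\<in>V. \<forall>i j. i \<le> j \<longrightarrow> lookup (f (r i)) v \<le> lookup (f (r j)) v"
    using dickson[OF assms, of "\<lambda>i. lookup (f i)"] by auto
  have "lookup (f (r 0)) v \<le> lookup (f (r 1)) v" for v
  proof (cases "v \<in> V")
    case True
    show ?thesis using r(2)[rule_format, OF True, of 0 1] by simp
  next
    case False
    then have "lookup (f (r 0)) v = 0" using mon[of "r 0"] unfolding monomials_iff by blast
    then show ?thesis by simp
  qed
  then have "f (r 1) = f (r 0) + (f (r 1) - f (r 0))"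
    by (intro poly_mapping_eqI) (simp add: lookup_add lookup_minus)
  then have 1: "(f (r 0), f (r 1)) \<in> ord"
    using term_order_le_add[OF mon monomials_minus[OF mon]] by metis
  obtain d where "r 1 = r 0 + Suc d"
    using less_imp_Suc_add[of "r 0" "r 1"] strict_monoD[OF r(1), of 0 1] by auto
  then have d: "(f (r 1), f (Suc (r 0))) \<in> ord" using desc[of "Suc (r 0)" d] by simp
  have "f (Suc (r 0)) = f (r 0)"
    by (rule term_order_antisym[OF T f(1) term_order_trans[OF T 1 d]])
  then show False using f(2) by blast
qed

end

text \<open>Only two-by-two minors are constrained, in the form that the diagonal is below the
  antidiagonal. This already fixes the leading monomial of every minor, because exchanges of this
  kind lead from any permutation to the decreasing one.\<close>

definition antidiagonal_exchange :: "(nat \<times> nat) set \<Rightarrow> (mon \<times> mon) set \<Rightarrow> bool" where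
  "antidiagonal_exchange V ord \<longleftrightarrow> term_order V ord \<and>
     (\<forall>i i' j j'. i < i' \<longrightarrow> j < j' \<longrightarrow> {(i, j), (i', j'), (i, j'), (i', j)} \<subseteq> V \<longrightarrow>
        (single (i, j) 1 + single (i', j') 1, single (i, j') 1 + single (i', j) 1) \<in> ord)"

text \<open>The witness is the graded reverse lexicographic order.\<close>

lemma antidiagonal_exchange_exists:
  assumes "finite V"
  shows "\<exists>ord. antidiagonal_exchange V ord"
proof -
  define deg where "deg m = (\<Sum>v\<in>V. lookup m v)" for m :: mon
  define ord where "ord = {(m, n). m \<in> monomials V \<and> n \<in> monomials V \<and>
    (deg m < deg n \<or> deg m = deg n \<and> n \<le> m)}"
  have deg_add: "deg (m + n) = deg m + deg n" for m n
    by (simp add: deg_def lookup_add sum.distrib)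
  have deg_0: "deg m = 0 \<Longrightarrow> m \<in> monomials V \<Longrightarrow> m = 0" for m
    using assms by (intro poly_mapping_eqI) (auto simp: deg_def monomials_iff)
  have deg_single: "deg (single v 1) = 1" if "v \<in> V" for v
    using assms that by (simp add: deg_def lookup_single when_def)
  have "refl_on (monomials V) ord" by (auto simp: refl_on_def ord_def)
  moreover have "trans ord" by (rule transI) (auto simp: ord_def)
  moreover have "antisym ord" by (rule antisymI) (auto simp: ord_def)
  moreover have "total_on (monomials V) ord" by (auto simp: total_on_def ord_def)
  moreover have "ord \<subseteq> monomials V \<times> monomials V" by (auto simp: ord_def)
  moreover have "(0, m) \<in> ord" if "m \<in> monomials V" for m
    using deg_0[of m] that by (cases "deg m = 0") (auto simp: ord_def deg_def)
  moreover have "(m + u, n + u) \<in> ord" if "u \<in> monomials V" "(m, n) \<in> ord" for m n u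
    using that by (auto simp: ord_def deg_add intro: add_right_mono)
  ultimately have T: "term_order V ord"
    by (auto simp: term_order_def linear_order_on_def partial_order_on_def preorder_on_def)
  moreover have "(single (i, j) 1 + single (i', j') 1, single (i, j') 1 + single (i', j) 1) \<in> ord"
    if "i < i'" "j < j'" "{(i, j), (i', j'), (i, j'), (i', j)} \<subseteq> V" for i i' j j'
  proof -
    let ?d = "single (i, j) 1 + single (i', j') 1 :: mon"
    let ?a = "single (i, j') 1 + single (i', j) 1 :: mon"
    \<comment> \<open>(i, j) is the lexicographically first of the four cells, so it decides the
      comparison. The larger exponent there makes the diagonal monomial the smaller one in
      \<open>ord\<close>, which reverses the lexicographic order.\<close>
    have "lookup ?a (i, j) < lookup ?d (i, j)"
      using that by (simp add: lookup_add lookup_single)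
    moreover have "lookup ?a v = lookup ?d v" if "v < (i, j)" for v
      using that \<open>i < i'\<close> \<open>j < j'\<close> by (auto simp: lookup_add lookup_single when_def)
    ultimately have "?a < ?d" unfolding less_poly_mapping.rep_eq less_fun_def by blast
    then show ?thesis
      using that deg_single[of "(i, j)"] deg_single[of "(i', j')"] deg_single[of "(i, j')"]
        deg_single[of "(i', j)"]
      by (auto simp: ord_def deg_add)
  qed
  ultimately show ?thesis by (auto simp: antidiagonal_exchange_def)
qed

section \<open>Leading monomials modulo a prime element\<close>

definition lead :: "'a::comm_ring_1 \<Rightarrow> (mon \<times> mon) set \<Rightarrow> 'a mpoly \<Rightarrow> mon \<Rightarrow> bool" where
  "lead c ord g m \<longleftrightarrow> \<not> c dvd lookup g m \<and> (\<forall>n. \<not> c dvd lookup g n \<longrightarrow> (n, m) \<in> ord)"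

text \<open>The whole support counts and the coefficient is 1 or -1, so the same monomial leads
  modulo every nonunit.\<close>

definition unit_lead :: "(mon \<times> mon) set \<Rightarrow> 'a::comm_ring_1 mpoly \<Rightarrow> mon \<Rightarrow> bool" where
  "unit_lead ord g m \<longleftrightarrow> lookup g m \<in> {1, -1} \<and> (\<forall>n\<in>keys g. (n, m) \<in> ord)"

text \<open>
  Polynomials are considered modulo \<open>\<pi>\<close>.  The case \<open>\<pi> = 0\<close> is that of a field; the integers with
  \<open>\<pi> = p\<close> stand for the field with \<open>p\<close> elements when characteristic zero is reduced to all primes.
\<close>

locale residue_field =
  fixes \<pi> :: "'a::idom"
  assumes not_dvd_one: "\<not> \<pi> dvd 1"
    and inverse_mod: "\<not> \<pi> dvd c \<Longrightarrow> \<exists>b. \<pi> dvd c * b - 1"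

lemma dvd_sum_one:
  fixes f :: "'i \<Rightarrow> 'a::comm_ring_1"
  assumes "finite A" "a \<in> A" "\<And>b. b \<in> A \<Longrightarrow> b \<noteq> a \<Longrightarrow> c dvd f b"
  shows "c dvd sum f A - f a"
  using assms by (auto simp: sum.remove[of A a] intro!: dvd_sum)

text \<open>Any other pair of keys with sum m + n has a member that is not below the corresponding
  leading monomial, hence a coefficient divisible by c.\<close>

lemma lead_mult:
  fixes g h :: "'a::comm_ring_1 mpoly"
  assumes prime: "\<And>a b. c dvd a * b \<Longrightarrow> c dvd a \<or> c dvd b" and T: "term_order V ord"
    and g: "lead c ord g m" and h: "lead c ord h n"
  shows "lead c ord (g * h) (m + n)" "c dvd lookup (g * h) (m + n) - lookup g m * lookup h n"
proof -
  have *: "c dvd lookup g a * lookup h b \<or> (a, m) \<in> ord \<and> (b, n) \<in> ord" for a b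
    using g h by (metis dvd_mult dvd_mult2 lead_def)
  let ?S = "\<lambda>w. {(a, b). a \<in> keys g \<and> b \<in> keys h \<and> a + b = w}"
  have fin: "finite (?S w)" for w
    by (rule finite_subset[of _ "keys g \<times> keys h"]) auto
  have "lookup g m \<noteq> 0" "lookup h n \<noteq> 0" using g h by (auto simp: lead_def)
  then have mem: "(m, n) \<in> ?S (m + n)" by (simp add: in_keys_iff)
  show 1: "c dvd lookup (g * h) (m + n) - lookup g m * lookup h n"
    unfolding lookup_mult_sum
    using dvd_sum_one[OF fin mem, of c "\<lambda>(a, b). lookup g a * lookup h b"]
      * term_order_add_eq[OF T]
    by fastforce
  have "\<not> c dvd lookup g m * lookup h n" using prime g h by (auto simp: lead_def)
  with 1 have "\<not> c dvd lookup (g * h) (m + n)"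
    by (metis dvd_diff_right_iff dvd_minus_iff minus_diff_eq)
  moreover have "(w, m + n) \<in> ord" if "\<not> c dvd lookup (g * h) w" for w
  proof -
    obtain a b where "a + b = w" "\<not> c dvd lookup g a * lookup h b"
    proof (rule ccontr)
      assume "\<not> thesis"
      then have "c dvd lookup (g * h) w"
        unfolding lookup_mult_sum using that by (intro dvd_sum) auto
      then show False using \<open>\<not> c dvd lookup (g * h) w\<close> by contradiction
    qed
    then show ?thesis using * term_order_add_mono[OF T] by blast
  qed
  ultimately show "lead c ord (g * h) (m + n)" by (simp add: lead_def)
qed

lemma lead_exists:
  assumes T: "term_order V ord" and "g \<in> mpolys V" "\<not> c dvd lookup g m"
  obtains n where "lead c ord g n"
proof -
  let ?S = "{m. \<not> c dvd lookup g m}"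
  have "?S \<subseteq> keys g" by (auto simp: in_keys_iff)
  then have "finite ?S" "?S \<noteq> {}" "?S \<subseteq> monomials V"
    using assms(2,3) by (auto simp: mpolys_iff intro: finite_subset)
  from term_order_max[OF T this] show ?thesis using that by (auto simp: lead_def)
qed

lemma unit_lead_lead: "unit_lead ord g m \<Longrightarrow> \<not> c dvd 1 \<Longrightarrow> lead c ord g m"
  by (auto simp: unit_lead_def lead_def in_keys_iff)

lemma unit_lead_nonzero: "unit_lead ord g m \<Longrightarrow> g \<noteq> 0"
  by (auto simp: unit_lead_def)

lemma unit_lead_mult:
  fixes g h :: "'a::idom mpoly"
  assumes T: "term_order V ord" and "unit_lead ord g m" "unit_lead ord h n"
  shows "unit_lead ord (g * h) (m + n)"
proof -
  note 1 = lead_mult[OF _ T unit_lead_lead[OF assms(2)] unit_lead_lead[OF assms(3)], of 0]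
  show ?thesis using 1 assms(2,3) by (auto simp: unit_lead_def lead_def in_keys_iff)
qed

lemma unit_lead_one: "term_order V ord \<Longrightarrow> unit_lead ord (1 :: 'a::comm_ring_1 mpoly) 0"
  by (auto simp: unit_lead_def intro: term_order_refl)

lemma unit_lead_prod:
  fixes g :: "'i \<Rightarrow> 'a::idom mpoly"
  assumes "term_order V ord" "\<And>a. a \<in> A \<Longrightarrow> unit_lead ord (g a) (m a)" "finite A"
  shows "unit_lead ord (prod g A) (sum m A)"
  using assms(3,2)
  by (induction A rule: finite_induct) (auto simp: unit_lead_one[OF assms(1)] intro!: unit_lead_mult[OF assms(1)])

lemma unit_lead_power:
  fixes g :: "'a::idom mpoly"
  assumes "term_order V ord" "unit_lead ord g m"
  shows "unit_lead ord (g ^ n) (\<Sum>i<n. m)"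
  using unit_lead_prod[OF assms(1), of "{..<n}" "\<lambda>_. g" "\<lambda>_. m"] assms(2) by simp

context residue_field
begin

lemma prime_mod:
  assumes "\<pi> dvd a * b"
  shows "\<pi> dvd a \<or> \<pi> dvd b"
proof (rule disjCI)
  assume "\<not> \<pi> dvd b"
  then obtain x where "\<pi> dvd b * x - 1" using inverse_mod by blast
  then have "\<pi> dvd a * b * x - a * (b * x - 1)" using assms by (intro dvd_diff) auto
  then show "\<pi> dvd a" by (simp add: algebra_simps)
qed

text \<open>Gauss's lemma for the prime \<open>\<pi>\<close>: otherwise both factors have leading
  monomials modulo \<open>\<pi>\<close>, and these add up to a leading monomial of the
  product.\<close>

lemma mpolys_prime_mod:
  assumes "finite V" "g \<in> mpolys V" "h \<in> mpolys V" "\<And>m. \<pi> dvd lookup (g * h) m"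
    and "\<not> \<pi> dvd lookup h n"
  shows "\<pi> dvd lookup g m"
proof (rule ccontr)
  obtain ord where "antidiagonal_exchange V ord"
    using antidiagonal_exchange_exists[OF assms(1)] by blast
  then have T: "term_order V ord" by (simp add: antidiagonal_exchange_def)
  assume "\<not> \<pi> dvd lookup g m"
  then obtain a b where "lead \<pi> ord g a" "lead \<pi> ord h b"
    using lead_exists[OF T] assms(2,3,5) by metis
  from lead_mult(1)[OF prime_mod T this] show False using assms(4) by (auto simp: lead_def)
qed

end

text \<open>Multivariate division with remainder. Leading coefficients 1 and -1 make it work over
  every domain, in particular over the integers.\<close>

lemma reduction:
  fixes G :: "'a::idom mpoly set"
  assumes T: "term_order V ord" and V: "finite V" and G: "G \<subseteq> mpolys V"
    and L: "\<And>g. g \<in> G \<Longrightarrow> unit_lead ord g (L g)" and p: "p \<in> mpolys V"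
  shows "\<exists>s\<in>mpolys V. p - s \<in> gen V G \<and> (\<forall>m\<in>keys s. \<forall>g\<in>G. \<forall>u. m \<noteq> u + L g)"
proof -
  define red where "red p \<longleftrightarrow> (\<exists>s\<in>mpolys V. p - s \<in> gen V G \<and> (\<forall>m\<in>keys s. \<forall>g\<in>G. \<forall>u. m \<noteq> u + L g))"
    for p :: "'a mpoly"
  note I = ideal_gen[OF G]
  have add: "red (p + q)" if "red p" "red q" for p q
  proof -
    from that obtain s t where st: "s \<in> mpolys V" "t \<in> mpolys V" "p - s \<in> gen V G" "q - t \<in> gen V G"
      "\<forall>m\<in>keys s. \<forall>g\<in>G. \<forall>u. m \<noteq> u + L g" "\<forall>m\<in>keys t. \<forall>g\<in>G. \<forall>u. m \<noteq> u + L g"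
      unfolding red_def by blast
    have "p + q - (s + t) \<in> gen V G"
      using mpoly_ideal_add[OF I st(3,4)] by (simp add: algebra_simps)
    then show ?thesis unfolding red_def using st Poly_Mapping.keys_add[of s t] by blast
  qed
  have red_0: "red 0" unfolding red_def by (rule bexI[of _ 0]) (auto intro: mpoly_ideal_zero[OF I])
  have sum: "red q" if "\<And>m c. m \<in> keys q \<Longrightarrow> red (single m c)" for q
  proof -
    have "red (\<Sum>m\<in>M. single m (lookup q m))" if "M \<subseteq> keys q" for M
      using finite_subset[OF that finite_keys] that \<open>\<And>m c. m \<in> keys q \<Longrightarrow> red (single m c)\<close>
      by (induction M rule: finite_induct) (auto intro: red_0 add)
    then show ?thesis by (subst poly_mapping_sum_single) auto
  qed
  have mon: "\<forall>c. red (single m c)" if "m \<in> monomials V" for m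
    using that
  proof (induction m rule: wf_induct_rule[OF wf_term_order[OF T V]])
    case (1 m)
    show ?case
    proof (cases "\<exists>g\<in>G. \<exists>u. m = u + L g")
      case False
      have "red (single m c)" for c
        unfolding red_def
        by (rule bexI[of _ "single m c"]) (use False 1(2) in \<open>auto intro: mpoly_ideal_zero[OF I]\<close>)
      then show ?thesis by blast
    next
      case True
      then obtain g u where g: "g \<in> G" and m: "m = u + L g" by blast
      have u: "u \<in> monomials V" using 1(2) unfolding m monomials_iff lookup_add by simp
      show ?thesis
      proof
        fix c
        \<comment> \<open>e is 1 or -1 and so its own inverse: subtracting \<open>h\<close> cancels
          the coefficient c at m and leaves only smaller monomials.\<close>
        define e where "e = lookup g (L g)"
        have e: "e * e = 1" using L[OF g] by (auto simp: unit_lead_def e_def)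
        define h where "h = single u (c * e) * g"
        have hG: "h \<in> gen V G" unfolding h_def
          by (intro mpoly_ideal_mult[OF I] mpolys_single u gen_self[OF G g])
        define q where "q = single m c - h"
        have "red q"
        proof (rule sum)
          fix n d assume n: "n \<in> keys q"
          have "lookup h m = c" by (simp add: h_def m lookup_single_mult e_def[symmetric] e mult.assoc)
          then have "n \<noteq> m" using n by (auto simp: q_def in_keys_iff lookup_minus)
          with n have nh: "lookup h n \<noteq> 0"
            by (auto simp: q_def in_keys_iff lookup_minus lookup_single when_def)
          then obtain w where w: "n = u + w"
            unfolding h_def using lookup_single_mult_eq_0[of n u] by metis
          with nh have "w \<in> keys g" by (auto simp: h_def lookup_single_mult in_keys_iff)
          then have "(w, L g) \<in> ord" using L[OF g] by (simp add: unit_lead_def)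
          from term_order_add[OF T this u] have nm: "(n, m) \<in> ord"
            by (simp add: w m add.commute)
          then have "n \<in> monomials V" using term_order_carrier[OF T] by blast
          then show "red (single n d)" using 1(1)[of n] nm \<open>n \<noteq> m\<close> by blast
        qed
        then obtain s where s: "s \<in> mpolys V" "q - s \<in> gen V G" "\<forall>m\<in>keys s. \<forall>g\<in>G. \<forall>u. m \<noteq> u + L g"
          unfolding red_def by blast
        have "single m c - s \<in> gen V G"
          using mpoly_ideal_add[OF I s(2) hG] by (simp add: q_def)
        then show "red (single m c)" unfolding red_def using s by blast
      qed
    qed
  qed
  have "red p" by (rule sum) (use mon p in \<open>auto simp: mpolys_iff\<close>)
  then show ?thesis unfolding red_def .
qed

section \<open>Minors and their leading monomials\<close>

declare One_nat_def [simp del]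

lemma permutes_less: "p permutes {0..<n} \<Longrightarrow> a < n \<Longrightarrow> p a < (n::nat)"
  using permutes_in_image[of p "{0..<n}" a] by auto

definition var :: "nat \<Rightarrow> nat \<Rightarrow> 'a::comm_ring_1 mpoly" where
  "var i j = monom (single (i, j) 1)"

definition minor :: "(nat \<Rightarrow> nat) \<Rightarrow> (nat \<Rightarrow> nat) \<Rightarrow> nat \<Rightarrow> 'a::comm_ring_1 mpoly" where
  "minor \<rho> \<sigma> n = det (mat n n (\<lambda>(a, b). var (\<rho> a) (\<sigma> b)))"

definition antidiag :: "(nat \<Rightarrow> nat) \<Rightarrow> (nat \<Rightarrow> nat) \<Rightarrow> nat \<Rightarrow> mon" where
  "antidiag \<rho> \<sigma> n = (\<Sum>a<n. single (\<rho> a, \<sigma> (n - 1 - a)) 1)"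

definition sorted_in :: "nat \<Rightarrow> nat \<Rightarrow> (nat \<Rightarrow> nat) \<Rightarrow> bool" where
  "sorted_in r n \<rho> \<longleftrightarrow> strict_mono_on {..<n} \<rho> \<and> \<rho> ` {..<n} \<subseteq> {..<r}"

definition box_minors :: "nat \<Rightarrow> nat \<Rightarrow> nat \<Rightarrow> 'a::comm_ring_1 mpoly set" where
  "box_minors r s n = {minor \<rho> \<sigma> n | \<rho> \<sigma>. sorted_in r n \<rho> \<and> sorted_in s n \<sigma>}"

lemma mpolys_var [intro]: "(i, j) \<in> V \<Longrightarrow> var i j \<in> mpolys V"
  by (auto simp: var_def)

lemma mpolys_minor [intro]:
  assumes "\<And>a b. a < n \<Longrightarrow> b < n \<Longrightarrow> (\<rho> a, \<sigma> b) \<in> V"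
  shows "minor \<rho> \<sigma> n \<in> mpolys V"
  unfolding minor_def by (intro mpolys_det) (auto intro!: mpolys_var assms)

lemma prod_monom: "(\<Prod>a\<in>A. monom (f a)) = (monom (sum f A) :: 'a::comm_ring_1 mpoly)"
  by (induction A rule: infinite_finite_induct) (auto simp: monom_def mult_single)

lemma minor_expand:
  "(minor \<rho> \<sigma> n :: 'a::comm_ring_1 mpoly) =
    (\<Sum>p | p permutes {0..<n}. single (\<Sum>a<n. single (\<rho> a, \<sigma> (p a)) 1) (signof p))"
proof -
  have "signof p * (\<Prod>a = 0..<n. mat n n (\<lambda>(a, b). var (\<rho> a) (\<sigma> b)) $$ (a, p a)) =
      (single (\<Sum>a<n. single (\<rho> a, \<sigma> (p a)) 1) (signof p) :: 'a mpoly)"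
    if p: "p permutes {0..<n}" for p
  proof -
    have "(\<Prod>a = 0..<n. mat n n (\<lambda>(a, b). var (\<rho> a) (\<sigma> b)) $$ (a, p a)) =
        (\<Prod>a<n. monom (single (\<rho> a, \<sigma> (p a)) 1) :: 'a mpoly)"
      using permutes_less[OF p]
      by (intro prod.cong) (auto simp: var_def lessThan_atLeast0)
    then have "(\<Prod>a = 0..<n. mat n n (\<lambda>(a, b). var (\<rho> a) (\<sigma> b)) $$ (a, p a)) =
        (monom (\<Sum>a<n. single (\<rho> a, \<sigma> (p a)) 1) :: 'a mpoly)"
      by (simp add: prod_monom)
    then show ?thesis by (simp add: monom_def sign_def single_uminus)
  qed
  then show ?thesis
    unfolding minor_def det_def'[OF mat_carrier] by (intro sum.cong) auto
qed

lemma lookup_perm_monomial: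
  fixes \<rho> \<sigma> p :: "nat \<Rightarrow> nat"
  assumes "inj_on \<rho> {..<n}" "inj_on \<sigma> {..<n}" "p permutes {0..<n}" "a < n" "b < n"
  shows "lookup (\<Sum>a<n. single (\<rho> a, \<sigma> (p a)) 1 :: mon) (\<rho> a, \<sigma> b) = (if p a = b then 1 else 0)"
proof -
  have p: "p c < n" if "c < n" for c using permutes_less[OF assms(3) that] .
  have "lookup (\<Sum>a<n. single (\<rho> a, \<sigma> (p a)) 1 :: mon) (\<rho> a, \<sigma> b) =
      (\<Sum>c<n. if c = a then (if p a = b then 1 else 0) else 0)"
    unfolding lookup_sum using assms p
    by (intro sum.cong) (auto simp: lookup_single when_def dest: inj_onD)
  then show ?thesis using assms(4) by simp
qed

text \<open>Used for two-by-two minors: the diagonal monomial really occurs, so a leading monomial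
  must be above it.\<close>

lemma lookup_minor_id:
  assumes "inj_on \<rho> {..<n}" "inj_on \<sigma> {..<n}"
  shows "lookup (minor \<rho> \<sigma> n :: 'a::comm_ring_1 mpoly) (\<Sum>a<n. single (\<rho> a, \<sigma> a) 1) = 1"
proof -
  have "(\<Sum>a<n. single (\<rho> a, \<sigma> (p a)) 1) = (\<Sum>a<n. single (\<rho> a, \<sigma> (id a)) (1::nat)) \<longleftrightarrow> p = id"
    if p: "p permutes {0..<n}" for p
  proof
    assume eq: "(\<Sum>a<n. single (\<rho> a, \<sigma> (p a)) 1) = (\<Sum>a<n. single (\<rho> a, \<sigma> (id a)) (1::nat))"
    have "p a = a" for a
    proof (cases "a < n")
      case True
      have "(if p a = a then 1 else 0) = (if id a = a then 1 else (0::nat))"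
        unfolding lookup_perm_monomial[OF assms p True True, symmetric]
          lookup_perm_monomial[OF assms permutes_id True True, symmetric] eq ..
      then show ?thesis by (simp split: if_splits)
    next
      case False
      then show ?thesis using p by (simp add: permutes_def)
    qed
    then show "p = id" by auto
  qed simp
  then have "lookup (minor \<rho> \<sigma> n :: 'a mpoly) (\<Sum>a<n. single (\<rho> a, \<sigma> (id a)) 1) =
      (\<Sum>p | p permutes {0..<n}. if p = id then signof p else 0)"
    unfolding minor_expand lookup_sum by (intro sum.cong) (auto simp: lookup_single when_def)
  then show ?thesis by (simp add: finite_permutations permutes_id)
qed

lemma decreasing_permutation:
  fixes p :: "nat \<Rightarrow> nat"
  assumes "p permutes {0..<n}" "\<And>a b. a < b \<Longrightarrow> b < n \<Longrightarrow> p b < p a" "a < n"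
  shows "p a = n - 1 - a"
proof -
  have lt: "p c < n" if "c < n" for c using permutes_less[OF assms(1) that] .
  \<comment> \<open>Each step loses at least one, so the value at 0 bounds p a from above and the
    value at n - 1 bounds it from below.\<close>
  have step: "p (c + d) + d \<le> p c" if "c + d < n" for c d
    using that
  proof (induction d)
    case (Suc d)
    with assms(2)[of "c + d" "c + Suc d"] show ?case by simp
  qed simp
  from step[of 0 a] step[of a "n - 1 - a"] lt[of 0] assms(3) show ?thesis by simp
qed

definition reverse_perm :: "nat \<Rightarrow> nat \<Rightarrow> nat" where
  "reverse_perm n a = (if a < n then n - 1 - a else a)"

lemma reverse_perm_permutes: "reverse_perm n permutes {0..<n}"
  by (rule bij_imp_permutes)
    (auto simp: reverse_perm_def intro!: bij_betw_byWitness[where f' = "reverse_perm n"])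

text \<open>A largest permutation monomial belongs to a decreasing permutation: transposing two
  values in increasing order replaces a diagonal pair of factors by the antidiagonal pair and would
  give a strictly larger monomial.\<close>

lemma perm_monomial_le_antidiag:
  assumes E: "antidiagonal_exchange V ord"
    and \<rho>: "strict_mono_on {..<n} \<rho>" and \<sigma>: "strict_mono_on {..<n} \<sigma>"
    and V: "\<And>a b. a < n \<Longrightarrow> b < n \<Longrightarrow> (\<rho> a, \<sigma> b) \<in> V"
    and p: "p permutes {0..<n}"
  shows "(\<Sum>a<n. single (\<rho> a, \<sigma> (p a)) 1, antidiag \<rho> \<sigma> n) \<in> ord"
proof -
  have T: "term_order V ord" using E by (simp add: antidiagonal_exchange_def)
  define P :: "(nat \<Rightarrow> nat) \<Rightarrow> mon" where "P p = (\<Sum>a<n. single (\<rho> a, \<sigma> (p a)) 1)" for p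
  let ?S = "P ` {p. p permutes {0..<n}}"
  have lt: "p a < n" if "p permutes {0..<n}" "a < n" for p a
    using permutes_less[OF that] .
  have inj: "inj_on \<rho> {..<n}" "inj_on \<sigma> {..<n}"
    using \<rho> \<sigma> by (auto intro: strict_mono_on_imp_inj_on)
  have "finite ?S" by (simp add: finite_permutations)
  moreover have "?S \<subseteq> monomials V"
    unfolding P_def using V lt by (auto intro!: monomials_sum monomials_single)
  moreover have "?S \<noteq> {}" using p by blast
  ultimately obtain m where m: "m \<in> ?S" "\<And>n. n \<in> ?S \<Longrightarrow> (n, m) \<in> ord"
    using term_order_max[OF T] by blast
  then obtain q where q: "q permutes {0..<n}" and mq: "m = P q" by blast
  have dec: "q b < q a" if "a < b" "b < n" for a b
  proof (rule ccontr)
    assume "\<not> q b < q a"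
    moreover have "q a \<noteq> q b"
      using permutes_inj[OF q] that(1) by (auto simp: inj_eq)
    ultimately have ab: "q a < q b" by simp
    define q' where "q' = q \<circ> transpose a b"
    have q': "q' permutes {0..<n}"
      unfolding q'_def using that by (intro permutes_compose[OF _ q] permutes_swap_id) auto
    let ?R = "{..<n} - {a} - {b}"
    have split: "P f = (\<Sum>c\<in>?R. single (\<rho> c, \<sigma> (f c)) 1) +
        (single (\<rho> a, \<sigma> (f a)) 1 + single (\<rho> b, \<sigma> (f b)) 1)" for f
      unfolding P_def using that
      by (simp add: sum.remove[of "{..<n}" a] sum.remove[of "{..<n} - {a}" b] ac_simps)
    have "(single (\<rho> a, \<sigma> (q a)) 1 + single (\<rho> b, \<sigma> (q b)) 1,
        single (\<rho> a, \<sigma> (q b)) 1 + single (\<rho> b, \<sigma> (q a)) 1) \<in> ord"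
    proof -
      have "a < n" using that by simp
      moreover have "\<rho> a < \<rho> b" "\<sigma> (q a) < \<sigma> (q b)"
        using \<rho> \<sigma> that ab lt[OF q] by (auto simp: strict_mono_on_def)
      ultimately show ?thesis
        using E V lt[OF q] that unfolding antidiagonal_exchange_def by auto
    qed
    moreover have R: "(\<Sum>c\<in>?R. single (\<rho> c, \<sigma> (q' c)) (1::nat)) = (\<Sum>c\<in>?R. single (\<rho> c, \<sigma> (q c)) 1)"
      by (intro sum.cong) (auto simp: q'_def transpose_def)
    moreover have "(\<Sum>c\<in>?R. single (\<rho> c, \<sigma> (q c)) 1) \<in> monomials V"
      using V lt[OF q] by (auto intro!: monomials_sum monomials_single)
    ultimately have "(P q, P q') \<in> ord"
      unfolding split[of q] split[of q'] R
      using term_order_add_mono[OF T term_order_refl[OF T]] that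
      by (auto simp: q'_def)
    moreover have "(P q', P q) \<in> ord" using m(2) q' mq by auto
    ultimately have "P q = P q'" using term_order_antisym[OF T] by blast
    then have "lookup (P q) (\<rho> a, \<sigma> (q a)) = lookup (P q') (\<rho> a, \<sigma> (q a))" by simp
    moreover have "q' a \<noteq> q a" using ab by (simp add: q'_def)
    ultimately show False
      using that lt[OF q, of a]
      by (simp add: P_def lookup_perm_monomial[OF inj q] lookup_perm_monomial[OF inj q'])
  qed
  have "P q = antidiag \<rho> \<sigma> n"
    unfolding P_def antidiag_def using decreasing_permutation[OF q dec]
    by (intro sum.cong) auto
  then show ?thesis using m(2)[of "P p"] p mq by (simp add: P_def)
qed

lemma unit_lead_minor:
  assumes E: "antidiagonal_exchange V ord"
    and \<rho>: "strict_mono_on {..<n} \<rho>" and \<sigma>: "strict_mono_on {..<n} \<sigma>"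
    and V: "\<And>a b. a < n \<Longrightarrow> b < n \<Longrightarrow> (\<rho> a, \<sigma> b) \<in> V"
  shows "unit_lead ord (minor \<rho> \<sigma> n :: 'a::comm_ring_1 mpoly) (antidiag \<rho> \<sigma> n)"
proof -
  define P :: "(nat \<Rightarrow> nat) \<Rightarrow> mon" where "P p = (\<Sum>a<n. single (\<rho> a, \<sigma> (p a)) 1)" for p
  let ?Q = "{p. p permutes {0..<n}}"
  have lt: "p a < n" if "p permutes {0..<n}" "a < n" for p a
    using permutes_less[OF that] .
  have inj: "inj_on \<rho> {..<n}" "inj_on \<sigma> {..<n}"
    using \<rho> \<sigma> by (auto intro: strict_mono_on_imp_inj_on)
  \<comment> \<open>Distinct permutations give distinct monomials, so the terms of the Leibniz
    expansion cannot cancel.\<close>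
  have eq: "p = q" if "p \<in> ?Q" "q \<in> ?Q" "P p = P q" for p q
  proof
    fix a show "p a = q a"
    proof (cases "a < n")
      case True
      have "lookup (P p) (\<rho> a, \<sigma> (p a)) = lookup (P q) (\<rho> a, \<sigma> (p a))" using that by simp
      then show ?thesis using True that(1,2) lt
        by (simp add: P_def lookup_perm_monomial[OF inj] split: if_splits)
    next
      case False
      then show ?thesis using that by (simp add: permutes_def)
    qed
  qed
  have lookup: "lookup (minor \<rho> \<sigma> n :: 'a mpoly) w = (\<Sum>p\<in>?Q. signof p when P p = w)" for w
    unfolding minor_expand lookup_sum by (simp add: P_def lookup_single)
  have rev: "reverse_perm n \<in> ?Q" by (simp add: reverse_perm_permutes)
  have anti: "antidiag \<rho> \<sigma> n = P (reverse_perm n)"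
    unfolding antidiag_def P_def by (intro sum.cong) (auto simp: reverse_perm_def)
  have "lookup (minor \<rho> \<sigma> n :: 'a mpoly) (antidiag \<rho> \<sigma> n) =
      (\<Sum>p\<in>?Q. if p = reverse_perm n then signof p else 0)"
    unfolding lookup anti using eq[OF _ rev] by (intro sum.cong) (auto simp: when_def)
  also have "\<dots> = signof (reverse_perm n)" using rev by (simp add: finite_permutations)
  finally have "lookup (minor \<rho> \<sigma> n :: 'a mpoly) (antidiag \<rho> \<sigma> n) \<in> {1, -1}"
    by (simp add: sign_def)
  moreover have "(w, antidiag \<rho> \<sigma> n) \<in> ord" if w: "w \<in> keys (minor \<rho> \<sigma> n :: 'a mpoly)" for w
  proof -
    obtain p where "p \<in> ?Q" "(signof p when P p = w) \<noteq> (0::'a)"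
      using w unfolding in_keys_iff lookup by (rule sum.not_neutral_contains_not_neutral)
    then have "p permutes {0..<n}" "P p = w" by (auto simp: when_def split: if_splits)
    then show ?thesis using perm_monomial_le_antidiag[OF E \<rho> \<sigma> V] by (auto simp: P_def)
  qed
  ultimately show ?thesis by (simp add: unit_lead_def)
qed

text \<open>Divisibility by the antidiagonal term of an n-minor of the northwest r x s block, that
  is, membership in the initial ideal which the minors are expected to have.\<close>

definition has_antidiag :: "nat \<Rightarrow> nat \<Rightarrow> nat \<Rightarrow> mon \<Rightarrow> bool" where
  "has_antidiag r s n m \<longleftrightarrow> (\<exists>\<rho> \<sigma> u. sorted_in r n \<rho> \<and> sorted_in s n \<sigma> \<and> m = u + antidiag \<rho> \<sigma> n)"

lemma lookup_antidiag:
  assumes "inj_on \<rho> {..<n}"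
  shows "lookup (antidiag \<rho> \<sigma> n) v = (if \<exists>a<n. v = (\<rho> a, \<sigma> (n - 1 - a)) then 1 else 0)"
proof (cases "\<exists>a<n. v = (\<rho> a, \<sigma> (n - 1 - a))")
  case True
  then obtain a where a: "a < n" "v = (\<rho> a, \<sigma> (n - 1 - a))" by blast
  have "lookup (antidiag \<rho> \<sigma> n) v = (\<Sum>c<n. if c = a then 1 else 0)"
    unfolding antidiag_def lookup_sum using assms a
    by (intro sum.cong) (auto simp: lookup_single when_def dest: inj_onD)
  then show ?thesis using True a by simp
next
  case False
  then show ?thesis by (auto simp: antidiag_def lookup_sum lookup_single when_def intro!: sum.neutral)
qed

lemma has_antidiagI:
  assumes \<rho>: "sorted_in r n \<rho>" and \<tau>: "\<And>a b. a < b \<Longrightarrow> b < n \<Longrightarrow> \<tau> b < \<tau> a"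
    "\<And>a. a < n \<Longrightarrow> \<tau> a < s" and m: "\<And>a. a < n \<Longrightarrow> 0 < lookup m (\<rho> a, \<tau> a)"
  shows "has_antidiag r s n m"
proof -
  define \<sigma> where "\<sigma> a = \<tau> (n - 1 - a)" for a
  have \<sigma>: "sorted_in s n \<sigma>"
    unfolding sorted_in_def using \<tau> by (auto simp: \<sigma>_def strict_mono_on_def)
  have inj: "inj_on \<rho> {..<n}" using \<rho> by (auto simp: sorted_in_def intro: strict_mono_on_imp_inj_on)
  have "lookup (antidiag \<rho> \<sigma> n) v \<le> lookup m v" for v
    using m by (auto simp: lookup_antidiag[OF inj] \<sigma>_def One_nat_def Suc_le_eq)
  then have "m = (m - antidiag \<rho> \<sigma> n) + antidiag \<rho> \<sigma> n"
    by (intro poly_mapping_eqI) (simp add: lookup_add lookup_minus)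
  then show ?thesis unfolding has_antidiag_def using \<rho> \<sigma> by blast
qed

text \<open>
  Mirsky's argument: grading the cells of \<open>S\<close> by the length of the longest antidiagonal chain
  ending there makes every level free of antidiagonal pairs.
\<close>

lemma antidiag_levels:
  assumes "\<And>\<rho> \<tau>. (\<And>a b. a < b \<Longrightarrow> b \<le> t \<Longrightarrow> \<rho> a < \<rho> b \<and> \<tau> b < \<tau> a) \<Longrightarrow>
      (\<And>a. a \<le> t \<Longrightarrow> (\<rho> a, \<tau> a) \<in> S) \<Longrightarrow> False"
  shows "\<exists>lev :: nat \<times> nat \<Rightarrow> nat. \<forall>v\<in>S. lev v < t \<and>
    (\<forall>u\<in>S. fst u < fst v \<longrightarrow> snd v < snd u \<longrightarrow> lev u < lev v)"
proof -
  \<comment> \<open>The indices run from 0 to q, so such a chain has q + 1 cells; the assumption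
    excludes chains of t + 1 cells, whence q < t.\<close>
  define chain where "chain q v \<longleftrightarrow> (\<exists>\<rho> \<tau>. (\<forall>a b. a < b \<longrightarrow> b \<le> q \<longrightarrow> \<rho> a < \<rho> b \<and> \<tau> b < \<tau> a) \<and>
      (\<forall>a\<le>q. (\<rho> a, \<tau> a) \<in> S) \<and> (\<rho> q, \<tau> q) = v)" for q :: nat and v :: "nat \<times> nat"
  have lt: "q < t" if "chain q v" for q v
  proof (rule ccontr)
    assume "\<not> q < t"
    with that show False unfolding chain_def using assms by (metis not_less order.trans)
  qed
  have chain_0: "chain 0 v" if "v \<in> S" for v
    unfolding chain_def by (intro exI[of _ "\<lambda>_. fst v"] exI[of _ "\<lambda>_. snd v"]) (use that in auto)
  have chain_Suc: "chain (Suc q) v" if "chain q u" "v \<in> S" "fst u < fst v" "snd v < snd u" for q u v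
  proof -
    from that(1) obtain \<rho> \<tau> where c: "\<forall>a b. a < b \<longrightarrow> b \<le> q \<longrightarrow> \<rho> a < \<rho> b \<and> \<tau> b < \<tau> a"
      "\<forall>a\<le>q. (\<rho> a, \<tau> a) \<in> S" "(\<rho> q, \<tau> q) = u" unfolding chain_def by blast
    have le: "\<rho> a \<le> \<rho> q \<and> \<tau> q \<le> \<tau> a" if "a \<le> q" for a
      using c(1) that by (cases "a = q") (auto simp: less_imp_le)
    show ?thesis unfolding chain_def
    proof (rule exI[of _ "\<rho>(Suc q := fst v)"], rule exI[of _ "\<tau>(Suc q := snd v)"], intro conjI allI impI)
      fix a b assume ab: "a < b" "b \<le> Suc q"
      have "\<rho> q < fst v" "snd v < \<tau> q" using c(3) that(3,4) by auto
      with c(1) le[of a] ab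
      show "(\<rho>(Suc q := fst v)) a < (\<rho>(Suc q := fst v)) b" "(\<tau>(Suc q := snd v)) b < (\<tau>(Suc q := snd v)) a"
        by (auto simp: le_Suc_eq)
    qed (use c(2) that(2) in \<open>auto simp: le_Suc_eq\<close>)
  qed
  define lev where "lev v = Max {q. chain q v}" for v
  have fin: "finite {q. chain q v}" for v
    by (rule finite_subset[of _ "{..<t}"]) (auto dest: lt)
  have lev: "chain (lev v) v" if "v \<in> S" for v
    using Max_in[OF fin[of v]] chain_0[OF that] by (auto simp: lev_def)
  show ?thesis
  proof (intro exI[of _ lev] ballI conjI impI)
    fix v assume v: "v \<in> S"
    show "lev v < t" using lt lev[OF v] .
    fix u assume u: "u \<in> S" "fst u < fst v" "snd v < snd u"
    have "Suc (lev u) \<le> lev v"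
      unfolding lev_def[of v] using chain_Suc[OF lev[OF u(1)] v u(2,3)] fin by (intro Max_ge) auto
    then show "lev u < lev v" by simp
  qed
qed

section \<open>Antidiagonal-free monomials\<close>

definition antidiag_free :: "mon \<Rightarrow> bool" where
  "antidiag_free m \<longleftrightarrow>
    (\<forall>i i' j j'. i < i' \<longrightarrow> j < j' \<longrightarrow> lookup m (i, j') = 0 \<or> lookup m (i', j) = 0)"

text \<open>Equality of row and column degrees, the grading preserved when an antidiagonal pair is
  exchanged for a diagonal one.\<close>

definition same_content :: "nat \<Rightarrow> nat \<Rightarrow> mon \<Rightarrow> mon \<Rightarrow> bool" where
  "same_content k l m n \<longleftrightarrow>
    (\<forall>i<k. (\<Sum>j<l. lookup m (i, j)) = (\<Sum>j<l. lookup n (i, j))) \<and>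
    (\<forall>j<l. (\<Sum>i<k. lookup m (i, j)) = (\<Sum>i<k. lookup n (i, j)))"

text \<open>
  A nonzero entry northeast and one southwest of the corner of the block would form an antidiagonal
  pair, so one of these two regions is empty.
\<close>

lemma antidiag_free_partial_sum:
  assumes "antidiag_free m" "i \<le> k" "j \<le> l"
  shows "(\<Sum>i'<i. \<Sum>j'<j. lookup m (i', j')) =
    min (\<Sum>i'<i. \<Sum>j'<l. lookup m (i', j')) (\<Sum>i'<k. \<Sum>j'<j. lookup m (i', j'))"
proof -
  let ?N = "\<lambda>i j. \<Sum>i'<i. \<Sum>j'<j. lookup m (i', j')"
  have le: "?N i j \<le> ?N i l" "?N i j \<le> ?N k j"
    using assms(2,3) by (auto intro!: sum_mono sum_mono2)
  consider "\<And>i' j'. i' < i \<Longrightarrow> j \<le> j' \<Longrightarrow> lookup m (i', j') = 0"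
    | "\<And>i' j'. i \<le> i' \<Longrightarrow> j' < j \<Longrightarrow> lookup m (i', j') = 0"
    using assms(1) unfolding antidiag_free_def by (metis not_less order.strict_trans1)
  then show ?thesis
  proof cases
    case 1
    then have "?N i j = ?N i l"
      using assms(3) by (intro sum.cong sum.mono_neutral_left) auto
    then show ?thesis using le by simp
  next
    case 2
    then have "?N i j = ?N k j"
      using assms(2) by (intro sum.mono_neutral_left) auto
    then show ?thesis using le by simp
  qed
qed

text \<open>The sums over northwest blocks are determined by the row and column sums, and the
  entries are recovered from them by differences. This is the northwest corner rule for
  transportation problems.\<close>

lemma antidiag_free_unique:
  assumes free: "antidiag_free m" "antidiag_free n" and "same_content k l m n"
    and mon: "m \<in> monomials (vars k l)" "n \<in> monomials (vars k l)"
  shows "m = n"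
proof -
  have cont: "(\<Sum>i'<i. \<Sum>j'<l. lookup m (i', j')) = (\<Sum>i'<i. \<Sum>j'<l. lookup n (i', j'))" if "i \<le> k" for i
    using assms(3) that by - (rule sum.cong[OF refl], auto simp: same_content_def)
  have swap: "(\<Sum>i'<k. \<Sum>j'<j. lookup x (i', j')) = (\<Sum>j'<j. \<Sum>i'<k. lookup x (i', j'))"
    for x :: mon and j by (rule sum.swap)
  have "(\<Sum>i'<k. \<Sum>j'<j. lookup m (i', j')) = (\<Sum>i'<k. \<Sum>j'<j. lookup n (i', j'))" if "j \<le> l" for j
    unfolding swap using assms(3) that
    by - (rule sum.cong[OF refl], auto simp: same_content_def)
  with cont have N: "(\<Sum>i'<i. \<Sum>j'<j. lookup m (i', j')) = (\<Sum>i'<i. \<Sum>j'<j. lookup n (i', j'))"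
    if "i \<le> k" "j \<le> l" for i j
    using that by (simp add: antidiag_free_partial_sum[OF free(1) that]
        antidiag_free_partial_sum[OF free(2) that])
  have row: "(\<Sum>j'<j. lookup m (i, j')) = (\<Sum>j'<j. lookup n (i, j'))" if "i < k" "j \<le> l" for i j
    using N[of "Suc i" j] N[of i j] that by simp
  show ?thesis
  proof (rule poly_mapping_eqI)
    fix v :: "nat \<times> nat"
    show "lookup m v = lookup n v"
    proof (cases "v \<in> vars k l")
      case True
      then obtain i j where v: "v = (i, j)" "i < k" "j < l" by auto
      then show ?thesis using row[of i "Suc j"] row[of i j] by simp
    next
      case False
      then show ?thesis using mon unfolding monomials_iff by metis
    qed
  qed
qed

lemma sum_lookup_single:
  fixes n :: nat
  shows "(\<Sum>j<n. lookup (single (a, b) (c::nat)) (i, j)) = (if i = a \<and> b < n then c else 0)"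
    and "(\<Sum>j<n. lookup (single (b, a) (c::nat)) (j, i)) = (if i = a \<and> b < n then c else 0)"
proof -
  have "(\<Sum>j<n. lookup (single (a, b) c) (i, j)) = (\<Sum>j<n. if j = b then (if i = a then c else 0) else 0)"
    by (intro sum.cong) (auto simp: lookup_single when_def)
  then show "(\<Sum>j<n. lookup (single (a, b) c) (i, j)) = (if i = a \<and> b < n then c else 0)" by simp
  have "(\<Sum>j<n. lookup (single (b, a) c) (j, i)) = (\<Sum>j<n. if j = b then (if i = a then c else 0) else 0)"
    by (intro sum.cong) (auto simp: lookup_single when_def)
  then show "(\<Sum>j<n. lookup (single (b, a) c) (j, i)) = (if i = a \<and> b < n then c else 0)" by simp
qed

text \<open>Exchanging an antidiagonal pair for the diagonal one lowers a monomial without changing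
  its content. So a smallest monomial of this content is antidiagonal-free, hence equal to m by
  uniqueness.\<close>

lemma antidiag_free_minimal:
  assumes E: "antidiagonal_exchange (vars k l) ord"
    and m: "antidiag_free m" "m \<in> monomials (vars k l)"
    and n: "n \<in> monomials (vars k l)" "same_content k l m n"
  shows "(m, n) \<in> ord"
proof -
  let ?V = "vars k l"
  have T: "term_order ?V ord" using E by (simp add: antidiagonal_exchange_def)
  let ?S = "{n \<in> monomials ?V. same_content k l m n}"
  have "n \<in> ?S" using n by simp
  then obtain n0 where n0: "n0 \<in> ?S" "\<And>n'. (n', n0) \<in> strict_part ord \<Longrightarrow> n' \<notin> ?S"
    using wfE_min[OF wf_term_order[OF T]] by (metis (no_types, lifting) finite_SigmaI finite_lessThan)
  have "antidiag_free n0"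
    unfolding antidiag_free_def
  proof (intro allI impI, rule ccontr)
    fix i i' j j' assume ij: "i < i'" "j < j'" and "\<not> (lookup n0 (i, j') = 0 \<or> lookup n0 (i', j) = 0)"
    then have pos: "0 < lookup n0 (i, j')" "0 < lookup n0 (i', j)" by auto
    have inV: "(i, j') \<in> ?V" "(i', j) \<in> ?V"
      using n0(1) pos unfolding monomials_iff by (metis (mono_tags, lifting) less_irrefl mem_Collect_eq)+
    let ?a = "single (i, j') 1 + single (i', j) 1 :: mon"
    let ?d = "single (i, j) 1 + single (i', j') 1 :: mon"
    define w where "w = n0 - ?a"
    have nw: "n0 = w + ?a"
      using pos ij by (intro poly_mapping_eqI) (auto simp: w_def lookup_add lookup_minus lookup_single when_def)
    have w: "w \<in> monomials ?V" unfolding w_def using n0(1) by auto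
    have "(?d, ?a) \<in> ord" using E ij inV unfolding antidiagonal_exchange_def by auto
    then have "(w + ?d, n0) \<in> ord"
      unfolding nw by (rule term_order_add_mono[OF T term_order_refl[OF T w]])
    moreover have "w + ?d \<noteq> n0"
    proof
      assume "w + ?d = n0"
      then have "lookup ?d (i, j) = lookup ?a (i, j)" by (simp add: nw)
      then show False using ij by (simp add: lookup_add lookup_single)
    qed
    moreover have "w + ?d \<in> monomials ?V" using calculation(1) term_order_carrier[OF T] by blast
    moreover have "same_content k l m (w + ?d)"
    proof -
      have "same_content k l (w + ?a) (w + ?d)"
        using inV ij
        unfolding same_content_def by (simp add: lookup_add sum.distrib sum_lookup_single[simplified])
      then show ?thesis using n0(1) by (simp add: same_content_def nw)
    qed
    ultimately show False using n0(2)[of "w + ?d"] by auto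
  qed
  then have "m = n0" using antidiag_free_unique[OF m(1)] n0(1) m(2) by auto
  then show ?thesis
    using n0(2)[of n] n term_order_total[OF T m(2) n(1)] term_order_refl[OF T m(2)] by auto
qed

section \<open>The generic matrix of bounded rank\<close>

abbreviation in_box :: "nat \<Rightarrow> nat \<Rightarrow> nat \<times> nat \<Rightarrow> bool" where
  "in_box r s v \<equiv> fst v < r \<and> snd v < s"

definition rank_weight :: "nat \<Rightarrow> nat \<Rightarrow> nat \<Rightarrow> nat \<Rightarrow> nat \<times> nat \<Rightarrow> nat \<Rightarrow> mon" where
  "rank_weight k l r s v a =
    (if in_box r s v then single (fst v, l + a) 1 + single (k + a, snd v) 1 else single v 1)"

text \<open>Variables outside the block are kept; the single choice 0 writes them as sums too, so
  that all variables expand uniformly.\<close>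

definition rank_choices :: "nat \<Rightarrow> nat \<Rightarrow> nat \<Rightarrow> nat \<times> nat \<Rightarrow> nat set" where
  "rank_choices r s t v = (if in_box r s v then {..<t} else {0})"

text \<open>
  The northwest \<open>r \<times> s\<close> block is replaced by the product of a generic \<open>r \<times> t\<close> and a generic
  \<open>t \<times> s\<close> matrix, whose entries are the indeterminates right of and below the \<open>k \<times> l\<close> matrix.
\<close>

definition rank_subst :: "nat \<Rightarrow> nat \<Rightarrow> nat \<Rightarrow> nat \<Rightarrow> nat \<Rightarrow> 'a::comm_ring_1 mpoly \<Rightarrow> 'a mpoly" where
  "rank_subst k l r s t =
    subst (\<lambda>v. \<Sum>a\<in>rank_choices r s t v. monom (rank_weight k l r s v a))"

interpretation rank_subst: comm_ring_hom "rank_subst k l r s t"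
  unfolding rank_subst_def by unfold_locales

lemma finite_rank_choices [simp]: "finite (rank_choices r s t v)"
  by (simp add: rank_choices_def)

lemma mpolys_rank_subst:
  assumes "p \<in> mpolys (vars k l)"
  shows "rank_subst k l r s t p \<in> mpolys (vars (k + t) (l + max t 1))"
  unfolding rank_subst_def
proof (rule mpolys_subst[OF _ assms])
  fix v assume "v \<in> vars k l"
  then show "(\<Sum>a\<in>rank_choices r s t v. monom (rank_weight k l r s v a)) \<in> mpolys (vars (k + t) (l + max t 1))"
    by (intro mpolys_sum mpolys_monom)
      (auto simp: rank_choices_def rank_weight_def intro!: monomials_add monomials_single split: if_splits)
qed

text \<open>The variable factors of a monomial, counted with multiplicity; a choice of one summand
  for each factor indexes the expansion of a product of sums.\<close>

definition occurrences :: "mon \<Rightarrow> ((nat \<times> nat) \<times> nat) set" where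
  "occurrences m = (SIGMA v:keys m. {..<lookup m v})"

lemma finite_occurrences [simp]: "finite (occurrences m)"
  by (simp add: occurrences_def)

lemma sum_occurrences: "(\<Sum>q\<in>occurrences m. single (fst q) 1) = m"
proof -
  have "(\<Sum>q\<in>occurrences m. single (fst q) 1) = (\<Sum>v\<in>keys m. \<Sum>e<lookup m v. single v 1)"
    unfolding occurrences_def by (subst sum.Sigma) (auto simp: case_prod_unfold)
  also have "\<dots> = (\<Sum>v\<in>keys m. single v (lookup m v))"
    by (intro sum.cong refl poly_mapping_eqI) (simp add: lookup_sum lookup_single when_def)
  finally show ?thesis using poly_mapping_sum_single[of m] by simp
qed

lemma mon_eval_sum_monom:
  assumes "\<And>v. finite (B v)"
  shows "mon_eval (\<lambda>v. \<Sum>a\<in>B v. monom (W v a)) m =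
    (\<Sum>c\<in>PiE (occurrences m) (\<lambda>q. B (fst q)). (monom (\<Sum>q\<in>occurrences m. W (fst q) (c q)) :: 'a::comm_ring_1 mpoly))"
proof -
  have "mon_eval (\<lambda>v. \<Sum>a\<in>B v. monom (W v a)) m =
      (\<Prod>v\<in>keys m. \<Prod>e<lookup m v. \<Sum>a\<in>B v. monom (W v a) :: 'a mpoly)"
    by (simp add: mon_eval_def)
  also have "\<dots> = (\<Prod>q\<in>occurrences m. \<Sum>a\<in>B (fst q). monom (W (fst q) a))"
    unfolding occurrences_def by (subst prod.Sigma) (auto simp: case_prod_unfold)
  also have "\<dots> = (\<Sum>c\<in>PiE (occurrences m) (\<lambda>q. B (fst q)). \<Prod>q\<in>occurrences m. monom (W (fst q) (c q)))"
    using assms by (intro prod_sum_PiE) auto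
  finally show ?thesis by (simp add: prod_monom)
qed

lemma sum_indicator:
  assumes "finite Q"
  shows "(\<Sum>q\<in>Q. if P q then 1 else 0) = card {q \<in> Q. P q}"
  using assms by (simp add: sum.If_cases Int_def)

context
  fixes k l r s :: nat and Q :: "'q set" and x :: "'q \<Rightarrow> nat \<times> nat" and c :: "'q \<Rightarrow> nat"
  assumes Q: "finite Q" and x: "\<And>q. q \<in> Q \<Longrightarrow> x q \<in> vars k l"
begin

text \<open>In the image, the exponents at (i, l + a) and, symmetrically, at (k + a, j) count the
  factors with choice a in row i and in column j. From these the contents of the pieces are read
  off.\<close>

lemma lookup_rank_weight_row:
  assumes "i < k"
  shows "lookup (\<Sum>q\<in>Q. rank_weight k l r s (x q) (c q)) (i, l + a) =
    card {q \<in> Q. (in_box r s (x q) \<and> c q = a) \<and> fst (x q) = i}"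
proof -
  have "lookup (rank_weight k l r s (x q) (c q)) (i, l + a) =
      (if (in_box r s (x q) \<and> c q = a) \<and> fst (x q) = i then 1 else 0)" if "q \<in> Q" for q
    using x[OF that] assms by (cases "x q") (auto simp: rank_weight_def lookup_add lookup_single when_def)
  then show ?thesis unfolding lookup_sum by (simp add: sum_indicator[OF Q])
qed

lemma lookup_rank_weight_col:
  assumes "j < l"
  shows "lookup (\<Sum>q\<in>Q. rank_weight k l r s (x q) (c q)) (k + a, j) =
    card {q \<in> Q. (in_box r s (x q) \<and> c q = a) \<and> snd (x q) = j}"
proof -
  have "lookup (rank_weight k l r s (x q) (c q)) (k + a, j) =
      (if (in_box r s (x q) \<and> c q = a) \<and> snd (x q) = j then 1 else 0)" if "q \<in> Q" for q
    using x[OF that] assms by (cases "x q") (auto simp: rank_weight_def lookup_add lookup_single when_def)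
  then show ?thesis unfolding lookup_sum by (simp add: sum_indicator[OF Q])
qed

lemma lookup_rank_weight_outer:
  assumes "v \<in> vars k l"
  shows "lookup (\<Sum>q\<in>Q. rank_weight k l r s (x q) (c q)) v =
    card {q \<in> Q. \<not> in_box r s (x q) \<and> x q = v}"
proof -
  have "lookup (rank_weight k l r s (x q) (c q)) v =
      (if \<not> in_box r s (x q) \<and> x q = v then 1 else 0)" if "q \<in> Q" for q
    using x[OF that] assms
    by (cases "x q"; cases v) (auto simp: rank_weight_def lookup_add lookup_single when_def)
  then show ?thesis unfolding lookup_sum by (simp add: sum_indicator[OF Q])
qed

lemma sum_part_content:
  shows "(\<Sum>j<l. lookup (\<Sum>q\<in>{q \<in> Q. P q}. single (x q) 1) (i, j)) = card {q \<in> Q. P q \<and> fst (x q) = i}"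
    and "(\<Sum>i<k. lookup (\<Sum>q\<in>{q \<in> Q. P q}. single (x q) 1) (i, j)) = card {q \<in> Q. P q \<and> snd (x q) = j}"
proof -
  let ?Q = "{q \<in> Q. P q}"
  have h: "(\<Sum>j<l. lookup (single (x q) 1) (i, j)) = (if fst (x q) = i then 1 else (0::nat))" if "q \<in> ?Q" for q
    using x[of q] that by (cases "x q") (auto simp: sum_lookup_single)
  have "(\<Sum>j<l. lookup (\<Sum>q\<in>?Q. single (x q) 1) (i, j)) = (\<Sum>q\<in>?Q. \<Sum>j<l. lookup (single (x q) (1::nat)) (i, j))"
    unfolding lookup_sum by (rule sum.swap)
  also have "\<dots> = (\<Sum>q\<in>?Q. if fst (x q) = i then 1 else 0)"
    by (rule sum.cong[OF refl h])
  finally have "(\<Sum>j<l. lookup (\<Sum>q\<in>?Q. single (x q) (1::nat)) (i, j)) = (\<Sum>q\<in>?Q. if fst (x q) = i then 1 else 0)" .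
  then show "(\<Sum>j<l. lookup (\<Sum>q\<in>?Q. single (x q) 1) (i, j)) = card {q \<in> Q. P q \<and> fst (x q) = i}"
    using Q by (simp add: sum_indicator)
  have h: "(\<Sum>i<k. lookup (single (x q) 1) (i, j)) = (if snd (x q) = j then 1 else (0::nat))" if "q \<in> ?Q" for q
    using x[of q] that by (cases "x q") (auto simp: sum_lookup_single)
  have "(\<Sum>i<k. lookup (\<Sum>q\<in>?Q. single (x q) 1) (i, j)) = (\<Sum>q\<in>?Q. \<Sum>i<k. lookup (single (x q) (1::nat)) (i, j))"
    unfolding lookup_sum by (rule sum.swap)
  also have "\<dots> = (\<Sum>q\<in>?Q. if snd (x q) = j then 1 else 0)"
    by (rule sum.cong[OF refl h])
  finally have "(\<Sum>i<k. lookup (\<Sum>q\<in>?Q. single (x q) (1::nat)) (i, j)) = (\<Sum>q\<in>?Q. if snd (x q) = j then 1 else 0)" .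
  then show "(\<Sum>i<k. lookup (\<Sum>q\<in>?Q. single (x q) 1) (i, j)) = card {q \<in> Q. P q \<and> snd (x q) = j}"
    using Q by (simp add: sum_indicator)
qed

lemma lookup_sum_single:
  "lookup (\<Sum>q\<in>{q \<in> Q. P q}. single (x q) (1::nat)) v = card {q \<in> Q. P q \<and> x q = v}"
proof -
  have "lookup (\<Sum>q\<in>{q \<in> Q. P q}. single (x q) (1::nat)) v = (\<Sum>q\<in>{q \<in> Q. P q}. if x q = v then 1 else 0)"
    unfolding lookup_sum by (intro sum.cong) (auto simp: lookup_single when_def)
  then show ?thesis using Q by (simp add: sum_indicator)
qed

lemma monomials_part: "(\<Sum>q\<in>{q \<in> Q. P q}. single (x q) (1::nat)) \<in> monomials (vars k l)"
  using x by (auto intro!: monomials_sum monomials_single)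

lemma sum_parts:
  assumes "\<And>q. q \<in> Q \<Longrightarrow> c q \<in> rank_choices r s t (x q)"
  shows "(\<Sum>q\<in>Q. single (x q) (1::nat)) =
    (\<Sum>q\<in>{q \<in> Q. \<not> in_box r s (x q)}. single (x q) 1) +
    (\<Sum>a<t. \<Sum>q\<in>{q \<in> Q. in_box r s (x q) \<and> c q = a}. single (x q) 1)"
proof -
  have "c q < t" if "q \<in> Q" "in_box r s (x q)" for q
    using assms[OF that(1)] that(2) by (simp add: rank_choices_def)
  then have "(\<Sum>a<t. \<Sum>q\<in>{q \<in> {q \<in> Q. in_box r s (x q)}. c q = a}. single (x q) (1::nat)) =
      (\<Sum>q\<in>{q \<in> Q. in_box r s (x q)}. single (x q) 1)"
    using Q by (intro sum.group) auto
  moreover have "Q = {q \<in> Q. \<not> in_box r s (x q)} \<union> {q \<in> Q. in_box r s (x q)}" by blast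
  then have "(\<Sum>q\<in>Q. single (x q) (1::nat)) = (\<Sum>q\<in>{q \<in> Q. \<not> in_box r s (x q)}. single (x q) 1) +
      (\<Sum>q\<in>{q \<in> Q. in_box r s (x q)}. single (x q) 1)"
    using Q by (subst (1) \<open>Q = _\<close>, intro sum.union_disjoint) auto
  ultimately show ?thesis by (simp add: conj_assoc)
qed

end

text \<open>
  Split the monomial \<open>m\<close> along levels into \<open>t\<close> antidiagonal-free pieces and read off the
  monomial \<open>T\<close> in which the \<open>a\<close>-th piece contributes its row and column content to the \<open>a\<close>-th
  column and row of the two factors.  Pieces of any other monomial contributing to \<open>T\<close> have the same
  contents, so they are larger; hence \<open>T\<close> arises from the leading monomial only, and only once.
\<close>

lemma rank_subst_lead:
  fixes g :: "'a::comm_ring_1 mpoly"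
  assumes E: "antidiagonal_exchange (vars k l) ord" and lead: "lead c ord g m"
    and m: "\<not> has_antidiag r s (Suc t) m"
  shows "\<exists>T. \<not> c dvd lookup (rank_subst k l r s t g) T"
proof -
  let ?V = "vars k l"
  have T: "term_order ?V ord" using E by (simp add: antidiagonal_exchange_def)
  have mV: "m \<in> monomials ?V"
    using lead term_order_carrier[OF T] unfolding lead_def by blast
  let ?S = "{v \<in> keys m. in_box r s v}"
  have "\<exists>lev :: nat \<times> nat \<Rightarrow> nat. \<forall>v\<in>?S. lev v < t \<and>
    (\<forall>u\<in>?S. fst u < fst v \<longrightarrow> snd v < snd u \<longrightarrow> lev u < lev v)"
  proof (rule antidiag_levels)
    fix \<rho> \<tau> :: "nat \<Rightarrow> nat"
    assume c: "\<And>a b. a < b \<Longrightarrow> b \<le> t \<Longrightarrow> \<rho> a < \<rho> b \<and> \<tau> b < \<tau> a" "\<And>a. a \<le> t \<Longrightarrow> (\<rho> a, \<tau> a) \<in> ?S"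
    have "has_antidiag r s (Suc t) m"
    proof (rule has_antidiagI)
      show "sorted_in r (Suc t) \<rho>"
        using c by (auto simp: sorted_in_def strict_mono_on_def)
      show "0 < lookup m (\<rho> a, \<tau> a)" if "a < Suc t" for a
        using c(2)[of a] that by (auto simp: in_keys_iff)
    qed (use c in auto)
    then show False using m by contradiction
  qed
  then obtain lev where lev: "\<And>v. v \<in> ?S \<Longrightarrow> lev v < t"
    "\<And>u v. u \<in> ?S \<Longrightarrow> v \<in> ?S \<Longrightarrow> fst u < fst v \<Longrightarrow> snd v < snd u \<Longrightarrow> lev u < lev v"
    by blast
  define d where "d v = (if in_box r s v then lev v else 0)" for v
  \<comment> \<open>The monomial picked out by the choice f when the image of n is expanded.\<close>
  define tm where "tm n f = (\<Sum>q\<in>occurrences n. rank_weight k l r s (fst q) (f q))"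
    for n and f :: "(nat \<times> nat) \<times> nat \<Rightarrow> nat"
  define T where "T = tm m (d \<circ> fst)"
  define part where "part n f a = (\<Sum>q\<in>{q \<in> occurrences n. in_box r s (fst q) \<and> f q = a}. single (fst q) (1::nat))"
    for n and f :: "(nat \<times> nat) \<times> nat \<Rightarrow> nat" and a
  define outer where "outer n = (\<Sum>q\<in>{q \<in> occurrences n. \<not> in_box r s (fst q)}. single (fst q) (1::nat))" for n
  define ch where "ch n = PiE (occurrences n) (\<lambda>q. rank_choices r s t (fst q))" for n
  have occ: "fst q \<in> ?V" if "n \<in> monomials ?V" "q \<in> occurrences n" for n q
    using that by (auto simp: occurrences_def monomials_def)
  have dch: "d (fst q) \<in> rank_choices r s t (fst q)" if "q \<in> occurrences m" for q
    using lev(1)[of "fst q"] that by (auto simp: d_def rank_choices_def occurrences_def)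
  have chD: "f q \<in> rank_choices r s t (fst q)" if "f \<in> ch n" "q \<in> occurrences n" for f n q
    using that by (auto simp: ch_def)
  have lookup_part: "lookup (part m f a) v =
      card {q \<in> occurrences m. (in_box r s (fst q) \<and> f q = a) \<and> fst q = v}" for f a v
    unfolding part_def by (rule lookup_sum_single[OF finite_occurrences occ[OF mV]])
  have free: "antidiag_free (part m (d \<circ> fst) a)" for a
    unfolding antidiag_free_def
  proof (intro allI impI, rule ccontr)
    fix i i' j j' assume ij: "i < i'" "j < j'"
      "\<not> (lookup (part m (d \<circ> fst) a) (i, j') = 0 \<or> lookup (part m (d \<circ> fst) a) (i', j) = 0)"
    have "v \<in> ?S \<and> lev v = a" if "lookup (part m (d \<circ> fst) a) v \<noteq> 0" for v
    proof -
      from that have "card {q \<in> occurrences m. (in_box r s (fst q) \<and> (d \<circ> fst) q = a) \<and> fst q = v} \<noteq> 0"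
        unfolding lookup_part .
      then have "{q \<in> occurrences m. (in_box r s (fst q) \<and> (d \<circ> fst) q = a) \<and> fst q = v} \<noteq> {}"
        by (metis card.empty)
      then show ?thesis by (auto simp: occurrences_def d_def)
    qed
    then show False using lev(2)[of "(i, j')" "(i', j)"] ij by force
  qed
  have decomp: "n = outer n + (\<Sum>a<t. part n f a)" if "n \<in> monomials ?V" "f \<in> ch n" for n f
    using sum_parts[of "occurrences n" fst k l f r s t] occ[OF that(1)] chD[OF that(2)] sum_occurrences[of n]
    by (simp add: outer_def part_def)
  have decomp_m: "m = outer m + (\<Sum>a<t. part m (d \<circ> fst) a)"
    using sum_parts[of "occurrences m" fst k l "d \<circ> fst" r s t] occ[OF mV] dch sum_occurrences[of m]
    by (simp add: outer_def part_def)
  have row_part: "(\<Sum>j<l. lookup (part n f a) (i, j)) =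
      card {q \<in> occurrences n. (in_box r s (fst q) \<and> f q = a) \<and> fst (fst q) = i}"
    and col_part: "(\<Sum>i<k. lookup (part n f a) (i, j)) =
      card {q \<in> occurrences n. (in_box r s (fst q) \<and> f q = a) \<and> snd (fst q) = j}"
    and out_part: "lookup (outer n) v = card {q \<in> occurrences n. \<not> in_box r s (fst q) \<and> fst q = v}"
    and row_tm: "i < k \<Longrightarrow> lookup (tm n f) (i, l + a) =
      card {q \<in> occurrences n. (in_box r s (fst q) \<and> f q = a) \<and> fst (fst q) = i}"
    and col_tm: "j < l \<Longrightarrow> lookup (tm n f) (k + a, j) =
      card {q \<in> occurrences n. (in_box r s (fst q) \<and> f q = a) \<and> snd (fst q) = j}"
    and out_tm: "v \<in> ?V \<Longrightarrow> lookup (tm n f) v =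
      card {q \<in> occurrences n. \<not> in_box r s (fst q) \<and> fst q = v}"
    if "n \<in> monomials ?V" for n f a i j v
    unfolding part_def outer_def tm_def
    by (rule sum_part_content(1)[OF finite_occurrences occ[OF that]]
      sum_part_content(2)[OF finite_occurrences occ[OF that]]
      lookup_sum_single[OF finite_occurrences occ[OF that]]
      lookup_rank_weight_row[OF finite_occurrences occ[OF that]]
      lookup_rank_weight_col[OF finite_occurrences occ[OF that]]
      lookup_rank_weight_outer[OF finite_occurrences occ[OF that]]; assumption)+
  have cmp: "(part m (d \<circ> fst) a, part n f a) \<in> ord" "outer m = outer n"
    if n: "n \<in> monomials ?V" and eq: "tm n f = T" for n f a
  proof -
    note row = row_part[OF n] row_part[OF mV] row_tm[OF n] row_tm[OF mV]
      and col = col_part[OF n] col_part[OF mV] col_tm[OF n] col_tm[OF mV]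
      and out = out_part[OF n] out_part[OF mV] out_tm[OF n] out_tm[OF mV]
    have "same_content k l (part m (d \<circ> fst) a) (part n f a)"
      unfolding same_content_def
    proof (intro conjI allI impI)
      fix i assume "i < k"
      have "lookup (tm n f) (i, l + a) = lookup T (i, l + a)" by (simp add: eq)
      then show "(\<Sum>j<l. lookup (part m (d \<circ> fst) a) (i, j)) = (\<Sum>j<l. lookup (part n f a) (i, j))"
        unfolding T_def row(1,2) row(3,4)[OF \<open>i < k\<close>] by (rule sym)
    next
      fix j assume "j < l"
      have "lookup (tm n f) (k + a, j) = lookup T (k + a, j)" by (simp add: eq)
      then show "(\<Sum>i<k. lookup (part m (d \<circ> fst) a) (i, j)) = (\<Sum>i<k. lookup (part n f a) (i, j))"
        unfolding T_def col(1,2) col(3,4)[OF \<open>j < l\<close>] by (rule sym)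
    qed
    then show "(part m (d \<circ> fst) a, part n f a) \<in> ord"
      using free monomials_part[of "occurrences m" fst k l, OF finite_occurrences occ[OF mV]]
        monomials_part[of "occurrences n" fst k l, OF finite_occurrences occ[OF n]]
      by (intro antidiag_free_minimal[OF E]) (auto simp: part_def)
    show "outer m = outer n"
    proof (rule poly_mapping_eqI)
      fix v
      show "lookup (outer m) v = lookup (outer n) v"
      proof (cases "v \<in> ?V")
        case True
        have "lookup (tm n f) v = lookup T v" by (simp add: eq)
        then show ?thesis
          unfolding T_def out(1,2) out(3,4)[OF True] by (rule sym)
      next
        case False
        have "outer n' \<in> monomials ?V" if "n' \<in> monomials ?V" for n'
          unfolding outer_def by (rule monomials_part[OF finite_occurrences occ[OF that]])
        from this[OF mV] this[OF n] show ?thesis using False unfolding monomials_iff by metis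
      qed
    qed
  qed
  \<comment> \<open>Summing the comparisons over the pieces: a monomial that contributes to
    \<open>T\<close> cannot be smaller than m.\<close>
  have le: "(m, n) \<in> ord" if "n \<in> monomials ?V" "f \<in> ch n" "tm n f = T" for n f
  proof -
    have "outer n \<in> monomials ?V"
      unfolding outer_def by (rule monomials_part[OF finite_occurrences occ[OF that(1)]])
    then have "(outer m + (\<Sum>a<t. part m (d \<circ> fst) a), outer n + (\<Sum>a<t. part n f a)) \<in> ord"
      using cmp[OF that(1,3)]
      by (auto intro!: term_order_add_mono[OF T] term_order_sum_mono[OF T] term_order_refl[OF T])
    then show ?thesis using decomp[OF that(1,2)] decomp_m by simp
  qed
  have uniq: "f q = d (fst q)" if f: "f \<in> ch m" "tm m f = T" and q: "q \<in> occurrences m" for f q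
  proof (cases "in_box r s (fst q)")
    case False
    then show ?thesis using chD[OF f(1) q] by (auto simp: rank_choices_def d_def split: if_splits)
  next
    case True
    then have a: "f q < t" using chD[OF f(1) q] by (simp add: rank_choices_def)
    \<comment> \<open>Equal sums of termwise comparable pieces force equality piece by piece. The
      piece with number f q contains the cell of q, which therefore has that level.\<close>
    have "(\<Sum>a<t. part m (d \<circ> fst) a) = (\<Sum>a<t. part m f a)"
      using decomp[OF mV f(1)] decomp_m by (metis add_left_cancel)
    then have "part m (d \<circ> fst) (f q) = part m f (f q)"
      by (rule term_order_sum_eq[OF T finite_lessThan cmp(1)[OF mV f(2)]]) (use a in auto)
    then have "lookup (part m (d \<circ> fst) (f q)) (fst q) = lookup (part m f (f q)) (fst q)" by simp
    then have "card {q' \<in> occurrences m. (in_box r s (fst q') \<and> (d \<circ> fst) q' = f q) \<and> fst q' = fst q} =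
        card {q' \<in> occurrences m. (in_box r s (fst q') \<and> f q' = f q) \<and> fst q' = fst q}"
      unfolding lookup_part .
    moreover have "q \<in> {q' \<in> occurrences m. (in_box r s (fst q') \<and> f q' = f q) \<and> fst q' = fst q}"
      using q True by simp
    then have "card {q' \<in> occurrences m. (in_box r s (fst q') \<and> f q' = f q) \<and> fst q' = fst q} \<noteq> 0"
      by (metis (no_types, lifting) card_eq_0_iff empty_iff finite_occurrences finite_subset mem_Collect_eq subsetI)
    ultimately have "{q' \<in> occurrences m. (in_box r s (fst q') \<and> (d \<circ> fst) q' = f q) \<and> fst q' = fst q} \<noteq> {}"
      by (metis card.empty)
    then show ?thesis by auto
  qed
  let ?C = "\<lambda>n. {f \<in> ch n. tm n f = T}"
  have fin: "finite (ch n)" for n unfolding ch_def by (intro finite_PiE) auto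
  have "lookup (rank_subst k l r s t g) T = (\<Sum>n\<in>keys g. lookup g n * of_nat (card (?C n)))"
  proof -
    have "lookup (mon_eval (\<lambda>v. \<Sum>a\<in>rank_choices r s t v. monom (rank_weight k l r s v a)) n :: 'a mpoly) T =
        of_nat (card (?C n))" for n
    proof -
      have "lookup (mon_eval (\<lambda>v. \<Sum>a\<in>rank_choices r s t v. monom (rank_weight k l r s v a)) n :: 'a mpoly) T =
          (\<Sum>f\<in>ch n. if tm n f = T then 1 else 0)"
        unfolding mon_eval_sum_monom[OF finite_rank_choices]
        by (simp add: lookup_sum ch_def tm_def monom_def lookup_single when_def)
      then show ?thesis using fin[of n] by (simp add: sum.If_cases Int_def)
    qed
    then show ?thesis
      by (simp add: rank_subst_def subst_def lookup_sum lookup_const_mult)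
  qed
  moreover have "m \<in> keys g" using lead by (auto simp: lead_def in_keys_iff)
  \<comment> \<open>Keys other than m contribute nothing modulo c: either their coefficient is
    divisible by c, or they are below m and no choice produces \<open>T\<close>.\<close>
  moreover have "c dvd lookup g n * of_nat (card (?C n))" if n: "n \<in> keys g" "n \<noteq> m" for n
  proof (cases "c dvd lookup g n")
    case False
    then have nm: "(n, m) \<in> ord" using lead by (simp add: lead_def)
    have nV: "n \<in> monomials ?V" using nm term_order_carrier[OF T] by blast
    have "?C n = {}" using le[OF nV] nm n(2) term_order_antisym[OF T] by blast
    then show ?thesis by (simp only: card.empty of_nat_0 mult_zero_right dvd_0_right)
  qed simp
  ultimately have "c dvd lookup (rank_subst k l r s t g) T - lookup g m * of_nat (card (?C m))"
    using dvd_sum_one[OF finite_keys, of m g c "\<lambda>n. lookup g n * of_nat (card (?C n))"] by simp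
  moreover have "?C m = {restrict (d \<circ> fst) (occurrences m)}"
  proof -
    have "restrict (d \<circ> fst) (occurrences m) \<in> ?C m"
      using dch by (auto simp: ch_def T_def tm_def)
    moreover have "f = restrict (d \<circ> fst) (occurrences m)" if "f \<in> ?C m" for f
    proof -
      have "f \<in> ch m" "tm m f = T" using that by auto
      then show ?thesis
        using uniq by (intro PiE_ext[of f "occurrences m" "\<lambda>q. rank_choices r s t (fst q)"])
          (use dch in \<open>auto simp: ch_def\<close>)
    qed
    ultimately show ?thesis by blast
  qed
  then have "card (?C m) = 1" by (simp only: card.empty card_insert_disjoint finite.emptyI empty_iff not_False_eq_True One_nat_def)
  ultimately have "c dvd lookup (rank_subst k l r s t g) T - lookup g m" by simp
  then have "\<not> c dvd lookup (rank_subst k l r s t g) T"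
    using lead unfolding lead_def by (metis dvd_diff_right_iff dvd_minus_iff minus_diff_eq)
  then show ?thesis by blast
qed

section \<open>Determinantal ideals are prime\<close>

text \<open>Padding both factors with zeros to size n makes multiplicativity of the determinant
  applicable; row t of the second padded factor vanishes.\<close>

lemma det_low_rank:
  fixes f g :: "nat \<Rightarrow> nat \<Rightarrow> 'a::comm_ring_1"
  assumes "t < n"
  shows "det (mat n n (\<lambda>(a, b). \<Sum>c<t. f a c * g c b)) = 0"
proof -
  let ?A = "mat n n (\<lambda>(a, c). if c < t then f a c else 0)"
  let ?B = "mat n n (\<lambda>(c, b). if c < t then g c b else 0)"
  have "mat n n (\<lambda>(a, b). \<Sum>c<t. f a c * g c b) = ?A * ?B"
  proof (rule eq_matI)
    fix a b assume "a < dim_row (?A * ?B)" "b < dim_col (?A * ?B)"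
    then have ab: "a < n" "b < n" by auto
    have "(?A * ?B) $$ (a, b) = (\<Sum>c = 0..<n. (if c < t then f a c else 0) * (if c < t then g c b else 0))"
      using ab by (simp add: scalar_prod_def)
    also have "\<dots> = (\<Sum>c<t. f a c * g c b)"
      using assms by (intro sum.mono_neutral_cong_right) auto
    finally show "mat n n (\<lambda>(a, b). \<Sum>c<t. f a c * g c b) $$ (a, b) = (?A * ?B) $$ (a, b)"
      using ab by simp
  qed auto
  then have "det (mat n n (\<lambda>(a, b). \<Sum>c<t. f a c * g c b)) = det ?A * det ?B"
    by (simp add: det_mult[of _ n])
  moreover have "det ?B = 0"
  proof -
    have "(\<Prod>i = 0..<n. ?B $$ (i, p i)) = 0" if "p permutes {0..<n}" for p
      using assms permutes_less[OF that, of t] by (intro prod_zero) (auto intro!: bexI[of _ t])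
    then show ?thesis by (subst det_def'[of _ n]) auto
  qed
  ultimately show ?thesis by simp
qed

lemma rank_subst_var:
  assumes "i < r" "j < s"
  shows "rank_subst k l r s t (var i j) = (\<Sum>c<t. var i (l + c) * var (k + c) j)"
  using assms
  by (simp add: rank_subst_def var_def rank_choices_def rank_weight_def)
    (simp add: monom_def mult_single)

lemma rank_subst_minor:
  assumes "\<And>a. a < n \<Longrightarrow> \<rho> a < r" "\<And>a. a < n \<Longrightarrow> \<sigma> a < s" "t < n"
  shows "rank_subst k l r s t (minor \<rho> \<sigma> n) = (0 :: 'a::comm_ring_1 mpoly)"
proof -
  have "rank_subst k l r s t (minor \<rho> \<sigma> n :: 'a mpoly) =
      det (map_mat (rank_subst k l r s t) (mat n n (\<lambda>(a, b). var (\<rho> a) (\<sigma> b))))"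
    by (simp add: minor_def)
  also have "map_mat (rank_subst k l r s t) (mat n n (\<lambda>(a, b). var (\<rho> a) (\<sigma> b))) =
      mat n n (\<lambda>(a, b). \<Sum>c<t. var (\<rho> a) (l + c) * var (k + c) (\<sigma> b))"
    using assms by (intro eq_matI) (auto simp: rank_subst_var)
  finally show ?thesis
    using det_low_rank[OF assms(3), of "\<lambda>a c. var (\<rho> a) (l + c)" "\<lambda>c b. var (k + c) (\<sigma> b) :: 'a mpoly"]
    by (rule trans)
qed

context residue_field
begin

text \<open>The constant \<open>\<pi>\<close> among the generators makes this the preimage of the
  ideal generated by G over the residue field.\<close>

definition det_ideal :: "nat \<Rightarrow> nat \<Rightarrow> 'a mpoly set \<Rightarrow> 'a mpoly set" where
  "det_ideal k l G = gen (vars k l) (insert (single 0 \<pi>) G)"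

end

lemma sorted_in_less: "sorted_in r n \<rho> \<Longrightarrow> a < n \<Longrightarrow> \<rho> a < r"
  by (auto simp: sorted_in_def)

lemma box_minors_mpolys:
  assumes "r \<le> k" "s \<le> l"
  shows "(box_minors r s n :: 'a::comm_ring_1 mpoly set) \<subseteq> mpolys (vars k l)"
proof
  fix x :: "'a mpoly" assume "x \<in> box_minors r s n"
  then obtain \<rho> \<sigma> where x: "x = minor \<rho> \<sigma> n" and h: "sorted_in r n \<rho>" "sorted_in s n \<sigma>"
    unfolding box_minors_def by blast
  have "(\<rho> a, \<sigma> b) \<in> vars k l" if "a < n" "b < n" for a b
    using sorted_in_less[OF h(1) that(1)] sorted_in_less[OF h(2) that(2)] assms by auto
  then show "x \<in> mpolys (vars k l)" unfolding x by (rule mpolys_minor)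
qed

lemma box_minors_Union_mpolys:
  assumes "A \<subseteq> {1..k} \<times> {1..l}"
  shows "(\<Union>(r, s)\<in>A. box_minors r s (Suc (t r s)) :: 'a::comm_ring_1 mpoly set) \<subseteq> mpolys (vars k l)"
proof (rule UN_least)
  fix a assume "a \<in> A"
  then obtain r s where a: "a = (r, s)" "r \<le> k" "s \<le> l" using assms by (cases a) auto
  show "(case a of (r, s) \<Rightarrow> box_minors r s (Suc (t r s))) \<subseteq> (mpolys (vars k l) :: 'a mpoly set)"
    unfolding a(1) prod.case by (rule box_minors_mpolys[OF a(2,3)])
qed

context residue_field
begin

lemma det_ideal_gens: "G \<subseteq> mpolys (vars k l) \<Longrightarrow> insert (single 0 \<pi>) G \<subseteq> mpolys (vars k l)"
  by auto

lemma ideal_det_ideal: "G \<subseteq> mpolys (vars k l) \<Longrightarrow> ideal (det_ideal k l G) (mpoly_ring (vars k l))"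
  unfolding det_ideal_def by (intro ideal_gen det_ideal_gens)

lemma det_ideal_self: "G \<subseteq> mpolys (vars k l) \<Longrightarrow> x \<in> G \<Longrightarrow> x \<in> det_ideal k l G"
  unfolding det_ideal_def by (intro gen_self[OF det_ideal_gens]) auto

lemma det_ideal_minimal:
  "ideal I (mpoly_ring (vars k l)) \<Longrightarrow> single 0 \<pi> \<in> I \<Longrightarrow> G \<subseteq> I \<Longrightarrow> det_ideal k l G \<subseteq> I"
  unfolding det_ideal_def by (intro gen_minimal) auto

lemma det_ideal_Un:
  assumes "G \<subseteq> mpolys (vars k l)" "H \<subseteq> mpolys (vars k l)"
  shows "det_ideal k l (G \<union> H) = det_ideal k l G <+>\<^bsub>mpoly_ring (vars k l)\<^esub> det_ideal k l H"
proof -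
  have "insert (single 0 \<pi>) (G \<union> H) = insert (single 0 \<pi>) G \<union> insert (single 0 \<pi>) H" by auto
  then show ?thesis unfolding det_ideal_def
    by (simp only: gen_Un[OF det_ideal_gens[OF assms(1)] det_ideal_gens[OF assms(2)]])
qed

lemma residue_mem:
  assumes "ideal I (mpoly_ring V)" "single 0 \<pi> \<in> I" "g \<in> mpolys V" "\<And>m. \<pi> dvd lookup g m"
  shows "g \<in> I"
proof -
  obtain h where h: "g = single 0 \<pi> * h" "keys h \<subseteq> keys g"
    using mpolys_factor_const[OF assms(4)] .
  then have "h \<in> mpolys V" using assms(3) by (auto simp: mpolys_iff)
  from mpoly_ideal_mult[OF assms(1) this assms(2)] show ?thesis by (simp add: h(1) mult.commute)
qed

lemma det_ideal_rank_subst: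
  assumes "r \<le> k" "s \<le> l" "x \<in> det_ideal k l (box_minors r s (Suc t))"
  shows "\<pi> dvd lookup (rank_subst k l r s t x) m"
proof -
  let ?I = "{x \<in> mpolys (vars k l). \<forall>m. \<pi> dvd lookup (rank_subst k l r s t x) m}"
  have "ideal ?I (mpoly_ring (vars k l))"
  proof (rule mpoly_idealI)
    fix c x :: "'a mpoly" assume "c \<in> mpolys (vars k l)" "x \<in> ?I"
    then show "c * x \<in> ?I"
      by (auto simp: rank_subst.hom_mult lookup_mult_sum intro!: dvd_sum)
  qed (auto simp: rank_subst.hom_add lookup_add)
  moreover have "single 0 \<pi> \<in> ?I"
    by (auto simp: rank_subst_def lookup_single when_def)
  moreover have "box_minors r s (Suc t) \<subseteq> ?I"
    using box_minors_mpolys[OF assms(1,2), of "Suc t"]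
    by (auto simp: box_minors_def rank_subst_minor sorted_in_less)
  ultimately show ?thesis using det_ideal_minimal assms(3) by blast
qed

lemma lead_det_ideal:
  assumes "antidiagonal_exchange (vars k l) ord" "r \<le> k" "s \<le> l"
    "x \<in> det_ideal k l (box_minors r s (Suc t))" "lead \<pi> ord x m"
  shows "has_antidiag r s (Suc t) m"
  using rank_subst_lead[OF assms(1,5)] det_ideal_rank_subst[OF assms(2-4)] by blast

text \<open>If x is in the kernel, so is its remainder y modulo the minors. But no monomial of y
  contains a long antidiagonal, so by \<open>rank_subst_lead\<close> its image is nonzero modulo
  \<open>\<pi>\<close> unless y itself vanishes modulo \<open>\<pi>\<close>.\<close>

lemma det_ideal_iff_rank_subst:
  assumes rk: "r \<le> k" and sl: "s \<le> l"
  shows "x \<in> det_ideal k l (box_minors r s (Suc t)) \<longleftrightarrow>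
    x \<in> mpolys (vars k l) \<and> (\<forall>m. \<pi> dvd lookup (rank_subst k l r s t x) m)"
proof (intro iffI conjI)
  let ?G = "box_minors r s (Suc t) :: 'a mpoly set"
  let ?I = "det_ideal k l ?G"
  note G = box_minors_mpolys[OF rk sl, of "Suc t"]
  note I = ideal_det_ideal[OF G]
  show "x \<in> mpolys (vars k l)" if "x \<in> ?I" using that mpoly_ideal_subset[OF I] by blast
  show "\<forall>m. \<pi> dvd lookup (rank_subst k l r s t x) m" if "x \<in> ?I"
    using that det_ideal_rank_subst[OF assms] by blast
  assume x: "x \<in> mpolys (vars k l) \<and> (\<forall>m. \<pi> dvd lookup (rank_subst k l r s t x) m)"
  obtain ord where E: "antidiagonal_exchange (vars k l) ord"
    using antidiagonal_exchange_exists[of "vars k l"] by auto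
  then have T: "term_order (vars k l) ord" by (simp add: antidiagonal_exchange_def)
  \<comment> \<open>\<open>reduction\<close> wants the leading monomial as a function of the
    generator; antisymmetry of the order later identifies the chosen value with any given
    antidiagonal.\<close>
  define L where "L g = (SOME m. \<exists>\<rho> \<sigma>. g = minor \<rho> \<sigma> (Suc t) \<and> sorted_in r (Suc t) \<rho> \<and>
    sorted_in s (Suc t) \<sigma> \<and> m = antidiag \<rho> \<sigma> (Suc t))" for g :: "'a mpoly"
  have L: "\<exists>\<rho> \<sigma>. g = minor \<rho> \<sigma> (Suc t) \<and> sorted_in r (Suc t) \<rho> \<and>
    sorted_in s (Suc t) \<sigma> \<and> L g = antidiag \<rho> \<sigma> (Suc t)" if "g \<in> ?G" for g
    unfolding L_def by (rule someI_ex) (use that in \<open>auto simp: box_minors_def\<close>)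
  have "unit_lead ord g (L g)" if "g \<in> ?G" for g
  proof -
    from L[OF that] obtain \<rho> \<sigma> where g: "g = minor \<rho> \<sigma> (Suc t)" "L g = antidiag \<rho> \<sigma> (Suc t)"
      and \<rho>\<sigma>: "sorted_in r (Suc t) \<rho>" "sorted_in s (Suc t) \<sigma>" by blast
    have "(\<rho> a, \<sigma> b) \<in> vars k l" if "a < Suc t" "b < Suc t" for a b
      using sorted_in_less[OF \<rho>\<sigma>(1) that(1)] sorted_in_less[OF \<rho>\<sigma>(2) that(2)] rk sl by auto
    then show ?thesis unfolding g(2) unfolding g(1)
      using \<rho>\<sigma> by (intro unit_lead_minor[OF E]) (auto simp: sorted_in_def)
  qed
  from reduction[OF T _ G this, of x] x obtain y where y: "y \<in> mpolys (vars k l)" "x - y \<in> gen (vars k l) ?G"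
    "\<forall>m\<in>keys y. \<forall>g\<in>?G. \<forall>u. m \<noteq> u + L g" by auto
  have xy: "x - y \<in> ?I" unfolding det_ideal_def using y(2) gen_mono[OF det_ideal_gens[OF G]] by blast
  have "\<pi> dvd lookup y m" for m
  proof (rule ccontr)
    assume "\<not> \<pi> dvd lookup y m"
    then obtain n where n: "lead \<pi> ord y n" using lead_exists[OF T y(1)] by blast
    have "\<not> has_antidiag r s (Suc t) n"
    proof
      assume "has_antidiag r s (Suc t) n"
      then obtain \<rho> \<sigma> u where h: "sorted_in r (Suc t) \<rho>" "sorted_in s (Suc t) \<sigma>" "n = u + antidiag \<rho> \<sigma> (Suc t)"
        unfolding has_antidiag_def by blast
      let ?g = "minor \<rho> \<sigma> (Suc t) :: 'a mpoly"
      have g: "?g \<in> ?G" using h by (auto simp: box_minors_def)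
      have V: "(\<rho> a, \<sigma> b) \<in> vars k l" if "a < Suc t" "b < Suc t" for a b
        using sorted_in_less[OF h(1) that(1)] sorted_in_less[OF h(2) that(2)] rk sl by auto
      have "unit_lead ord ?g (antidiag \<rho> \<sigma> (Suc t))"
        using h(1,2) by (intro unit_lead_minor[OF E] V) (auto simp: sorted_in_def)
      with \<open>\<And>g. g \<in> ?G \<Longrightarrow> unit_lead ord g (L g)\<close>[OF g] have "L ?g = antidiag \<rho> \<sigma> (Suc t)"
        using term_order_antisym[OF T] by (auto simp: unit_lead_def in_keys_iff)
      moreover have "n \<in> keys y" using n by (auto simp: lead_def in_keys_iff)
      ultimately show False using y(3) g h(3) by metis
    qed
    from rank_subst_lead[OF E n this] obtain T where "\<not> \<pi> dvd lookup (rank_subst k l r s t y) T" by blast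
    moreover have "rank_subst k l r s t y = rank_subst k l r s t x - rank_subst k l r s t (x - y)"
      by (simp add: rank_subst.hom_minus)
    ultimately show False
      using x det_ideal_rank_subst[OF assms xy] by (simp add: lookup_minus)
  qed
  then have "y \<in> ?I"
    by (intro residue_mem[OF I _ y(1)]) (auto simp: det_ideal_def intro!: gen_self[OF det_ideal_gens[OF G]])
  then show "x \<in> ?I" using mpoly_ideal_add[OF I xy] by fastforce
qed

text \<open>The ideal is the kernel modulo \<open>\<pi>\<close> of a homomorphism into a polynomial
  ring, where Gauss's lemma applies.\<close>

lemma det_ideal_prime:
  assumes "r \<le> k" "s \<le> l" and "x * h \<in> det_ideal k l (box_minors r s (Suc t))"
    and "x \<in> mpolys (vars k l)" "h \<in> mpolys (vars k l)" "h \<notin> det_ideal k l (box_minors r s (Suc t))"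
  shows "x \<in> det_ideal k l (box_minors r s (Suc t))"
proof -
  note iff = det_ideal_iff_rank_subst[OF assms(1,2)]
  obtain n where "\<not> \<pi> dvd lookup (rank_subst k l r s t h) n" using assms(5,6) iff by blast
  then have "\<pi> dvd lookup (rank_subst k l r s t x) m" for m
    using assms(3-5) iff[of "x * h" t]
    by (intro mpolys_prime_mod[OF _ mpolys_rank_subst mpolys_rank_subst]) (auto simp: rank_subst.hom_mult)
  then show ?thesis using iff assms(4) by blast
qed

end

section \<open>Rearranging and bordering minors\<close>

lemma perm_of_same_image:
  fixes \<rho> \<rho>' :: "nat \<Rightarrow> nat"
  assumes "inj_on \<rho> {..<n}" "inj_on \<rho>' {..<n}" "\<rho>' ` {..<n} = \<rho> ` {..<n}"
  obtains p where "p permutes {0..<n}" "\<And>a. a < n \<Longrightarrow> \<rho>' a = \<rho> (p a)"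
proof -
  define p where "p a = (if a < n then inv_into {..<n} \<rho> (\<rho>' a) else a)" for a
  have in_im: "\<rho>' a \<in> \<rho> ` {..<n}" if "a < n" for a using assms(3) that by blast
  have p: "p a < n" "\<rho> (p a) = \<rho>' a" if "a < n" for a
    using inv_into_into[OF in_im[OF that]] f_inv_into_f[OF in_im[OF that]] that by (auto simp: p_def)
  have "inj_on p {0..<n}"
  proof (rule inj_onI)
    fix a b assume ab: "a \<in> {0..<n}" "b \<in> {0..<n}" "p a = p b"
    then have "\<rho>' a = \<rho>' b" using p(2)[of a] p(2)[of b] by simp
    then show "a = b" using assms(2) ab by (auto dest: inj_onD)
  qed
  then have "bij_betw p {0..<n} {0..<n}"
  proof -
    have "p ` {0..<n} \<subseteq> {0..<n}" using p(1) by auto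
    then show ?thesis using endo_inj_surj[of "{0..<n}" p] \<open>inj_on p {0..<n}\<close> by (simp add: bij_betw_def)
  qed
  then have "p permutes {0..<n}" by (rule bij_imp_permutes) (simp add: p_def)
  then show ?thesis using that p(2) by metis
qed

lemma minor_cong:
  assumes "\<And>a. a < n \<Longrightarrow> \<rho> a = \<rho>' a" "\<And>a. a < n \<Longrightarrow> \<sigma> a = \<sigma>' a"
  shows "minor \<rho> \<sigma> n = minor \<rho>' \<sigma>' n"
  unfolding minor_def using assms by (intro arg_cong[where f = det] eq_matI) auto

lemma minor_permute_rows:
  assumes "p permutes {0..<n}"
  shows "(minor (\<lambda>a. \<rho> (p a)) \<sigma> n :: 'a::comm_ring_1 mpoly) = signof p * minor \<rho> \<sigma> n"
proof -
  let ?A = "mat n n (\<lambda>(a, b). var (\<rho> a) (\<sigma> b)) :: 'a mpoly mat"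
  have "mat n n (\<lambda>(a, b). var (\<rho> (p a)) (\<sigma> b)) = mat n n (\<lambda>(a, b). ?A $$ (p a, b))"
    using permutes_less[OF assms] by (intro eq_matI) auto
  then show ?thesis using det_permute_rows[OF _ assms, of ?A] by (simp add: minor_def)
qed

lemma minor_permute_cols:
  assumes "p permutes {0..<n}"
  shows "(minor \<rho> (\<lambda>a. \<sigma> (p a)) n :: 'a::comm_ring_1 mpoly) = signof p * minor \<rho> \<sigma> n"
proof -
  let ?A = "mat n n (\<lambda>(a, b). var (\<rho> b) (\<sigma> a)) :: 'a mpoly mat"
  have "mat n n (\<lambda>(a, b). var (\<rho> a) (\<sigma> (p b))) = (mat n n (\<lambda>(a, b). ?A $$ (p a, b)))\<^sup>T"
    using permutes_less[OF assms] by (intro eq_matI) auto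
  then have "minor \<rho> (\<lambda>a. \<sigma> (p a)) n = det (mat n n (\<lambda>(a, b). ?A $$ (p a, b)))"
    by (simp add: minor_def det_transpose[of _ n])
  also have "\<dots> = signof p * det ?A" by (rule det_permute_rows[OF _ assms]) simp
  also have "?A = (mat n n (\<lambda>(a, b). var (\<rho> a) (\<sigma> b)))\<^sup>T" by (intro eq_matI) auto
  finally show ?thesis by (simp add: minor_def det_transpose[of _ n])
qed

lemma minor_same_images:
  fixes \<rho> \<rho>' \<sigma> \<sigma>' :: "nat \<Rightarrow> nat"
  assumes "inj_on \<rho> {..<n}" "inj_on \<rho>' {..<n}" "\<rho>' ` {..<n} = \<rho> ` {..<n}"
    and "inj_on \<sigma> {..<n}" "inj_on \<sigma>' {..<n}" "\<sigma>' ` {..<n} = \<sigma> ` {..<n}"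
  shows "minor \<rho>' \<sigma>' n = (minor \<rho> \<sigma> n :: 'a::comm_ring_1 mpoly) \<or> minor \<rho>' \<sigma>' n = - (minor \<rho> \<sigma> n :: 'a mpoly)"
proof -
  obtain p where p: "p permutes {0..<n}" "\<And>a. a < n \<Longrightarrow> \<rho>' a = \<rho> (p a)"
    using perm_of_same_image[OF assms(1-3)] by blast
  obtain q where q: "q permutes {0..<n}" "\<And>a. a < n \<Longrightarrow> \<sigma>' a = \<sigma> (q a)"
    using perm_of_same_image[OF assms(4-6)] by blast
  have "(minor \<rho>' \<sigma>' n :: 'a mpoly) = minor (\<lambda>a. \<rho> (p a)) (\<lambda>a. \<sigma> (q a)) n"
    by (rule minor_cong[OF p(2) q(2)])
  also have "\<dots> = signof p * (signof q * minor \<rho> \<sigma> n)"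
    by (simp only: minor_permute_rows[OF p(1)] minor_permute_cols[OF q(1)])
  finally show ?thesis by (simp add: sign_def)
qed

lemma minor_noninj_rows:
  assumes "\<not> inj_on \<rho> {..<n}"
  shows "minor \<rho> \<sigma> n = 0"
proof -
  obtain a b where "a < n" "b < n" "a \<noteq> b" "\<rho> a = \<rho> b" using assms by (auto simp: inj_on_def)
  then show ?thesis unfolding minor_def
    by (intro det_identical_rows[of _ n a b]) (auto intro!: eq_vecI)
qed

lemma minor_noninj_cols:
  assumes "\<not> inj_on \<sigma> {..<n}"
  shows "minor \<rho> \<sigma> n = 0"
proof -
  obtain a b where "a < n" "b < n" "a \<noteq> b" "\<sigma> a = \<sigma> b" using assms by (auto simp: inj_on_def)
  then show ?thesis unfolding minor_def
    by (intro det_identical_columns[of _ n a b]) (auto intro!: eq_vecI)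
qed

lemma sort_exists:
  fixes \<rho> :: "nat \<Rightarrow> nat"
  assumes "inj_on \<rho> {..<n}"
  obtains \<rho>' where "strict_mono_on {..<n} \<rho>'" "\<rho>' ` {..<n} = \<rho> ` {..<n}"
proof -
  let ?xs = "sorted_list_of_set (\<rho> ` {..<n})"
  have len: "length ?xs = n" using assms by (simp add: card_image)
  have "strict_mono_on {..<n} (\<lambda>a. ?xs ! a)"
    using sorted_wrt_nth_less[OF strict_sorted_list_of_set[of "\<rho> ` {..<n}"]] len
    by (auto simp: strict_mono_on_def)
  moreover have "(\<lambda>a. ?xs ! a) ` {..<n} = \<rho> ` {..<n}"
    using len nth_image[of n ?xs] by (simp add: lessThan_atLeast0)
  ultimately show ?thesis using that by blast
qed

text \<open>\<open>box_minors\<close> only has increasing index lists. A repeated index gives 0, and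
  sorting distinct indices changes at most the sign.\<close>

lemma minor_in_ideal:
  fixes I :: "'a::comm_ring_1 mpoly set"
  assumes I: "ideal I (mpoly_ring V)" and sub: "box_minors r s n \<subseteq> I"
    and \<rho>: "\<And>a. a < n \<Longrightarrow> \<rho> a < r" and \<sigma>: "\<And>a. a < n \<Longrightarrow> \<sigma> a < s"
  shows "minor \<rho> \<sigma> n \<in> I"
proof (cases "inj_on \<rho> {..<n} \<and> inj_on \<sigma> {..<n}")
  case False
  then show ?thesis using minor_noninj_rows minor_noninj_cols mpoly_ideal_zero[OF I] by metis
next
  case True
  obtain \<rho>' where \<rho>': "strict_mono_on {..<n} \<rho>'" "\<rho>' ` {..<n} = \<rho> ` {..<n}"
    using sort_exists True by blast
  obtain \<sigma>' where \<sigma>': "strict_mono_on {..<n} \<sigma>'" "\<sigma>' ` {..<n} = \<sigma> ` {..<n}"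
    using sort_exists True by blast
  have "sorted_in r n \<rho>'" "sorted_in s n \<sigma>'"
    using \<rho>' \<sigma>' \<rho> \<sigma> by (auto simp: sorted_in_def)
  then have "minor \<rho>' \<sigma>' n \<in> I" using sub by (auto simp: box_minors_def)
  moreover have "inj_on \<rho>' {..<n}" "inj_on \<sigma>' {..<n}"
    using \<rho>'(1) \<sigma>'(1) by (auto intro: strict_mono_on_imp_inj_on)
  then have "minor \<rho> \<sigma> n = (minor \<rho>' \<sigma>' n :: 'a mpoly) \<or> minor \<rho> \<sigma> n = - (minor \<rho>' \<sigma>' n :: 'a mpoly)"
    using minor_same_images[of \<rho>' n \<rho> \<sigma>' \<sigma>] True \<rho>'(2) \<sigma>'(2) by metis
  ultimately show ?thesis using mpoly_ideal_uminus[OF I] by metis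
qed

text \<open>
  The Schur complement of the contiguous \<open>t \<times> t\<close> block with northwest corner \<open>(r0, c0)\<close>, with the
  denominator cleared.
\<close>

definition contiguous :: "nat \<Rightarrow> nat \<Rightarrow> nat \<Rightarrow> 'a::comm_ring_1 mpoly mat" where
  "contiguous r0 c0 t = mat t t (\<lambda>(a, b). var (r0 + a) (c0 + b))"

definition schur_entry :: "nat \<Rightarrow> nat \<Rightarrow> nat \<Rightarrow> nat \<Rightarrow> nat \<Rightarrow> 'a::comm_ring_1 mpoly" where
  "schur_entry r0 c0 t i j = det (contiguous r0 c0 t) * var i j -
    (\<Sum>p<t. (\<Sum>q<t. var i (c0 + q) * adj_mat (contiguous r0 c0 t) $$ (q, p)) * var (r0 + p) j)"

definition border :: "nat \<Rightarrow> nat \<Rightarrow> (nat \<Rightarrow> nat) \<Rightarrow> nat \<Rightarrow> nat" where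
  "border t c f x = (if x < t then c + x else f (x - t))"

lemma det_contiguous_nonzero: "det (contiguous r0 c0 t) \<noteq> (0 :: 'a::idom mpoly)"
proof -
  obtain ord where E: "antidiagonal_exchange (vars (r0 + t) (c0 + t)) ord"
    using antidiagonal_exchange_exists[of "vars (r0 + t) (c0 + t)"] by auto
  have "unit_lead ord (minor (\<lambda>a. r0 + a) (\<lambda>b. c0 + b) t :: 'a mpoly) (antidiag (\<lambda>a. r0 + a) (\<lambda>b. c0 + b) t)"
    by (rule unit_lead_minor[OF E]) (auto simp: strict_mono_on_def)
  then show ?thesis by (auto simp: unit_lead_def minor_def contiguous_def)
qed

text \<open>Left multiplication by the block matrix with rows (adj D, 0) and (- C adj D, \<Delta>)
  turns the matrix with rows (D, B) and (C, X) into an upper block triangular one, whose diagonal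
  blocks are the scalar \<Delta> and the matrix of Schur entries. The adjugate in place of the
  inverse avoids fractions.\<close>

lemma schur_complement:
  "det (contiguous r0 c0 t) ^ m * (minor (border t r0 R) (border t c0 S) (t + m) :: 'a::idom mpoly) =
    det (contiguous r0 c0 t) * det (mat m m (\<lambda>(y, z). schur_entry r0 c0 t (R y) (S z)))"
proof -
  define D :: "'a mpoly mat" where "D = contiguous r0 c0 t"
  define B :: "'a mpoly mat" where "B = mat t m (\<lambda>(a, z). var (r0 + a) (S z))"
  define C :: "'a mpoly mat" where "C = mat m t (\<lambda>(y, b). var (R y) (c0 + b))"
  define X :: "'a mpoly mat" where "X = mat m m (\<lambda>(y, z). var (R y) (S z))"
  define \<Delta> where "\<Delta> = det D"
  have c: "D \<in> carrier_mat t t" "B \<in> carrier_mat t m" "C \<in> carrier_mat m t" "X \<in> carrier_mat m m"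
    by (auto simp: D_def B_def C_def X_def contiguous_def)
  note adj = adj_mat[OF c(1)]
  have Y: "mat (t + m) (t + m) (\<lambda>(a, b). var (border t r0 R a) (border t c0 S b)) = four_block_mat D B C X"
    by (rule eq_matI) (auto simp: D_def B_def C_def X_def contiguous_def border_def)
  let ?E = "mat m m (\<lambda>(y, z). schur_entry r0 c0 t (R y) (S z)) :: 'a mpoly mat"
  let ?L = "four_block_mat (adj_mat D) (0\<^sub>m t m) (- (C * adj_mat D)) (\<Delta> \<cdot>\<^sub>m 1\<^sub>m m)"
  have cL: "adj_mat D \<in> carrier_mat t t" "0\<^sub>m t m \<in> carrier_mat t m" "- (C * adj_mat D) \<in> carrier_mat m t"
    "\<Delta> \<cdot>\<^sub>m 1\<^sub>m m \<in> carrier_mat m m" using c adj by auto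
  have "?L * four_block_mat D B C X = four_block_mat (adj_mat D * D + 0\<^sub>m t m * C) (adj_mat D * B + 0\<^sub>m t m * X)
      (- (C * adj_mat D) * D + \<Delta> \<cdot>\<^sub>m 1\<^sub>m m * C) (- (C * adj_mat D) * B + \<Delta> \<cdot>\<^sub>m 1\<^sub>m m * X)"
    by (rule mult_four_block_mat[OF cL c])
  also have "adj_mat D * D + 0\<^sub>m t m * C = \<Delta> \<cdot>\<^sub>m 1\<^sub>m t"
    using adj(3) c by (simp add: \<Delta>_def)
  also have "- (C * adj_mat D) * D + \<Delta> \<cdot>\<^sub>m 1\<^sub>m m * C = 0\<^sub>m m t"
  proof -
    have "- (C * adj_mat D) * D = - (C * (adj_mat D * D))"
      using c adj(1) assoc_mult_mat[OF c(3) adj(1) c(1)] by simp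
    also have "\<dots> = - (\<Delta> \<cdot>\<^sub>m C)" using c by (simp add: adj(3) \<Delta>_def mult_smult_distrib[of _ m t _ t])
    finally have "- (C * adj_mat D) * D + \<Delta> \<cdot>\<^sub>m 1\<^sub>m m * C = - (\<Delta> \<cdot>\<^sub>m C) + \<Delta> \<cdot>\<^sub>m C"
      using c by (simp add: mult_smult_assoc_mat[of _ m m _ t])
    then show ?thesis using c by (simp add: uminus_l_inv_mat[of _ m t])
  qed
  also have "- (C * adj_mat D) * B + \<Delta> \<cdot>\<^sub>m 1\<^sub>m m * X = ?E"
  proof (rule eq_matI)
    fix y z assume "y < dim_row ?E" "z < dim_col ?E"
    then have yz: "y < m" "z < m" by auto
    have "(C * adj_mat D * B) $$ (y, z) = (\<Sum>p<t. (\<Sum>q<t. var (R y) (c0 + q) * adj_mat D $$ (q, p)) * var (r0 + p) (S z))"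
      using yz c adj(1) by (auto simp: scalar_prod_def C_def B_def lessThan_atLeast0 intro!: sum.cong)
    moreover have "- (C * adj_mat D) * B = - (C * adj_mat D * B)"
      using c adj(1) by (simp add: uminus_mult_left_mat)
    moreover have "\<Delta> \<cdot>\<^sub>m 1\<^sub>m m * X = \<Delta> \<cdot>\<^sub>m X"
      using c by (simp add: mult_smult_assoc_mat[of _ m m _ m])
    ultimately show "(- (C * adj_mat D) * B + \<Delta> \<cdot>\<^sub>m 1\<^sub>m m * X) $$ (y, z) = ?E $$ (y, z)"
      using yz c adj(1) by (simp add: schur_entry_def D_def[symmetric] \<Delta>_def[symmetric] X_def)
  qed (use c adj in auto)
  finally have LY: "?L * four_block_mat D B C X =
    four_block_mat (\<Delta> \<cdot>\<^sub>m 1\<^sub>m t) (adj_mat D * B + 0\<^sub>m t m * X) (0\<^sub>m m t) ?E" .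
  have "det ?L = det (adj_mat D) * \<Delta> ^ m"
    using det_four_block_mat_upper_right_zero[OF cL(1) refl cL(3,4)] by simp
  moreover have "det (four_block_mat (\<Delta> \<cdot>\<^sub>m 1\<^sub>m t) (adj_mat D * B + 0\<^sub>m t m * X) (0\<^sub>m m t) ?E) = \<Delta> ^ t * det ?E"
    using c adj(1) by (subst det_four_block_mat_lower_left_zero[of _ t _ m]) auto
  moreover have "det (?L * four_block_mat D B C X) = det ?L * det (four_block_mat D B C X)"
    using c cL by (intro det_mult[of _ "t + m"]) auto
  ultimately have "det (adj_mat D) * \<Delta> ^ m * det (four_block_mat D B C X) = \<Delta> ^ t * det ?E"
    by (metis LY)
  \<comment> \<open>A further factor \<Delta> replaces det (adj D) by a power of \<Delta>, which is
    nonzero and can be cancelled.\<close>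
  then have "\<Delta> * (det (adj_mat D) * \<Delta> ^ m * det (four_block_mat D B C X)) = \<Delta> * (\<Delta> ^ t * det ?E)"
    by simp
  moreover have "\<Delta> * det (adj_mat D) = \<Delta> ^ t"
    using det_mult[OF c(1) adj(1)] adj(2) by (simp add: \<Delta>_def)
  ultimately have "\<Delta> ^ t * (\<Delta> ^ m * det (four_block_mat D B C X)) = \<Delta> ^ t * (\<Delta> * det ?E)"
    by (simp only: mult.assoc[symmetric]) (simp only: mult_ac)
  moreover have "\<Delta> \<noteq> 0" unfolding \<Delta>_def D_def by (rule det_contiguous_nonzero)
  ultimately have "\<Delta> ^ m * det (four_block_mat D B C X) = \<Delta> * det ?E" by simp
  then show ?thesis by (simp add: minor_def Y \<Delta>_def D_def)
qed

text \<open>The case m = 1 of \<open>schur_complement\<close>, with the common factor cancelled. It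
  reduces membership of a Schur entry in an ideal to that of a (t + 1)-minor.\<close>

lemma schur_entry_minor:
  "schur_entry r0 c0 t i j = (minor (border t r0 (\<lambda>_. i)) (border t c0 (\<lambda>_. j)) (Suc t) :: 'a::idom mpoly)"
proof -
  have "det (contiguous r0 c0 t) \<noteq> (0 :: 'a mpoly)" by (rule det_contiguous_nonzero)
  with schur_complement[of r0 c0 t 1 "\<lambda>_. i" "\<lambda>_. j", where 'a='a] show ?thesis
    by (simp add: det_single One_nat_def)
qed

lemma mpolys_adj_mat:
  assumes "A \<in> carrier_mat n n" "\<And>i j. i < n \<Longrightarrow> j < n \<Longrightarrow> A $$ (i, j) \<in> mpolys V" "i < n" "j < n"
  shows "adj_mat A $$ (i, j) \<in> mpolys V"
proof -
  have "det (mat_delete A j i) \<in> mpolys V"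
    using assms by (intro mpolys_det[of _ "n - 1"] mat_delete_carrier) (auto simp: mat_delete_def)
  then show ?thesis using assms
    by (auto simp: adj_mat_def cofactor_def intro!: mpolys_mult mpolys_power mpolys_uminus)
qed

text \<open>What remains of the pivot determinant times a variable once the Schur entry is
  subtracted. As a matrix in i and j it factors through size t, so its (t + 1)-minors
  vanish.\<close>

definition low_rank_part :: "nat \<Rightarrow> nat \<Rightarrow> nat \<Rightarrow> nat \<Rightarrow> nat \<Rightarrow> 'a::comm_ring_1 mpoly" where
  "low_rank_part r0 c0 t i j =
    (\<Sum>p<t. (\<Sum>q<t. var i (c0 + q) * adj_mat (contiguous r0 c0 t) $$ (q, p)) * var (r0 + p) j)"

lemma mpolys_low_rank_part:
  assumes "r0 + t \<le> k" "c0 + t \<le> l" "i < k" "j < l"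
  shows "low_rank_part r0 c0 t i j \<in> mpolys (vars k l)"
  unfolding low_rank_part_def
  by (intro mpolys_sum mpolys_mult mpolys_var mpolys_adj_mat[of _ t])
    (use assms in \<open>auto simp: contiguous_def\<close>)

lemma mpolys_det_contiguous:
  assumes "r0 + t \<le> k" "c0 + t \<le> l"
  shows "det (contiguous r0 c0 t) \<in> mpolys (vars k l)"
  by (intro mpolys_det[of _ t]) (use assms in \<open>auto simp: contiguous_def\<close>)

lemma mpolys_schur_entry:
  assumes "r0 + t \<le> k" "c0 + t \<le> l" "i < k" "j < l"
  shows "schur_entry r0 c0 t i j \<in> mpolys (vars k l)"
  unfolding schur_entry_def low_rank_part_def[symmetric]
  using assms by (intro mpolys_diff mpolys_mult mpolys_low_rank_part mpolys_det_contiguous mpolys_var) auto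

section \<open>Determinantal ideals as ideal quotients\<close>

text \<open>The minor on the largest square block whose antidiagonal is the whole antidiagonal \<open>i + j = d\<close>.\<close>

definition diag_minor :: "nat \<Rightarrow> nat \<Rightarrow> nat \<Rightarrow> 'a::comm_ring_1 mpoly" where
  "diag_minor k l d = minor (\<lambda>a. (d + 1 - l) + a) (\<lambda>b. (d - min (k - 1) d) + b)
    (Suc (min (k - 1) d) - (d + 1 - l))"

lemma mpolys_diag_minor:
  assumes "d < k + l - 1" "1 \<le> k" "1 \<le> l"
  shows "diag_minor k l d \<in> mpolys (vars k l)"
  unfolding diag_minor_def
  by (rule mpolys_minor) (use assms in \<open>auto simp: min_def split: if_splits\<close>)

lemma colon_ideal:
  fixes I :: "'a::comm_ring_1 mpoly set"
  assumes I: "ideal I (mpoly_ring V)" and h: "h \<in> mpolys V"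
  shows "ideal {x \<in> mpolys V. x * h \<in> I} (mpoly_ring V)"
  by (rule mpoly_idealI)
    (use mpoly_ideal_zero[OF I] mpoly_ideal_add[OF I] mpoly_ideal_mult[OF I] in
      \<open>auto simp: distrib_right mult.assoc\<close>)

text \<open>
  The \<open>t \<times> t\<close> block with northwest corner \<open>(r0, c0)\<close>, adjacent to the cell \<open>(r - 1, s - 1)\<close>, is used
  as a pivot; \<open>R\<close> and \<open>S\<close> list the remaining rows and columns of the block of
  the minor on the antidiagonal \<open>d\<close>: first the \<open>a\<close> rows above and columns to the right of the
  pivot, then \<open>r - 1\<close> and \<open>s - 1\<close>, then the \<open>b\<close> rows below and columns to the left.
\<close>

locale pivot =
  fixes k l r s t :: nat
  assumes tr: "t < r" and rk: "r \<le> k" and ts: "t < s" and sl: "s \<le> l"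
begin

text \<open>The corner minor has rows r - 1 - t to r - 1 and columns s - 1 - t to s - 1, so the
  cells of its antidiagonal have index sum d. The block of the diagonal minor for d has northwest
  corner (\<open>row0\<close>, \<open>col0\<close>).\<close>

definition "d = r + s - t - 2"
definition "row0 = d + 1 - l"
definition "col0 = d - min (k - 1) d"
definition "a = r - t - 1 - row0"
definition "b = s - t - 1 - col0"
definition "r0 = r - t - 1"
definition "c0 = s - t - 1"
definition "R y = (if y < a then row0 + y else r - 1 + (y - a))"
definition "S y = (if y < a then s + y else if y = a then s - 1 else col0 + (y - a - 1))"

lemma bounds:
  "row0 + a = r0" "col0 + b = c0" "r0 + t = r - 1" "c0 + t = s - 1" "r + b \<le> k" "s + a \<le> l"
  "Suc (min (k - 1) d) - row0 = t + (a + 1 + b)" "d < k + l - 1" "row0 + (t + (a + 1 + b)) = r + b"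
  "col0 + (t + (a + 1 + b)) = s + a"
  using tr rk ts sl by (auto simp: d_def row0_def col0_def a_def b_def r0_def c0_def min_def)

lemma row0_a: "row0 + a = r0" and col0_b: "col0 + b = c0"
  and r_eq: "Suc (r0 + t) = r" and s_eq: "Suc (c0 + t) = s"
  using bounds(1-4) tr ts by simp_all

text \<open>The positions are given additively to keep truncated subtraction out of the arithmetic
  on index lists.\<close>

lemma border_R:
  "x < t \<and> border t r0 R x = r0 + x \<or>
   t \<le> x \<and> x < t + a \<and> border t r0 R x + t = row0 + x \<or>
   t + a \<le> x \<and> border t r0 R x + a = r0 + x"
proof -
  consider "x < t" | "t \<le> x" "x < t + a" | "t + a \<le> x" by linarith
  then show ?thesis using r_eq by (cases; simp add: border_def R_def; arith?)
qed

lemma border_S: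
  "x < t \<and> border t c0 S x = c0 + x \<or>
   t \<le> x \<and> x < t + a \<and> border t c0 S x = Suc (c0 + x) \<or>
   x = t + a \<and> border t c0 S x = c0 + t \<or>
   t + a < x \<and> border t c0 S x + Suc (t + a) = col0 + x"
proof -
  consider "x < t" | "t \<le> x" "x < t + a" | "x = t + a" | "t + a < x" by linarith
  then show ?thesis using s_eq by (cases; simp add: border_def S_def; arith?)
qed

lemma R_less: "y < a + 1 + b \<Longrightarrow> R y < k" and S_less: "y < a + 1 + b \<Longrightarrow> S y < l"
  using bounds(5,6) rk sl r_eq s_eq row0_a col0_b by (auto simp: R_def S_def)

text \<open>The pivot followed by \<open>R\<close> and \<open>S\<close> lists the rows and columns
  of the block in another order, which affects only the sign.\<close>

lemma diag_minor_border:
  "minor (border t r0 R) (border t c0 S) (t + (a + 1 + b)) = (diag_minor k l d :: 'a::comm_ring_1 mpoly) \<or>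
   minor (border t r0 R) (border t c0 S) (t + (a + 1 + b)) = - (diag_minor k l d :: 'a mpoly)"
proof -
  let ?n = "t + (a + 1 + b)"
  have "diag_minor k l d = (minor (\<lambda>x. row0 + x) (\<lambda>x. col0 + x) ?n :: 'a mpoly)"
    by (simp add: diag_minor_def bounds(7)[symmetric] row0_def col0_def)
  moreover have "inj_on (border t r0 R) {..<?n}" "border t r0 R ` {..<?n} = (\<lambda>x. row0 + x) ` {..<?n}"
  proof -
    show inj: "inj_on (border t r0 R) {..<?n}"
    proof (rule inj_onI)
      fix x y assume "border t r0 R x = border t r0 R y"
      then show "x = y"
        using border_R[of x] border_R[of y] row0_a by linarith
    qed
    show "border t r0 R ` {..<?n} = (\<lambda>x. row0 + x) ` {..<?n}"
    proof (rule card_subset_eq)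
      have "row0 \<le> border t r0 R x" "border t r0 R x - row0 < ?n" if "x < ?n" for x
        using border_R[of x] row0_a that by linarith+
      then have "border t r0 R x \<in> (\<lambda>x. row0 + x) ` {..<?n}" if "x < ?n" for x
        using that by (intro image_eqI[of _ _ "border t r0 R x - row0"]) auto
      then show "border t r0 R ` {..<?n} \<subseteq> (\<lambda>x. row0 + x) ` {..<?n}" by blast
    qed (use inj in \<open>simp_all add: card_image\<close>)
  qed
  moreover have "inj_on (border t c0 S) {..<?n}" "border t c0 S ` {..<?n} = (\<lambda>x. col0 + x) ` {..<?n}"
  proof -
    show inj: "inj_on (border t c0 S) {..<?n}"
    proof (rule inj_onI)
      fix x y assume "x \<in> {..<?n}" "y \<in> {..<?n}" "border t c0 S x = border t c0 S y"
      then show "x = y"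
        using border_S[of x] border_S[of y] col0_b by simp linarith
    qed
    show "border t c0 S ` {..<?n} = (\<lambda>x. col0 + x) ` {..<?n}"
    proof (rule card_subset_eq)
      have "col0 \<le> border t c0 S x" "border t c0 S x - col0 < ?n" if "x < ?n" for x
        using border_S[of x] col0_b that by linarith+
      then have "border t c0 S x \<in> (\<lambda>x. col0 + x) ` {..<?n}" if "x < ?n" for x
        using that by (intro image_eqI[of _ _ "border t c0 S x - col0"]) auto
      then show "border t c0 S ` {..<?n} \<subseteq> (\<lambda>x. col0 + x) ` {..<?n}" by blast
    qed (use inj in \<open>simp_all add: card_image\<close>)
  qed
  ultimately show ?thesis
    using minor_same_images[of "\<lambda>x. row0 + x" ?n "border t r0 R" "\<lambda>x. col0 + x" "border t c0 S", where 'a='a]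
    by simp
qed

text \<open>The pivot occupies rows below r - 1 and columns below s - 1. Away from the corner the
  minor obtained by bordering it with i and j therefore misses row r - 1 or column s - 1, and so
  lies in one of the two smaller blocks.\<close>

lemma schur_entry_mem:
  fixes I :: "'a::idom mpoly set"
  assumes "ideal I (mpoly_ring V)" "box_minors (r - 1) s (Suc t) \<subseteq> I" "box_minors r (s - 1) (Suc t) \<subseteq> I"
    and "i < r" "j < s" "(i, j) \<noteq> (r - 1, s - 1)"
  shows "schur_entry r0 c0 t i j \<in> I"
proof -
  consider "i < r - 1" | "j < s - 1" using assms(4-6) by fastforce
  then show ?thesis unfolding schur_entry_minor
  proof cases
    case 1
    then show "minor (border t r0 (\<lambda>_. i)) (border t c0 (\<lambda>_. j)) (Suc t) \<in> I"
      using assms(5) bounds by (intro minor_in_ideal[OF assms(1,2)]) (auto simp: border_def)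
  next
    case 2
    then show "minor (border t r0 (\<lambda>_. i)) (border t c0 (\<lambda>_. j)) (Suc t) \<in> I"
      using assms(4) bounds by (intro minor_in_ideal[OF assms(1,3)]) (auto simp: border_def)
  qed
qed

lemma schur_corner_mem:
  fixes I :: "'a::idom mpoly set"
  assumes "ideal I (mpoly_ring V)" "box_minors r s (Suc t) \<subseteq> I"
  shows "schur_entry r0 c0 t (r - 1) (s - 1) \<in> I"
  unfolding schur_entry_minor
  using bounds tr ts by (intro minor_in_ideal[OF assms]) (auto simp: border_def)

text \<open>A zero-one matrix of northwest rank \<open>t\<close> at which the denominators do not vanish.\<close>

definition x0 :: "nat \<times> nat \<Rightarrow> 'a::comm_ring_1 mpoly" where
  "x0 = (\<lambda>(i, j). if r0 \<le> i \<and> i < r - 1 \<and> c0 \<le> j \<and> i - r0 = j - c0 \<or>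
      row0 \<le> i \<and> i < r0 \<and> s \<le> j \<and> i - row0 = j - s \<or>
      r \<le> i \<and> col0 \<le> j \<and> j < c0 \<and> i - r = j - col0 then 1 else 0)"

lemma subst_x0_var: "subst x0 (var i j) = x0 (i, j)"
  by (simp add: var_def)

lemma subst_x0_det:
  assumes "\<And>y z. y < n \<Longrightarrow> z < n \<Longrightarrow> subst x0 (F y z) = (if y = z then 1 else 0)"
  shows "subst x0 (det (mat n n (\<lambda>(y, z). F y z))) = (1 :: 'a::comm_ring_1 mpoly)"
proof -
  have "map_mat (subst x0) (mat n n (\<lambda>(y, z). F y z)) = 1\<^sub>m n"
    using assms by (intro eq_matI) auto
  then show ?thesis by (simp flip: subst.hom_det)
qed

lemma subst_x0_contiguous: "subst x0 (det (contiguous r0 c0 t)) = (1 :: 'a::comm_ring_1 mpoly)"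
  unfolding contiguous_def
proof (rule subst_x0_det)
  fix y z assume "y < t" "z < t"
  then show "subst x0 (var (r0 + y) (c0 + z)) = (if y = z then 1 else (0 :: 'a mpoly))"
    using bounds(3,4) unfolding subst_x0_var by (auto simp: x0_def)
qed

lemma subst_x0_schur_entry:
  assumes "\<And>q. q < t \<Longrightarrow> x0 (i, c0 + q) = (0 :: 'a::comm_ring_1 mpoly)"
  shows "subst x0 (schur_entry r0 c0 t i j) = (x0 (i, j) :: 'a mpoly)"
  using assms
  by (simp add: schur_entry_def subst.hom_minus subst.hom_mult subst.hom_sum subst_x0_contiguous subst_x0_var)

text \<open>Within the r x s block, \<open>x0\<close> is a partial identity with t ones, which
  factors through size t.\<close>

lemma subst_x0_minor:
  assumes "\<And>x. x < Suc t \<Longrightarrow> \<rho> x < r" "\<And>x. x < Suc t \<Longrightarrow> \<sigma> x < s"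
  shows "subst x0 (minor \<rho> \<sigma> (Suc t)) = (0 :: 'a::comm_ring_1 mpoly)"
proof -
  have x0: "x0 (i, j) = (\<Sum>c<t. (if i = r0 + c then 1 else 0) * (if j = c0 + c then 1 else 0) :: 'a mpoly)"
    if "i < r" "j < s" for i j
  proof (cases "r0 \<le> i \<and> i < r - 1 \<and> c0 \<le> j \<and> i - r0 = j - c0")
    case True
    have "(\<Sum>c<t. (if i = r0 + c then 1 else 0) * (if j = c0 + c then 1 else 0) :: 'a mpoly) =
        (\<Sum>c<t. if c = i - r0 then 1 else 0)"
      using True by (intro sum.cong) auto
    then show ?thesis using True bounds by (simp add: x0_def) linarith
  next
    case False
    then have "(\<Sum>c<t. (if i = r0 + c then 1 else 0) * (if j = c0 + c then 1 else 0) :: 'a mpoly) = 0"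
      using bounds(3,4) by (intro sum.neutral) auto
    moreover have "\<not> (r \<le> i \<and> col0 \<le> j \<and> j < c0 \<and> i - r = j - col0)"
      "\<not> (row0 \<le> i \<and> i < r0 \<and> s \<le> j \<and> i - row0 = j - s)" using that by auto
    ultimately show ?thesis using False by (simp add: x0_def)
  qed
  have "subst x0 (minor \<rho> \<sigma> (Suc t)) = det (map_mat (subst x0) (mat (Suc t) (Suc t) (\<lambda>(a, b). var (\<rho> a) (\<sigma> b))) :: 'a mpoly mat)"
    by (simp add: minor_def)
  also have "map_mat (subst x0) (mat (Suc t) (Suc t) (\<lambda>(a, b). var (\<rho> a) (\<sigma> b))) =
      mat (Suc t) (Suc t) (\<lambda>(a, b). \<Sum>c<t. (if \<rho> a = r0 + c then 1 else 0) * (if \<sigma> b = c0 + c then 1 else 0) :: 'a mpoly)"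
    using x0 assms by (intro eq_matI) (auto simp: subst_x0_var)
  also have "det \<dots> = 0" by (rule det_low_rank) simp
  finally show ?thesis .
qed

end

lemma det_block_triangular:
  fixes F :: "nat \<Rightarrow> nat \<Rightarrow> 'a::idom"
  assumes "\<And>y z. y < a \<Longrightarrow> a \<le> z \<Longrightarrow> z < a + 1 + b \<Longrightarrow> F y z = 0"
    and "\<And>z. a < z \<Longrightarrow> z < a + 1 + b \<Longrightarrow> F a z = 0"
  shows "det (mat (a + 1 + b) (a + 1 + b) (\<lambda>(y, z). F y z)) =
    det (mat a a (\<lambda>(y, z). F y z)) * (F a a * det (mat b b (\<lambda>(y, z). F (a + 1 + y) (a + 1 + z))))"
proof -
  let ?G = "mat a a (\<lambda>(y, z). F y z)"
  let ?K = "mat (1 + b) (1 + b) (\<lambda>(y, z). F (a + y) (a + z))"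
  let ?H = "mat b b (\<lambda>(y, z). F (a + 1 + y) (a + 1 + z))"
  have "mat (a + 1 + b) (a + 1 + b) (\<lambda>(y, z). F y z) =
      four_block_mat ?G (0\<^sub>m a (1 + b)) (mat (1 + b) a (\<lambda>(y, z). F (a + y) z)) ?K"
    using assms by (intro eq_matI) auto
  then have "det (mat (a + 1 + b) (a + 1 + b) (\<lambda>(y, z). F y z)) = det ?G * det ?K"
    by (simp add: det_four_block_mat_upper_right_zero[of _ a _ "1 + b"])
  moreover have "?K = four_block_mat (mat 1 1 (\<lambda>_. F a a)) (0\<^sub>m 1 b) (mat b 1 (\<lambda>(y, z). F (a + 1 + y) a)) ?H"
    using assms by (intro eq_matI) (auto simp: less_Suc_eq One_nat_def)
  then have "det ?K = F a a * det ?H"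
    by (simp add: det_four_block_mat_upper_right_zero[of _ 1 _ b] det_single)
  ultimately show ?thesis by simp
qed

lemma sorted_in_mono: "sorted_in r n \<rho> \<Longrightarrow> r \<le> r' \<Longrightarrow> sorted_in r' n \<rho>"
  by (auto simp: sorted_in_def)

lemma box_minors_mono: "r \<le> r' \<Longrightarrow> s \<le> s' \<Longrightarrow> box_minors r s n \<subseteq> box_minors r' s' n"
  unfolding box_minors_def using sorted_in_mono by blast

locale pivot_residue = residue_field \<pi> + pivot k l r s t
  for \<pi> :: "'a::idom" and k l r s t
begin

text \<open>
  Modulo the minors vanishing away from the corner \<open>(r - 1, s - 1)\<close>, the Schur complement of the pivot
  in the block of \<open>diag_minor k l d\<close> is block triangular, with the corner minor as a middle block.
\<close>

lemma det_ideal_colon: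
  "\<exists>h\<in>mpolys (vars k l). det_ideal k l (box_minors r s (Suc t)) =
    {x \<in> mpolys (vars k l). x * h \<in> det_ideal k l
      (insert (diag_minor k l d) (box_minors (r - 1) s (Suc t) \<union> box_minors r (s - 1) (Suc t)))}"
proof -
  let ?V = "vars k l" and ?m = "a + 1 + b"
  define f where "f = (diag_minor k l d :: 'a mpoly)"
  define B1 where "B1 = (box_minors (r - 1) s (Suc t) :: 'a mpoly set)"
  define B2 where "B2 = (box_minors r (s - 1) (Suc t) :: 'a mpoly set)"
  define I where "I = det_ideal k l (insert f (B1 \<union> B2))"
  define P where "P = det_ideal k l (box_minors r s (Suc t))"
  have f: "f \<in> mpolys ?V" unfolding f_def using bounds tr rk ts sl by (intro mpolys_diag_minor) auto
  have B: "B1 \<subseteq> mpolys ?V" "B2 \<subseteq> mpolys ?V" unfolding B1_def B2_def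
    using rk sl by (simp_all add: box_minors_mpolys)
  have gens: "insert f (B1 \<union> B2) \<subseteq> mpolys ?V" using f B by blast
  note Pgens = box_minors_mpolys[OF rk sl, of "Suc t", where 'a='a]
  have I: "ideal I (mpoly_ring ?V)" unfolding I_def by (rule ideal_det_ideal[OF gens])
  have P: "ideal P (mpoly_ring ?V)" unfolding P_def by (rule ideal_det_ideal[OF Pgens])
  have fI: "f \<in> I" "B1 \<subseteq> I" "B2 \<subseteq> I" unfolding I_def using det_ideal_self[OF gens] by auto
  have boxP: "box_minors r s (Suc t) \<subseteq> P" unfolding P_def using det_ideal_self[OF Pgens] by auto
  have BP: "B1 \<subseteq> P" "B2 \<subseteq> P" using boxP box_minors_mono[of "r - 1" r s s "Suc t", where 'a='a]
    box_minors_mono[of r r "s - 1" s "Suc t", where 'a='a] by (auto simp: B1_def B2_def)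
  define E where "E i j = (schur_entry r0 c0 t i j :: 'a mpoly)" for i j
  define F where "F y z = E (R y) (S z)" for y z
  define \<Delta> where "\<Delta> = (det (contiguous r0 c0 t) :: 'a mpoly)"
  define G where "G = det (mat a a (\<lambda>(y, z). F y z))"
  define H where "H = det (mat b b (\<lambda>(y, z). F (a + 1 + y) (a + 1 + z)))"
  define M where "M = E (r - 1) (s - 1)"
  have rc: "r0 + t \<le> k" "c0 + t \<le> l" using bounds rk sl by linarith+
  have EV: "E i j \<in> mpolys ?V" if "i < k" "j < l" for i j
    unfolding E_def by (rule mpolys_schur_entry[OF rc that])
  have FV: "F y z \<in> mpolys ?V" if "y < ?m" "z < ?m" for y z
    unfolding F_def by (rule EV[OF R_less[OF that(1)] S_less[OF that(2)]])
  have \<Delta>V: "\<Delta> \<in> mpolys ?V" unfolding \<Delta>_def by (rule mpolys_det_contiguous[OF rc])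
  have GV: "G \<in> mpolys ?V" "H \<in> mpolys ?V"
  proof -
    show "G \<in> mpolys ?V" unfolding G_def by (rule mpolys_det[of _ a]) (auto intro!: FV)
    show "H \<in> mpolys ?V" unfolding H_def by (rule mpolys_det[of _ b]) (auto intro!: FV)
  qed
  \<comment> \<open>The entries replaced by 0 are those in rows below r and columns below s other
    than the corner; they lie in every ideal containing the minors of the two smaller
    blocks.\<close>
  define F0 where "F0 y z = (if y < a \<and> a \<le> z \<or> y = a \<and> a < z then 0 else F y z)" for y z
  have det_F0: "det (mat ?m ?m (\<lambda>(y, z). F0 y z)) = G * (M * H)"
  proof -
    have "mat a a (\<lambda>(y, z). F0 y z) = mat a a (\<lambda>(y, z). F y z)"
      "mat b b (\<lambda>(y, z). F0 (a + 1 + y) (a + 1 + z)) = mat b b (\<lambda>(y, z). F (a + 1 + y) (a + 1 + z))"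
      by (auto intro!: eq_matI simp: F0_def)
    moreover have "F0 a a = M" by (simp add: F0_def F_def M_def R_def S_def)
    moreover have "det (mat ?m ?m (\<lambda>(y, z). F0 y z)) = det (mat a a (\<lambda>(y, z). F0 y z)) *
        (F0 a a * det (mat b b (\<lambda>(y, z). F0 (a + 1 + y) (a + 1 + z))))"
      by (rule det_block_triangular) (auto simp: F0_def)
    ultimately show ?thesis unfolding G_def H_def by (simp only:)
  qed
  have det_F: "det (mat ?m ?m (\<lambda>(y, z). F y z)) - G * (M * H) \<in> J"
    if J: "ideal J (mpoly_ring ?V)" "B1 \<subseteq> J" "B2 \<subseteq> J" for J
    unfolding det_F0[symmetric]
  proof (rule det_diff_in_ideal[OF J(1)])
    fix y z assume yz: "y < ?m" "z < ?m"
    show "mat ?m ?m (\<lambda>(y, z). F y z) $$ (y, z) \<in> mpolys ?V"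
      "mat ?m ?m (\<lambda>(y, z). F0 y z) $$ (y, z) \<in> mpolys ?V" using FV[OF yz] yz by (auto simp: F0_def)
    have "F y z \<in> J" if "y < a \<and> a \<le> z \<or> y = a \<and> a < z"
    proof -
      have "R y < r" "S z < s" "(R y, S z) \<noteq> (r - 1, s - 1)"
        using that yz row0_a col0_b r_eq s_eq by (auto simp: R_def S_def)
      then show ?thesis unfolding F_def E_def using J
        by (intro schur_entry_mem[OF J(1)]) (auto simp: B1_def B2_def)
    qed
    then show "mat ?m ?m (\<lambda>(y, z). F y z) $$ (y, z) - mat ?m ?m (\<lambda>(y, z). F0 y z) $$ (y, z) \<in> J"
      using yz mpoly_ideal_zero[OF J(1)] by (auto simp: F0_def)
  qed auto
  have schur: "\<Delta> ^ ?m * f = \<Delta> * det (mat ?m ?m (\<lambda>(y, z). F y z)) \<or>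
      \<Delta> ^ ?m * - f = \<Delta> * det (mat ?m ?m (\<lambda>(y, z). F y z))"
    using schur_complement[of r0 c0 t ?m R S, where 'a='a] diag_minor_border[where 'a='a]
    by (auto simp: F_def E_def \<Delta>_def f_def)
  define h1 where "h1 = \<Delta> * G * H"
  have h1V: "h1 \<in> mpolys ?V" unfolding h1_def using \<Delta>V GV by auto
  have "\<Delta> * det (mat ?m ?m (\<lambda>(y, z). F y z)) \<in> I"
    using schur mpoly_ideal_mult[OF I mpolys_power[OF \<Delta>V] fI(1)]
      mpoly_ideal_mult[OF I mpolys_power[OF \<Delta>V] mpoly_ideal_uminus[OF I fI(1)]] by metis
  then have "\<Delta> * (G * (M * H)) \<in> I"
    using mpoly_ideal_diff[OF I _ mpoly_ideal_mult[OF I \<Delta>V det_F[OF I fI(2,3)]]]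
    by (force simp: right_diff_distrib)
  then have Mh: "M * h1 \<in> I" by (simp add: h1_def mult_ac)
  \<comment> \<open>All Schur entries of the r x s block lie in this quotient: those off the corner
    already lie in \<open>I\<close>, the corner one does after multiplication by
    \<open>h1\<close>.\<close>
  define J where "J = {x \<in> mpolys ?V. x * h1 \<in> I}"
  have J: "ideal J (mpoly_ring ?V)" unfolding J_def by (rule colon_ideal[OF I h1V])
  have BJ: "B1 \<subseteq> J" "B2 \<subseteq> J"
    using fI B mpoly_ideal_mult[OF I h1V] by (auto simp: J_def mult.commute)
  have MJ: "M \<in> J" using Mh EV[of "r - 1" "s - 1"] tr rk ts sl by (auto simp: J_def M_def)
  have EJ: "E i j \<in> J" if "i < r" "j < s" for i j
    using schur_entry_mem[OF J _ _ that] BJ MJ by (cases "(i, j) = (r - 1, s - 1)") (auto simp: E_def M_def B1_def B2_def)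
  \<comment> \<open>One factor \<Delta> for each of the t + 1 rows of the minors to be
    captured.\<close>
  define h where "h = \<Delta> ^ Suc t * h1"
  have hV: "h \<in> mpolys ?V" unfolding h_def using \<Delta>V h1V by auto
  have minor_h: "x * h \<in> I" if "x \<in> box_minors r s (Suc t)" for x
  proof -
    from that obtain \<rho> \<sigma> where x: "x = minor \<rho> \<sigma> (Suc t)" and so: "sorted_in r (Suc t) \<rho>" "sorted_in s (Suc t) \<sigma>"
      unfolding box_minors_def by blast
    let ?A = "mat (Suc t) (Suc t) (\<lambda>(x, y). \<Delta> * var (\<rho> x) (\<sigma> y))"
    let ?B = "mat (Suc t) (Suc t) (\<lambda>(x, y). low_rank_part r0 c0 t (\<rho> x) (\<sigma> y)) :: 'a mpoly mat"
    \<comment> \<open>Modulo \<open>J\<close> the Schur entries vanish, so \<Delta> times a variable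
      becomes the matching entry of a matrix of rank at most t.\<close>
    have "det ?A - det ?B \<in> J"
    proof (rule det_diff_in_ideal[OF J])
      fix x y assume xy: "x < Suc t" "y < Suc t"
      note lt = sorted_in_less[OF so(1) xy(1)] sorted_in_less[OF so(2) xy(2)]
      have ltk: "\<rho> x < k" "\<sigma> y < l" using lt rk sl by auto
      show "?A $$ (x, y) \<in> mpolys ?V" using xy ltk \<Delta>V by auto
      show "?B $$ (x, y) \<in> mpolys ?V" using xy mpolys_low_rank_part[OF rc ltk] by auto
      show "?A $$ (x, y) - ?B $$ (x, y) \<in> J"
        using EJ[OF lt] xy by (simp add: E_def schur_entry_def \<Delta>_def low_rank_part_def)
    qed auto
    moreover have "?A = \<Delta> \<cdot>\<^sub>m mat (Suc t) (Suc t) (\<lambda>(x, y). var (\<rho> x) (\<sigma> y))"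
      by (intro eq_matI) auto
    then have "det ?A = \<Delta> ^ Suc t * x" by (simp add: x minor_def)
    moreover have "det ?B = 0"
      unfolding low_rank_part_def by (rule det_low_rank) simp
    ultimately have "\<Delta> ^ Suc t * x \<in> J" by simp
    then show ?thesis by (simp add: J_def h_def mult_ac)
  qed
  \<comment> \<open>Evaluation at \<open>x0\<close> sends all of \<open>P\<close> to multiples of
    \<open>\<pi>\<close>, but sends \<Delta>, \<open>G\<close> and \<open>H\<close> to 1.\<close>
  have h_notin: "h \<notin> P" and \<Delta>_notin: "\<Delta> \<notin> P"
  proof -
    let ?K = "{x \<in> mpolys ?V. \<forall>m. \<pi> dvd lookup (subst x0 x) m}"
    have "ideal ?K (mpoly_ring ?V)"
    proof (rule mpoly_idealI)
      fix c x :: "'a mpoly" assume "c \<in> mpolys ?V" "x \<in> ?K"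
      then show "c * x \<in> ?K"
        by (auto simp: subst.hom_mult lookup_mult_sum intro!: dvd_sum)
    qed (auto simp: subst.hom_add lookup_add)
    moreover have "single 0 \<pi> \<in> ?K" by (auto simp: lookup_single when_def)
    moreover have "box_minors r s (Suc t) \<subseteq> ?K"
      using Pgens by (auto simp: box_minors_def subst_x0_minor sorted_in_less)
    ultimately have "P \<subseteq> ?K" unfolding P_def by (rule det_ideal_minimal)
    then have not_one: "x \<notin> P" if "subst x0 x = 1" for x
      using that not_dvd_one by (auto simp: lookup_one dest!: spec[of _ 0])
    have 1: "subst x0 \<Delta> = 1" unfolding \<Delta>_def by (rule subst_x0_contiguous)
    then show "\<Delta> \<notin> P" by (rule not_one)
    have Fx0: "subst x0 (F y z) = x0 (R y, S z)" if "y \<noteq> a" for y z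
      unfolding F_def E_def
    proof (rule subst_x0_schur_entry)
      fix q assume "q < t"
      then show "x0 (R y, c0 + q) = (0 :: 'a mpoly)"
        using that row0_a r_eq s_eq by (auto simp: x0_def R_def)
    qed
    have "subst x0 G = 1" unfolding G_def
    proof (rule subst_x0_det)
      fix y z assume "y < a" "z < a"
      then show "subst x0 (F y z) = (if y = z then 1 else 0)"
        using row0_a r_eq unfolding Fx0[OF less_imp_neq[OF \<open>y < a\<close>]] by (auto simp: x0_def R_def S_def)
    qed
    moreover have "subst x0 H = 1" unfolding H_def
    proof (rule subst_x0_det)
      fix y z assume "y < b" "z < b"
      have "R (a + 1 + y) = r + y" "S (a + 1 + z) = col0 + z"
        using tr by (auto simp: R_def S_def)
      moreover have "x0 (r + y, col0 + z) = (if y = z then 1 else (0 :: 'a mpoly))"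
        using col0_b r_eq \<open>y < b\<close> \<open>z < b\<close> by (auto simp: x0_def)
      ultimately show "subst x0 (F (a + 1 + y) (a + 1 + z)) = (if y = z then 1 else 0)"
        by (simp add: Fx0)
    qed
    ultimately show "h \<notin> P"
      using 1 by (intro not_one) (simp add: h_def h1_def subst.hom_mult subst.hom_power)
  qed
  have fP: "f \<in> P"
  proof -
    have "M \<in> P" unfolding M_def E_def by (rule schur_corner_mem[OF P boxP])
    then have "G * (M * H) \<in> P"
      using mpoly_ideal_mult[OF P, of "G * H" M] GV by (auto simp: mult_ac)
    then have "det (mat ?m ?m (\<lambda>(y, z). F y z)) \<in> P"
      using mpoly_ideal_eq[OF P det_F[OF P BP]] by simp
    then have "\<Delta> * det (mat ?m ?m (\<lambda>(y, z). F y z)) \<in> P" by (rule mpoly_ideal_mult[OF P \<Delta>V])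
    then have *: "f * \<Delta> ^ ?m \<in> P"
      using schur mpoly_ideal_uminus[OF P, of "\<Delta> ^ ?m * - f"] by (auto simp: mult.commute)
    \<comment> \<open>Powers of \<Delta> cancel because \<open>P\<close> is prime and does not
      contain \<Delta>.\<close>
    have "f * \<Delta> ^ n \<in> P \<Longrightarrow> f \<in> P" for n
    proof (induction n)
      case (Suc n)
      have "f * \<Delta> ^ n * \<Delta> \<in> P" using Suc.prems by (simp add: mult_ac)
      then have "f * \<Delta> ^ n \<in> P"
        using det_ideal_prime[OF rk sl, of "f * \<Delta> ^ n" \<Delta> t] \<Delta>_notin f \<Delta>V
        unfolding P_def by blast
      then show ?case by (rule Suc.IH)
    qed simp
    then show "f \<in> P" using * .
  qed
  have "I \<subseteq> P" unfolding I_def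
    using P fP BP by (intro det_ideal_minimal) (auto simp: P_def det_ideal_def intro!: gen_self[OF det_ideal_gens[OF Pgens]])
  have "P = {x \<in> mpolys ?V. x * h \<in> I}"
  proof
    show "P \<subseteq> {x \<in> mpolys ?V. x * h \<in> I}"
      unfolding P_def
    proof (rule det_ideal_minimal[OF colon_ideal[OF I hV]])
      have "single 0 \<pi> \<in> I" unfolding I_def det_ideal_def by (intro gen_self[OF det_ideal_gens[OF gens]]) simp
      then show "single 0 \<pi> \<in> {x \<in> mpolys ?V. x * h \<in> I}"
        using mpoly_ideal_mult[OF I hV, of "single 0 \<pi>"] by (auto simp: mult.commute[of _ h])
      show "box_minors r s (Suc t) \<subseteq> {x \<in> mpolys ?V. x * h \<in> I}" using Pgens minor_h by auto
    qed
    show "{x \<in> mpolys ?V. x * h \<in> I} \<subseteq> P"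
      using det_ideal_prime[OF rk sl, of _ h t] \<open>I \<subseteq> P\<close> hV h_notin unfolding P_def by blast
  qed
  then show ?thesis using hV unfolding P_def I_def f_def B1_def B2_def by blast
qed

end

lemma box_minors_empty: "r < n \<Longrightarrow> box_minors r s n = {}" "s < n \<Longrightarrow> box_minors r s n = {}"
proof -
  have "\<not> sorted_in r n \<rho>" if "r < n" for r n \<rho>
  proof
    assume "sorted_in r n \<rho>"
    then have "card {..<n} \<le> card {..<r}"
      by (intro card_inj_on_le[of \<rho>]) (auto simp: sorted_in_def intro: strict_mono_on_imp_inj_on)
    then show False using that by simp
  qed
  then show "r < n \<Longrightarrow> box_minors r s n = {}" "s < n \<Longrightarrow> box_minors r s n = {}"
    by (auto simp: box_minors_def)
qed

section \<open>Induction over the northwest blocks\<close>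

context residue_field
begin

text \<open>The class is left abstract because the induction is run twice: for the ideals preserved
  by the splitting and for the Knutson ideals.\<close>

lemma det_ideal_closure:
  assumes kl: "1 \<le> k" "1 \<le> l"
    and base: "\<And>d. d < k + l - 1 \<Longrightarrow> det_ideal k l {diag_minor k l d} \<in> \<C>"
    and add: "\<And>G H. G \<subseteq> mpolys (vars k l) \<Longrightarrow> H \<subseteq> mpolys (vars k l) \<Longrightarrow>
      det_ideal k l G \<in> \<C> \<Longrightarrow> det_ideal k l H \<in> \<C> \<Longrightarrow> det_ideal k l (G \<union> H) \<in> \<C>"
    and colon: "\<And>I h. I \<in> \<C> \<Longrightarrow> ideal I (mpoly_ring (vars k l)) \<Longrightarrow> h \<in> mpolys (vars k l) \<Longrightarrow>
      {x \<in> mpolys (vars k l). x * h \<in> I} \<in> \<C>"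
  shows "t < r \<Longrightarrow> r \<le> k \<Longrightarrow> t < s \<Longrightarrow> s \<le> l \<Longrightarrow> det_ideal k l (box_minors r s (Suc t)) \<in> \<C>"
proof (induction "r + s" arbitrary: r s rule: less_induct)
  case less
  interpret pivot_residue \<pi> k l r s t
    by unfold_locales (use less.prems in auto)
  have f: "diag_minor k l d \<in> mpolys (vars k l)" using bounds(8) kl by (rule mpolys_diag_minor)
  \<comment> \<open>A block too small for (t + 1)-minors adds no generators. Treating it here spares
    the class from having to contain the ideal of an empty set of minors.\<close>
  have add_box: "det_ideal k l (G \<union> box_minors r' s' (Suc t)) \<in> \<C>"
    if "G \<subseteq> mpolys (vars k l)" "det_ideal k l G \<in> \<C>" "r' \<le> r" "s' \<le> s" "r' + s' < r + s" for G r' s'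
  proof (cases "t < r' \<and> t < s'")
    case True
    then have "det_ideal k l (box_minors r' s' (Suc t)) \<in> \<C>" using less that by auto
    moreover have "box_minors r' s' (Suc t) \<subseteq> (mpolys (vars k l) :: 'a mpoly set)"
      using that less.prems by (intro box_minors_mpolys) auto
    ultimately show ?thesis using add that by blast
  next
    case False
    then have "r' < Suc t \<or> s' < Suc t" by auto
    then have "box_minors r' s' (Suc t) = ({} :: 'a mpoly set)" using box_minors_empty by blast
    then show ?thesis using that(2) by simp
  qed
  let ?G = "{diag_minor k l d} \<union> box_minors (r - 1) s (Suc t) \<union> box_minors r (s - 1) (Suc t) :: 'a mpoly set"
  have sub: "{diag_minor k l d} \<union> box_minors (r - 1) s (Suc t) \<subseteq> (mpolys (vars k l) :: 'a mpoly set)"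
    "box_minors r (s - 1) (Suc t) \<subseteq> (mpolys (vars k l) :: 'a mpoly set)"
    using f less.prems box_minors_mpolys[of "r - 1" k s l "Suc t", where 'a='a]
      box_minors_mpolys[of r k "s - 1" l "Suc t", where 'a='a] by auto
  have "det_ideal k l ?G \<in> \<C>"
    using less.prems f base[OF bounds(8)] sub(1) by (intro add_box) auto
  moreover have "?G = insert (diag_minor k l d) (box_minors (r - 1) s (Suc t) \<union> box_minors r (s - 1) (Suc t))"
    by simp
  moreover have "ideal (det_ideal k l ?G) (mpoly_ring (vars k l))"
    using sub by (intro ideal_det_ideal) blast
  ultimately have G: "det_ideal k l (insert (diag_minor k l d) (box_minors (r - 1) s (Suc t) \<union> box_minors r (s - 1) (Suc t))) \<in> \<C>"
    "ideal (det_ideal k l (insert (diag_minor k l d) (box_minors (r - 1) s (Suc t) \<union> box_minors r (s - 1) (Suc t))))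
      (mpoly_ring (vars k l))" by simp_all
  obtain h where h: "h \<in> mpolys (vars k l)" "det_ideal k l (box_minors r s (Suc t)) =
    {x \<in> mpolys (vars k l). x * h \<in> det_ideal k l
      (insert (diag_minor k l d) (box_minors (r - 1) s (Suc t) \<union> box_minors r (s - 1) (Suc t)))}"
    using det_ideal_colon by blast
  show ?case unfolding h(2) by (rule colon[OF G h(1)])
qed

end

section \<open>Ideals compatible with a Frobenius splitting\<close>

lemma freshman:
  fixes x y :: "'a::comm_ring_1"
  assumes "prime p"
  shows "\<exists>z. (x + y) ^ p = x ^ p + y ^ p + of_nat p * z"
proof -
  have p: "1 < p" using prime_gt_1_nat[OF assms] .
  have "\<exists>z. of_nat (p choose i) * x ^ i * y ^ (p - i) = of_nat p * z" if "0 < i" "i < p" for i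
  proof -
    have "p dvd p choose i" using assms that by (intro dvd_choose_prime) auto
    then obtain c where "p choose i = p * c" by blast
    then show ?thesis by (intro exI[of _ "of_nat c * x ^ i * y ^ (p - i)"]) (simp add: mult.assoc)
  qed
  then obtain z where z: "\<And>i. 0 < i \<Longrightarrow> i < p \<Longrightarrow> of_nat (p choose i) * x ^ i * y ^ (p - i) = of_nat p * z i"
    by metis
  have "(x + y) ^ p = (\<Sum>i\<le>p. of_nat (p choose i) * x ^ i * y ^ (p - i))"
    by (rule binomial_ring)
  also have "{..p} = insert 0 (insert p {0<..<p})" using p by auto
  also have "(\<Sum>i\<in>insert 0 (insert p {0<..<p}). of_nat (p choose i) * x ^ i * y ^ (p - i)) =
      y ^ p + (x ^ p + (\<Sum>i\<in>{0<..<p}. of_nat (p choose i) * x ^ i * y ^ (p - i)))"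
    using p by simp
  also have "(\<Sum>i\<in>{0<..<p}. of_nat (p choose i) * x ^ i * y ^ (p - i)) = of_nat p * (\<Sum>i\<in>{0<..<p}. z i)"
    using z by (simp add: sum_distrib_left)
  finally show ?thesis by (intro exI[of _ "\<Sum>i\<in>{0<..<p}. z i"]) (simp add: algebra_simps)
qed

lemma lookup_const_sum: "lookup (\<Sum>i<n. m) v = n * lookup m v" for m :: mon and n :: nat
  by (simp add: lookup_sum)

lemma single_power: "single m c ^ n = (single (\<Sum>i<n. m) (c ^ n) :: 'a::comm_ring_1 mpoly)"
proof (induction n)
  case (Suc n)
  then show ?case by (simp add: mult_single add.commute)
qed simp

text \<open>Modulo \<open>\<pi>\<close>, \<open>\<tau>\<close> is an additive left inverse of the
  p-th power map on coefficients and is linear over p-th powers. It stands in for p-th roots, which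
  need not exist in the field.\<close>

locale frobenius_residue = residue_field \<pi> for \<pi> :: "'a::idom" +
  fixes p :: nat and \<tau> :: "'a \<Rightarrow> 'a"
  assumes p: "prime p" and dvd_p: "\<pi> dvd of_nat p"
    and \<tau>_add: "\<tau> (a + b) = \<tau> a + \<tau> b"
    and \<tau>_frobenius: "\<pi> dvd \<tau> (a ^ p * b) - a * \<tau> b"
    and \<tau>_one: "\<tau> 1 = 1"
    and \<tau>_dvd: "\<pi> dvd a \<Longrightarrow> \<pi> dvd \<tau> a"
begin

lemma \<tau>_zero [simp]: "\<tau> 0 = 0"
  using \<tau>_add[of 0 0] by (metis add.right_neutral add_left_cancel)

lemma \<tau>_uminus: "\<tau> (- a) = - \<tau> a"
  using \<tau>_add[of a "- a"] by (simp add: add_eq_0_iff)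

definition residual :: "'a mpoly set" where
  "residual = {g. \<forall>m. \<pi> dvd lookup g m}"

lemma residual_zero: "0 \<in> residual"
  and residual_add: "x \<in> residual \<Longrightarrow> y \<in> residual \<Longrightarrow> x + y \<in> residual"
  and residual_mult: "x \<in> residual \<Longrightarrow> x * y \<in> residual"
  by (auto simp: residual_def lookup_add lookup_mult_sum intro!: dvd_sum)

lemma residual_of_nat_p: "of_nat p * z \<in> residual"
proof -
  have "of_nat p = (single 0 (of_nat p) :: 'a mpoly)" by simp
  then show ?thesis using dvd_p by (simp only: residual_def lookup_const_mult mem_Collect_eq) simp
qed

lemma power_p_residual:
  "g ^ p - (\<Sum>m\<in>keys g. single (\<Sum>i<p. m) (lookup g m ^ p)) \<in> residual"
proof -
  have "(\<Sum>m\<in>M. single m (c m)) ^ p - (\<Sum>m\<in>M. single (\<Sum>i<p. m) (c m ^ p)) \<in> residual"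
    if "finite M" for M and c :: "mon \<Rightarrow> 'a"
    using that
  proof (induction M rule: finite_induct)
    case empty
    then show ?case using prime_gt_0_nat[OF p] by (simp add: residual_zero zero_power)
  next
    case (insert m M)
    obtain z where "(single m (c m) + (\<Sum>m\<in>M. single m (c m))) ^ p =
        single m (c m) ^ p + (\<Sum>m\<in>M. single m (c m)) ^ p + of_nat p * z"
      using freshman[OF p] by blast
    then have "(\<Sum>m\<in>insert m M. single m (c m)) ^ p - (\<Sum>m\<in>insert m M. single (\<Sum>i<p. m) (c m ^ p)) =
        ((\<Sum>m\<in>M. single m (c m)) ^ p - (\<Sum>m\<in>M. single (\<Sum>i<p. m) (c m ^ p))) + of_nat p * z"
      using insert(1,2) by (simp add: single_power)
    then show ?case by (simp only: residual_add[OF insert(3) residual_of_nat_p])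
  qed
  from this[OF finite_keys, of "lookup g" g] show ?thesis
    unfolding poly_mapping_sum_single[of g, symmetric] .
qed

end

locale frobenius_splitting = frobenius_residue \<pi> p \<tau>
  for \<pi> :: "'a::idom" and p \<tau> +
  fixes k l :: nat and ord and F :: "'a mpoly"
  assumes kl: "1 \<le> k" "1 \<le> l"
    and E: "antidiagonal_exchange (vars k l) ord"
    and F: "F \<in> mpolys (vars k l)" "unit_lead ord F (\<Sum>v\<in>vars k l. single v 1)"
begin

lemma T: "term_order (vars k l) ord"
  using E by (simp add: antidiagonal_exchange_def)

definition ones :: mon where
  "ones = (\<Sum>v\<in>vars k l. single v 1)"

definition stretch :: "mon \<Rightarrow> mon" where
  "stretch n = (\<Sum>i<p. n) + (\<Sum>i<p - 1. ones)"

lemma lookup_ones: "lookup ones v = (if v \<in> vars k l then 1 else 0)"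
proof -
  have "lookup ones v = (\<Sum>w\<in>vars k l. if w = v then 1 else 0)"
    unfolding ones_def lookup_sum by (intro sum.cong) (auto simp: lookup_single when_def)
  then show ?thesis by simp
qed

lemma lookup_stretch: "lookup (stretch n) v = p * lookup n v + (if v \<in> vars k l then p - 1 else 0)"
  by (simp add: stretch_def lookup_add lookup_const_sum lookup_ones)

lemma inj_stretch: "inj stretch"
proof
  fix m n assume "stretch m = stretch n"
  then have "lookup (stretch m) v = lookup (stretch n) v" for v by simp
  then show "m = n"
    using prime_gt_0_nat[OF p] by (intro poly_mapping_eqI) (simp add: lookup_stretch)
qed

text \<open>The trace map sends \<open>c x\<^bsup>pn + p - 1\<^esup>\<close> to \<open>\<tau>(c) x\<^bsup>n\<^esup>\<close> and every other monomial to 0.\<close>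

definition trace :: "'a mpoly \<Rightarrow> 'a mpoly" where
  "trace g = Abs_poly_mapping (\<lambda>n. if n \<in> monomials (vars k l) then \<tau> (lookup g (stretch n)) else 0)"

lemma lookup_trace:
  "lookup (trace g) n = (if n \<in> monomials (vars k l) then \<tau> (lookup g (stretch n)) else 0)"
proof -
  let ?f = "\<lambda>n. if n \<in> monomials (vars k l) then \<tau> (lookup g (stretch n)) else 0"
  have "{n. ?f n \<noteq> 0} \<subseteq> stretch -` keys g" by (auto simp: in_keys_iff)
  then have "finite {n. ?f n \<noteq> 0}"
    using finite_vimageI[OF finite_keys inj_stretch] finite_subset by blast
  then show ?thesis unfolding trace_def by (subst lookup_Abs_poly_mapping) auto
qed

lemma trace_add: "trace (x + y) = trace x + trace y"
  by (rule poly_mapping_eqI) (simp add: lookup_trace lookup_add \<tau>_add)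

lemma trace_zero [simp]: "trace 0 = 0"
  by (rule poly_mapping_eqI) (simp add: lookup_trace)

lemma trace_diff: "trace (x - y) = trace x - trace y"
  using trace_add[of "x - y" y] by simp

lemma trace_sum: "trace (sum f A) = (\<Sum>a\<in>A. trace (f a))"
  by (induction A rule: infinite_finite_induct) (auto simp: trace_add)

lemma mpolys_trace: "trace g \<in> mpolys (vars k l)"
  unfolding mpolys_iff by (auto simp: in_keys_iff lookup_trace split: if_splits)

lemma trace_residual: "x \<in> residual \<Longrightarrow> trace x \<in> residual"
  by (auto simp: residual_def lookup_trace intro: \<tau>_dvd)

lemma lookup_trace_single_mult:
  assumes m: "m \<in> monomials (vars k l)" and n: "n \<in> monomials (vars k l)"
  shows "m + n \<in> monomials (vars k l)" "lookup (trace (single (\<Sum>i<p. m) c * g)) (m + n) = \<tau> (c * lookup g (stretch n))"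
proof -
  show mn: "m + n \<in> monomials (vars k l)" using m n by (rule monomials_add)
  have "stretch (m + n) = (\<Sum>i<p. m) + stretch n"
    by (simp add: stretch_def sum.distrib add.assoc)
  then show "lookup (trace (single (\<Sum>i<p. m) c * g)) (m + n) = \<tau> (c * lookup g (stretch n))"
    using mn by (simp add: lookup_trace lookup_single_mult)
qed

lemma lookup_trace_single_mult_eq_0:
  assumes m: "m \<in> monomials (vars k l)" and w: "\<And>n. w \<noteq> m + n"
  shows "lookup (trace (single (\<Sum>i<p. m) c * g)) w = 0"
proof (cases "w \<in> monomials (vars k l)")
  case True
  have "stretch w \<noteq> (\<Sum>i<p. m) + u" for u
  proof
    assume eq: "stretch w = (\<Sum>i<p. m) + u"
    have "lookup m v \<le> lookup w v" for v
    proof -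
      have "lookup (stretch w) v = lookup ((\<Sum>i<p. m) + u) v" by (simp add: eq)
      \<comment> \<open>Division by p rounds down: p m \<le> p w + (p - 1) at each variable gives m
        \<le> w, so m would divide w.\<close>
      then have "p * lookup m v \<le> p * lookup w v + (p - 1)"
        by (simp add: lookup_stretch lookup_add lookup_const_sum split: if_splits)
      then have "p * lookup m v < p * Suc (lookup w v)" using prime_gt_0_nat[OF p] by simp
      then show ?thesis using prime_gt_0_nat[OF p] by (simp only: mult_less_cancel1) simp
    qed
    then have "w = m + (w - m)" by (intro poly_mapping_eqI) (simp add: lookup_add lookup_minus)
    then show False using w by blast
  qed
  then show ?thesis using True by (simp add: lookup_trace lookup_single_mult_eq_0)
qed (simp add: lookup_trace)

lemma trace_single_mult:
  assumes "m \<in> monomials (vars k l)"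
  shows "trace (single (\<Sum>i<p. m) (c ^ p) * g) - single m c * trace g \<in> residual"
  unfolding residual_def
proof (intro CollectI allI)
  fix w
  show "\<pi> dvd lookup (trace (single (\<Sum>i<p. m) (c ^ p) * g) - single m c * trace g) w"
  proof (cases "\<exists>n. w = m + n")
    case True
    then obtain n where w: "w = m + n" by blast
    show ?thesis
    proof (cases "n \<in> monomials (vars k l)")
      case True
      have "lookup (single m c * trace g) w = c * \<tau> (lookup g (stretch n))"
        using True by (simp add: w lookup_single_mult lookup_trace)
      then show ?thesis
        using lookup_trace_single_mult(2)[OF assms True] \<tau>_frobenius by (simp add: w lookup_minus)
    next
      case False
      then have "w \<notin> monomials (vars k l)" unfolding w monomials_iff lookup_add by auto
      then show ?thesis using False by (simp add: w lookup_minus lookup_trace lookup_single_mult)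
    qed
  next
    case False
    then show ?thesis
      using lookup_trace_single_mult_eq_0[OF assms, of w]
      by (simp add: lookup_minus lookup_single_mult_eq_0)
  qed
qed

lemma trace_power_mult:
  assumes "x \<in> mpolys (vars k l)"
  shows "trace (x ^ p * g) - x * trace g \<in> residual"
proof -
  let ?x = "\<Sum>m\<in>keys x. single (\<Sum>i<p. m) (lookup x m ^ p)"
  have "(x ^ p - ?x) * g \<in> residual" by (rule residual_mult[OF power_p_residual])
  then have 1: "trace (x ^ p * g) - trace (?x * g) \<in> residual"
    by (simp only: left_diff_distrib trace_diff[symmetric] trace_residual)
  have "trace (?x * g) - x * trace g =
      (\<Sum>m\<in>keys x. trace (single (\<Sum>i<p. m) (lookup x m ^ p) * g) - single m (lookup x m) * trace g)"
  proof -
    have "x * trace g = (\<Sum>m\<in>keys x. single m (lookup x m) * trace g)"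
      unfolding sum_distrib_right[symmetric] by (simp flip: poly_mapping_sum_single)
    then show ?thesis by (simp add: sum_distrib_right trace_sum sum_subtractf)
  qed
  also have "\<dots> \<in> residual"
  proof -
    have "(\<Sum>m\<in>M. trace (single (\<Sum>i<p. m) (lookup x m ^ p) * g) - single m (lookup x m) * trace g) \<in> residual"
      if "M \<subseteq> keys x" for M
      using finite_subset[OF that finite_keys] that
    proof (induction M rule: finite_induct)
      case (insert m M)
      then have "m \<in> monomials (vars k l)" using assms by (auto simp: mpolys_iff)
      then show ?case using insert by (auto intro!: residual_add trace_single_mult)
    qed (simp add: residual_zero)
    then show ?thesis by blast
  qed
  finally have 2: "trace (?x * g) - x * trace g \<in> residual" .
  from residual_add[OF 1 2] show ?thesis by simp
qed

text \<open>The factor F^(p-1) makes the ideals of divisors of F stable under the trace and shifts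
  leading monomials to exponents that \<open>trace\<close> keeps.\<close>

definition split :: "'a mpoly \<Rightarrow> 'a mpoly" where
  "split g = trace (F ^ (p - 1) * g)"

lemma split_add: "split (x + y) = split x + split y"
  by (simp add: split_def distrib_left trace_add)

lemma split_zero [simp]: "split 0 = 0"
  by (simp add: split_def)

lemma mpolys_split: "split g \<in> mpolys (vars k l)"
  by (simp add: split_def mpolys_trace)

lemma split_power_mult:
  assumes "x \<in> mpolys (vars k l)"
  shows "split (x ^ p * g) - x * split g \<in> residual"
  using trace_power_mult[OF assms, of "F ^ (p - 1) * g"] by (simp add: split_def mult_ac)

lemma split_residual: "x \<in> residual \<Longrightarrow> split x \<in> residual"
  unfolding split_def by (metis mult.commute residual_mult trace_residual)

section \<open>Closure properties of compatible ideals\<close>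

definition compatible :: "'a mpoly set \<Rightarrow> bool" where
  "compatible I \<longleftrightarrow> ideal I (mpoly_ring (vars k l)) \<and> single 0 \<pi> \<in> I \<and> (\<forall>x\<in>I. split x \<in> I)"

lemma residual_mem: "compatible I \<Longrightarrow> x \<in> residual \<Longrightarrow> x \<in> mpolys (vars k l) \<Longrightarrow> x \<in> I"
  unfolding compatible_def residual_def by (auto intro: residue_mem)

lemma power_p: "x ^ p = x * x ^ (p - 1)" for x :: "'a mpoly"
  using prime_gt_0_nat[OF p] by (cases p) auto

text \<open>If F = g f', then F^(p-1) g = g^p f'^(p-1), and the trace pulls g^p out as g. So the
  ideal generated by a divisor of F is stable under \<open>split\<close>.\<close>

lemma compatible_det_ideal_base:
  assumes G: "G \<subseteq> mpolys (vars k l)" and dvd: "\<And>f. f \<in> G \<Longrightarrow> \<exists>g\<in>mpolys (vars k l). F = f * g"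
  shows "compatible (det_ideal k l G)"
proof -
  let ?I = "det_ideal k l G"
  note I = ideal_det_ideal[OF G]
  have \<pi>: "single 0 \<pi> \<in> ?I"
    unfolding det_ideal_def by (rule gen_self[OF det_ideal_gens[OF G]]) simp
  have res: "x \<in> ?I" if "x \<in> residual" "x \<in> mpolys (vars k l)" for x
    using residue_mem[OF I \<pi>] that by (auto simp: residual_def)
  have "split x \<in> ?I" if "x \<in> ?I" for x
    using that det_ideal_gens[OF G] unfolding det_ideal_def
  proof (induction x rule: gen_induct)
    case zero
    then show ?case using mpoly_ideal_zero[OF I] by (simp add: det_ideal_def)
  next
    case (add x y)
    then show ?case using mpoly_ideal_add[OF I] by (simp add: split_add det_ideal_def)
  next
    case (single u c g)
    from single(2) consider "g = single 0 \<pi>" | "g \<in> G" by blast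
    then have "split (Poly_Mapping.single u c * g) \<in> ?I"
    proof cases
      case 1
      then have "Poly_Mapping.single u c * g \<in> residual"
        by (auto simp: residual_def mult_single lookup_single when_def)
      then show ?thesis by (intro res split_residual mpolys_split)
    next
      case 2
      then obtain f' where f': "f' \<in> mpolys (vars k l)" "F = g * f'" using dvd by blast
      have g: "g \<in> mpolys (vars k l)" "g \<in> ?I" using 2 G det_ideal_self[OF G] by auto
      let ?h = "f' ^ (p - 1) * Poly_Mapping.single u c"
      have "F ^ (p - 1) * (Poly_Mapping.single u c * g) = g ^ p * ?h"
        unfolding f'(2) by (simp add: power_mult_distrib power_p mult_ac)
      then have "split (Poly_Mapping.single u c * g) = trace (g ^ p * ?h)"
        unfolding split_def by (rule arg_cong)
      moreover have "trace (g ^ p * ?h) - g * trace ?h \<in> ?I"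
        using g(1) by (intro res trace_power_mult mpolys_diff mpolys_mult mpolys_trace)
      moreover have "g * trace ?h \<in> ?I"
        using mpoly_ideal_mult[OF I mpolys_trace g(2)] by (simp add: mult.commute)
      ultimately show ?thesis using mpoly_ideal_eq[OF I] by metis
    qed
    then show ?case by (simp add: det_ideal_def)
  qed
  then show ?thesis unfolding compatible_def using I \<pi> by blast
qed

lemma compatible_Un:
  assumes "G \<subseteq> mpolys (vars k l)" "H \<subseteq> mpolys (vars k l)"
    and "compatible (det_ideal k l G)" "compatible (det_ideal k l H)"
  shows "compatible (det_ideal k l (G \<union> H))"
proof -
  have GH: "G \<union> H \<subseteq> mpolys (vars k l)" using assms by blast
  have "split x \<in> det_ideal k l (G \<union> H)" if "x \<in> det_ideal k l (G \<union> H)" for x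
  proof -
    from that obtain y z where "x = y + z" "y \<in> det_ideal k l G" "z \<in> det_ideal k l H"
      unfolding det_ideal_Un[OF assms(1,2)] set_add_mpoly by blast
    then show ?thesis using assms(3,4) unfolding det_ideal_Un[OF assms(1,2)] set_add_mpoly
      by (auto simp: split_add compatible_def)
  qed
  then show ?thesis unfolding compatible_def using ideal_det_ideal[OF GH]
    by (auto simp: det_ideal_def intro!: gen_self[OF det_ideal_gens[OF GH]])
qed

lemma compatible_Int:
  assumes "compatible I" "compatible J"
  shows "compatible (I \<inter> J)"
proof -
  have "ideal (I \<inter> J) (mpoly_ring (vars k l))"
    using assms by (intro mpoly_ring.i_intersect) (auto simp: compatible_def)
  then show ?thesis using assms by (auto simp: compatible_def)
qed

text \<open>If x h is in I, so is h^p x, and its image under \<open>split\<close> is h times the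
  image of x modulo \<open>\<pi>\<close>.\<close>

lemma compatible_colon:
  assumes I: "compatible I" and h: "h \<in> mpolys (vars k l)"
  shows "compatible {x \<in> mpolys (vars k l). x * h \<in> I}"
proof -
  have id: "ideal I (mpoly_ring (vars k l))" and \<pi>: "single 0 \<pi> \<in> I" using I by (auto simp: compatible_def)
  have "split x * h \<in> I" if "x * h \<in> I" for x
  proof -
    have "h ^ (p - 1) * (x * h) \<in> I" using mpoly_ideal_mult[OF id mpolys_power[OF h] that] .
    then have "split (h ^ p * x) \<in> I" using I by (simp add: compatible_def power_p mult_ac)
    moreover have "split (h ^ p * x) - h * split x \<in> I"
      using h by (intro residual_mem[OF I] split_power_mult mpolys_diff mpolys_mult mpolys_split)
    ultimately show ?thesis using mpoly_ideal_eq[OF id] by (metis mult.commute)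
  qed
  moreover have "single 0 \<pi> * h \<in> I"
    using mpoly_ideal_mult[OF id h \<pi>] by (simp add: mult.commute)
  ultimately show ?thesis
    unfolding compatible_def using colon_ideal[OF id h] by (auto intro: mpolys_split)
qed

lemma compatible_box:
  assumes base: "\<And>d. d < k + l - 1 \<Longrightarrow> \<exists>g\<in>mpolys (vars k l). F = diag_minor k l d * g"
    and "r \<le> k" "s \<le> l"
  shows "compatible (det_ideal k l (box_minors r s (Suc t)))"
proof (cases "t < r \<and> t < s")
  case True
  have "det_ideal k l (box_minors r s (Suc t)) \<in> Collect compatible"
  proof (rule det_ideal_closure[OF kl])
    show "det_ideal k l {diag_minor k l d} \<in> Collect compatible" if "d < k + l - 1" for d
      using compatible_det_ideal_base[of "{diag_minor k l d}"] base[OF that] mpolys_diag_minor[OF that kl] by auto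
  qed (use True assms compatible_Un compatible_colon in auto)
  then show ?thesis by simp
next
  case False
  then have "r < Suc t \<or> s < Suc t" by auto
  then have "box_minors r s (Suc t) = ({} :: 'a mpoly set)" using box_minors_empty by blast
  then show ?thesis using compatible_det_ideal_base[of "{}"] by simp
qed

section \<open>Initial ideals of compatible ideals\<close>

lemma stretch_mono:
  assumes "m \<in> monomials (vars k l)" "n \<in> monomials (vars k l)" "(stretch m, stretch n) \<in> ord"
  shows "(m, n) \<in> ord"
proof (rule ccontr)
  assume "(m, n) \<notin> ord"
  then have nm: "(n, m) \<in> ord" using term_order_total[OF T assms(1,2)] by blast
  have "ones \<in> monomials (vars k l)" unfolding ones_def by (auto intro!: monomials_sum monomials_single)
  then have "(stretch n, stretch m) \<in> ord"
    unfolding stretch_def using nm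
    by (intro term_order_add_mono[OF T] term_order_sum_mono[OF T] term_order_refl[OF T]) auto
  then have "stretch m = stretch n" using assms(3) term_order_antisym[OF T] by blast
  then have "m = n" using inj_stretch by (simp add: inj_eq)
  then show False using \<open>(m, n) \<notin> ord\<close> nm by simp
qed

text \<open>F^(p-1) x leads with \<open>stretch n\<close>, which the trace maps to n, and the trace
  respects the order. The leading coefficient is normalised to 1 because \<open>\<tau>\<close> may
  vanish at other values.\<close>

lemma lead_split:
  assumes lead: "lead \<pi> ord x (\<Sum>i<p. n)" and one: "\<pi> dvd lookup x (\<Sum>i<p. n) - 1"
    and n: "n \<in> monomials (vars k l)"
  shows "lead \<pi> ord (split x) n"
proof -
  define e where "e = lookup (F ^ (p - 1)) (\<Sum>i<p - 1. ones)"
  have uF: "unit_lead ord (F ^ (p - 1)) (\<Sum>i<p - 1. ones)"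
    using unit_lead_power[OF T F(2), of "p - 1"] by (simp add: ones_def)
  then have e: "e = 1 \<or> e = -1" by (auto simp: unit_lead_def e_def)
  note mult = lead_mult[OF prime_mod T unit_lead_lead[OF uF not_dvd_one] lead]
  have st: "(\<Sum>i<p - 1. ones) + (\<Sum>i<p. n) = stretch n" by (simp add: stretch_def add.commute)
  have "\<pi> dvd lookup (F ^ (p - 1) * x) (stretch n) - e * lookup x (\<Sum>i<p. n)"
    using mult(2) by (simp add: st e_def)
  moreover have "\<pi> dvd e * lookup x (\<Sum>i<p. n) - e"
    using one by (metis dvd_mult mult.right_neutral right_diff_distrib)
  ultimately have "\<pi> dvd lookup (F ^ (p - 1) * x) (stretch n) - e"
    by (metis (no_types, lifting) add_diff_cancel_left' diff_add_cancel diff_diff_eq2 dvd_add)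
  then have "\<pi> dvd \<tau> (lookup (F ^ (p - 1) * x) (stretch n) - e)" by (rule \<tau>_dvd)
  then have "\<pi> dvd \<tau> (lookup (F ^ (p - 1) * x) (stretch n)) - \<tau> e"
    using \<tau>_add[of "lookup (F ^ (p - 1) * x) (stretch n) - e" e] by simp
  moreover have "\<not> \<pi> dvd \<tau> e" using e not_dvd_one by (auto simp: \<tau>_uminus \<tau>_one)
  ultimately have "\<not> \<pi> dvd \<tau> (lookup (F ^ (p - 1) * x) (stretch n))"
    by (metis dvd_diff_left_iff dvd_diff_right_iff)
  then have "\<not> \<pi> dvd lookup (split x) n" using n by (simp add: split_def lookup_trace)
  moreover have "(n', n) \<in> ord" if n': "\<not> \<pi> dvd lookup (split x) n'" for n'
  proof -
    have "n' \<in> monomials (vars k l)" "\<not> \<pi> dvd lookup (F ^ (p - 1) * x) (stretch n')"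
      using n' by (auto simp: split_def lookup_trace split: if_splits dest: \<tau>_dvd)
    then show ?thesis using mult(1) n unfolding st lead_def by (blast intro: stretch_mono)
  qed
  ultimately show ?thesis by (simp add: lead_def)
qed

definition lead_in :: "'a mpoly set \<Rightarrow> mon \<Rightarrow> bool" where
  "lead_in I m \<longleftrightarrow> (\<exists>x\<in>I. lead \<pi> ord x m)"

lemma lead_monomials: "lead \<pi> ord x m \<Longrightarrow> m \<in> monomials (vars k l)"
  unfolding lead_def using term_order_carrier[OF T] by blast

text \<open>Multiplying by (p - 2) further copies of m turns the leading monomial m + m into p m,
  whose p-th root is extracted by \<open>split\<close>. This is the radicality of the initial
  ideal.\<close>

lemma lead_in_double:
  assumes I: "compatible I" and lead: "lead_in I (m + m)"
  shows "lead_in I m"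
proof -
  obtain x where x: "x \<in> I" "lead \<pi> ord x (m + m)" using lead by (auto simp: lead_in_def)
  have mV: "m \<in> monomials (vars k l)"
    using lead_monomials[OF x(2)] by (simp add: monomials_iff lookup_add)
  \<comment> \<open>For p = 2 this is the monomial 0 and nothing is padded.\<close>
  define u where "u = (\<Sum>i<p - 2. m)"
  have u: "u \<in> monomials (vars k l)" unfolding u_def using mV by auto
  have um: "u + (m + m) = (\<Sum>i<p. m)"
    using prime_ge_2_nat[OF p] by (intro poly_mapping_eqI)
      (simp add: u_def lookup_add lookup_const_sum algebra_simps diff_mult_distrib)
  obtain b where b: "\<pi> dvd lookup x (m + m) * b - 1" using x(2) inverse_mod by (auto simp: lead_def)
  have "\<not> \<pi> dvd b"
  proof
    assume "\<pi> dvd b"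
    then have "\<pi> dvd lookup x (m + m) * b" by simp
    then show False using b not_dvd_one by (metis dvd_diff_right_iff)
  qed
  then have "lead \<pi> ord (single u b) u"
    using u by (auto simp: lead_def lookup_single when_def intro: term_order_refl[OF T])
  from lead_mult(1)[OF prime_mod T this x(2)] have "lead \<pi> ord (single u b * x) (\<Sum>i<p. m)"
    by (simp add: um)
  moreover have "\<pi> dvd lookup (single u b * x) (\<Sum>i<p. m) - 1"
    using b by (simp add: um[symmetric] lookup_single_mult mult.commute[of b])
  ultimately have "lead \<pi> ord (split (single u b * x)) m" using mV by (rule lead_split)
  moreover have "single u b * x \<in> I"
    using I x(1) u by (auto simp: compatible_def intro: mpoly_ideal_mult)
  then have "split (single u b * x) \<in> I" using I by (simp add: compatible_def)
  ultimately show ?thesis by (auto simp: lead_in_def)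
qed

text \<open>The product of the two witnesses lies in the intersection and leads with m + m, which
  can be halved there.\<close>

lemma lead_in_Int:
  assumes I: "compatible I" and J: "compatible J" and "lead_in I m" "lead_in J m"
  shows "lead_in (I \<inter> J) m"
proof (rule lead_in_double[OF compatible_Int[OF I J]])
  obtain x y where xy: "x \<in> I" "lead \<pi> ord x m" "y \<in> J" "lead \<pi> ord y m"
    using assms by (auto simp: lead_in_def)
  have id: "ideal I (mpoly_ring (vars k l))" "ideal J (mpoly_ring (vars k l))"
    using I J by (auto simp: compatible_def)
  have V: "x \<in> mpolys (vars k l)" "y \<in> mpolys (vars k l)"
    using xy mpoly_ideal_subset[OF id(1)] mpoly_ideal_subset[OF id(2)] by auto
  have "x * y \<in> I \<inter> J"
    using mpoly_ideal_mult[OF id(1) V(2) xy(1)] mpoly_ideal_mult[OF id(2) V(1) xy(3)] by (simp add: mult.commute)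
  then show "lead_in (I \<inter> J) (m + m)"
    using lead_mult(1)[OF prime_mod T xy(2,4)] by (auto simp: lead_in_def)
qed

text \<open>
  If the leading terms of two summands cancel, subtract an element of the intersection with the
  same leading monomial from one and add it to the other; this lowers both leading monomials.
\<close>

lemma lead_in_sum:
  assumes I: "compatible I" and J: "compatible J"
    and "x \<in> I" "y \<in> J" and lead: "lead \<pi> ord (x + y) m"
  shows "lead_in I m \<or> lead_in J m"
proof -
  have id: "ideal I (mpoly_ring (vars k l))" "ideal J (mpoly_ring (vars k l))"
    using I J by (auto simp: compatible_def)
  let ?le = "\<lambda>x u. \<forall>n. \<not> \<pi> dvd lookup x n \<longrightarrow> (n, u) \<in> ord"
  have main: "\<forall>x\<in>I. \<forall>y\<in>J. ?le x u \<longrightarrow> ?le y u \<longrightarrow> lead \<pi> ord (x + y) m \<longrightarrow> lead_in I m \<or> lead_in J m" for u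
  proof (induction u rule: wf_induct_rule[OF wf_term_order[OF T]])
    case 1 then show ?case by simp
  next
    case (2 u)
    \<comment> \<open>When neither polynomial has a term at the bound u modulo \<open>\<pi>\<close>,
      the largest monomial left in either of them is a strictly smaller bound.\<close>
    have lower: "lead_in I m \<or> lead_in J m"
      if x: "x \<in> I" "?le x u" "\<pi> dvd lookup x u" and y: "y \<in> J" "?le y u" "\<pi> dvd lookup y u"
        and lead: "lead \<pi> ord (x + y) m" for x y
    proof -
      let ?S = "{n. \<not> \<pi> dvd lookup x n \<or> \<not> \<pi> dvd lookup y n}"
      have "?S \<subseteq> keys x \<union> keys y" by (auto simp: in_keys_iff)
      then have "finite ?S" by (rule finite_subset) simp
      moreover have "?S \<noteq> {}"
      proof
        assume "?S = {}"
        then have "\<pi> dvd lookup (x + y) m" by (auto simp: lookup_add)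
        then show False using lead by (simp add: lead_def)
      qed
      moreover have "?S \<subseteq> monomials (vars k l)" using x(2) y(2) term_order_carrier[OF T] by blast
      ultimately obtain w where w: "w \<in> ?S" "\<And>n. n \<in> ?S \<Longrightarrow> (n, w) \<in> ord"
        using term_order_max[OF T] by blast
      have "(w, u) \<in> strict_part ord" using w(1) x y by auto
      from 2[OF this] show ?thesis using x(1) y(1) w(2) lead by blast
    qed
    show ?case
    proof (intro ballI impI)
      fix x y assume x: "x \<in> I" "?le x u" and y: "y \<in> J" "?le y u" and lead: "lead \<pi> ord (x + y) m"
      show "lead_in I m \<or> lead_in J m"
      proof (cases "\<pi> dvd lookup (x + y) u")
        case False
        then have "(u, m) \<in> ord" using lead by (simp add: lead_def)
        moreover have "\<not> \<pi> dvd lookup x m \<or> \<not> \<pi> dvd lookup y m"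
          using lead by (auto simp: lead_def lookup_add)
        then have "(m, u) \<in> ord" using x y by blast
        ultimately have "m = u" using term_order_antisym[OF T] by blast
        moreover have "\<not> \<pi> dvd lookup x u \<or> \<not> \<pi> dvd lookup y u" using False by (auto simp: lookup_add)
        ultimately show ?thesis using x y by (auto simp: lead_in_def lead_def)
      next
        case True
        show ?thesis
        proof (cases "\<pi> dvd lookup x u")
          case dx: True
          then have "\<pi> dvd lookup y u" using True by (simp add: lookup_add dvd_add_right_iff)
          then show ?thesis using lower x y lead dx by blast
        next
          case False
          then have "\<not> \<pi> dvd lookup y u" using True by (auto simp: lookup_add dvd_add_left_iff)
          then have "lead_in I u" "lead_in J u" using False x y by (auto simp: lead_in_def lead_def)
          then have "lead_in (I \<inter> J) u" by (rule lead_in_Int[OF I J])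
          then obtain z where z: "z \<in> I" "z \<in> J" "lead \<pi> ord z u" by (auto simp: lead_in_def)
          obtain b where b: "\<pi> dvd lookup z u * b - 1" using z(3) inverse_mod by (auto simp: lead_def)
          define w where "w = single 0 (lookup x u * b) * z"
          have w: "w \<in> I" "w \<in> J" unfolding w_def
            using mpoly_ideal_mult[OF id(1) mpolys_single[OF monomials_zero] z(1)]
              mpoly_ideal_mult[OF id(2) mpolys_single[OF monomials_zero] z(2)] by auto
          have wu: "\<pi> dvd lookup w u - lookup x u"
          proof -
            have "lookup w u - lookup x u = lookup x u * (lookup z u * b - 1)"
              by (simp only: w_def lookup_const_mult) (simp add: algebra_simps)
            then show ?thesis using b by simp
          qed
          have wle: "?le w u"
          proof (intro allI impI)
            fix n assume "\<not> \<pi> dvd lookup w n"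
            then have "\<not> \<pi> dvd lookup z n" unfolding w_def lookup_const_mult by auto
            then show "(n, u) \<in> ord" using z(3) by (simp add: lead_def)
          qed
          have "?le (x - w) u" using x(2) wle by (metis dvd_diff lookup_minus)
          moreover have "?le (y + w) u" using y(2) wle by (metis dvd_add lookup_add)
          moreover have "\<pi> dvd lookup (x - w) u"
            using wu dvd_minus_iff[of \<pi> "lookup w u - lookup x u"] by (simp add: lookup_minus)
          moreover have "\<pi> dvd lookup (y + w) u"
          proof -
            have "lookup (y + w) u = lookup (x + y) u + (lookup w u - lookup x u)" by (simp add: lookup_add)
            then show ?thesis using True wu by simp
          qed
          moreover have "x - w \<in> I" "y + w \<in> J"
            using mpoly_ideal_diff[OF id(1) x(1) w(1)] mpoly_ideal_add[OF id(2) y(1) w(2)] by auto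
          moreover have "(x - w) + (y + w) = x + y" by simp
          ultimately show ?thesis using lower lead by metis
        qed
      qed
    qed
  qed
  have V: "x \<in> mpolys (vars k l)" "y \<in> mpolys (vars k l)"
    using assms(3,4) mpoly_ideal_subset[OF id(1)] mpoly_ideal_subset[OF id(2)] by auto
  \<comment> \<open>The monomial 0 keeps the set nonempty even if x and y have no keys.\<close>
  let ?S = "insert 0 (keys x \<union> keys y)"
  have "finite ?S" "?S \<noteq> {}" "?S \<subseteq> monomials (vars k l)" using V by (auto simp: mpolys_iff)
  then obtain u where u: "u \<in> ?S" "\<And>n. n \<in> ?S \<Longrightarrow> (n, u) \<in> ord"
    by (rule term_order_max[OF T]) blast
  have "?le x u" using u(2) by (metis UnI1 dvd_0_right in_keys_iff insertI2)
  moreover have "?le y u" using u(2) by (metis UnI2 dvd_0_right in_keys_iff insertI2)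
  ultimately show ?thesis using main assms by blast
qed

lemma lead_in_Union:
  assumes "finite A" "\<And>a. a \<in> A \<Longrightarrow> G a \<subseteq> mpolys (vars k l)"
    and "\<And>a. a \<in> A \<Longrightarrow> compatible (det_ideal k l (G a))"
  shows "compatible (det_ideal k l (\<Union>a\<in>A. G a)) \<and>
    (\<forall>m. lead_in (det_ideal k l (\<Union>a\<in>A. G a)) m \<longrightarrow> (\<exists>a\<in>A. lead_in (det_ideal k l (G a)) m))"
  using assms
proof (induction A rule: finite_induct)
  case empty
  \<comment> \<open>Without minors the ideal contains only multiples of \<open>\<pi>\<close>, which
    have no leading monomial modulo \<open>\<pi>\<close>.\<close>
  have "det_ideal k l {} \<subseteq> residual \<inter> mpolys (vars k l)"
  proof (rule det_ideal_minimal)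
    show "ideal (residual \<inter> mpolys (vars k l)) (mpoly_ring (vars k l))"
    proof (rule mpoly_idealI)
      fix c x :: "'a mpoly" assume "c \<in> mpolys (vars k l)" "x \<in> residual \<inter> mpolys (vars k l)"
      then show "c * x \<in> residual \<inter> mpolys (vars k l)"
        using residual_mult[of x c] by (auto simp: mult.commute)
    qed (auto simp: residual_zero intro: residual_add)
  qed (auto simp: residual_def lookup_single when_def)
  then have "\<not> lead_in (det_ideal k l {}) m" for m
    by (auto simp: lead_in_def lead_def residual_def)
  then show ?case using compatible_det_ideal_base[of "{}"] by simp
next
  case (insert a A)
  let ?H = "\<Union>a\<in>A. G a"
  have IH: "compatible (det_ideal k l ?H)" "\<And>m. lead_in (det_ideal k l ?H) m \<Longrightarrow> \<exists>a\<in>A. lead_in (det_ideal k l (G a)) m"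
    using insert by auto
  have V: "G a \<subseteq> mpolys (vars k l)" "?H \<subseteq> mpolys (vars k l)" using insert.prems by auto
  have C: "compatible (det_ideal k l (G a))" using insert.prems by auto
  have "lead_in (det_ideal k l (G a)) m \<or> lead_in (det_ideal k l ?H) m"
    if lead: "lead_in (det_ideal k l (G a \<union> ?H)) m" for m
  proof -
    from lead obtain x y where "x \<in> det_ideal k l (G a)" "y \<in> det_ideal k l ?H" "lead \<pi> ord (x + y) m"
      unfolding lead_in_def det_ideal_Un[OF V] set_add_mpoly by blast
    then show ?thesis using lead_in_sum[OF C IH(1)] by blast
  qed
  then show ?case using compatible_Un[OF V C IH(1)] IH(2) by auto
qed

end

section \<open>Split maps are pure\<close>

text \<open>A linear retraction \<open>\<psi>\<close> of \<open>\<phi>\<close> induces a retraction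
  of the tensor map. The argument stays with representatives in the free groups, where it suffices
  that \<open>e\<psi>\<close> undoes \<open>e\<phi>\<close> and maps relations to relations.\<close>

lemma tensor_map_inj:
  fixes M :: "('r, 'm, 'c) module_scheme" and N :: "('r, 'n, 'd) module_scheme"
    and N' :: "('r, 'p, 'e) module_scheme"
  assumes M: "module A M"
    and N: "\<And>y z. y \<in> carrier N \<Longrightarrow> z \<in> carrier N \<Longrightarrow> y \<oplus>\<^bsub>N\<^esub> z \<in> carrier N"
      "\<And>a y. a \<in> carrier A \<Longrightarrow> y \<in> carrier N \<Longrightarrow> a \<odot>\<^bsub>N\<^esub> y \<in> carrier N"
    and N': "\<And>y z. y \<in> carrier N' \<Longrightarrow> z \<in> carrier N' \<Longrightarrow> y \<oplus>\<^bsub>N'\<^esub> z \<in> carrier N'"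
      "\<And>a y. a \<in> carrier A \<Longrightarrow> y \<in> carrier N' \<Longrightarrow> a \<odot>\<^bsub>N'\<^esub> y \<in> carrier N'"
    and \<phi>: "\<And>y. y \<in> carrier N \<Longrightarrow> \<phi> y \<in> carrier N'"
    and \<psi>: "\<And>y. y \<in> carrier N' \<Longrightarrow> \<psi> y \<in> carrier N"
      "\<And>y z. y \<in> carrier N' \<Longrightarrow> z \<in> carrier N' \<Longrightarrow> \<psi> (y \<oplus>\<^bsub>N'\<^esub> z) = \<psi> y \<oplus>\<^bsub>N\<^esub> \<psi> z"
      "\<And>a y. a \<in> carrier A \<Longrightarrow> y \<in> carrier N' \<Longrightarrow> \<psi> (a \<odot>\<^bsub>N'\<^esub> y) = a \<odot>\<^bsub>N\<^esub> \<psi> y"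
    and \<psi>\<phi>: "\<And>y. y \<in> carrier N \<Longrightarrow> \<psi> (\<phi> y) = y"
  shows "inj_on (tensor_map A M N' \<phi>) (carrier (tensor_product A M N))"
proof -
  interpret M: module A M by fact
  define G where "G = tensor_free M N"
  define G' where "G' = tensor_free M N'"
  define H where "H = tensor_relations A M N"
  define H' where "H' = tensor_relations A M N'"
  define e\<phi> :: "('m \<times> 'n \<Rightarrow>\<^sub>0 int) \<Rightarrow> ('m \<times> 'p \<Rightarrow>\<^sub>0 int)"
    where "e\<phi> = frag_extend (\<lambda>(x, y). frag_of (x, \<phi> y))"
  define e\<psi> :: "('m \<times> 'p \<Rightarrow>\<^sub>0 int) \<Rightarrow> ('m \<times> 'n \<Rightarrow>\<^sub>0 int)"
    where "e\<psi> = frag_extend (\<lambda>(x, y). frag_of (x, \<psi> y))"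
  interpret G: group G unfolding G_def tensor_free_def by simp
  interpret G': group G' unfolding G'_def tensor_free_def by simp
  have G: "c \<in> carrier G \<longleftrightarrow> keys c \<subseteq> carrier M \<times> carrier N" "c \<otimes>\<^bsub>G\<^esub> d = c + d" "\<one>\<^bsub>G\<^esub> = 0" for c d
    by (simp_all add: G_def tensor_free_def)
  have G': "c \<in> carrier G' \<longleftrightarrow> keys c \<subseteq> carrier M \<times> carrier N'" "c \<otimes>\<^bsub>G'\<^esub> d = c + d" "\<one>\<^bsub>G'\<^esub> = 0" for c d
    by (simp_all add: G'_def tensor_free_def)
  have carr3: "frag_of a - frag_of b - frag_of c \<in> carrier G" "frag_of a - frag_of b \<in> carrier G"
    if "a \<in> carrier M \<times> carrier N" "b \<in> carrier M \<times> carrier N" "c \<in> carrier M \<times> carrier N" for a b c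
    using that keys_diff[of "frag_of a - frag_of b" "frag_of c :: _ \<Rightarrow>\<^sub>0 int"]
      keys_diff[of "frag_of a" "frag_of b :: _ \<Rightarrow>\<^sub>0 int"] unfolding G(1) by auto
  have carr3': "frag_of a - frag_of b - frag_of c \<in> carrier G'" "frag_of a - frag_of b \<in> carrier G'"
    if "a \<in> carrier M \<times> carrier N'" "b \<in> carrier M \<times> carrier N'" "c \<in> carrier M \<times> carrier N'" for a b c
    using that keys_diff[of "frag_of a - frag_of b" "frag_of c :: _ \<Rightarrow>\<^sub>0 int"]
      keys_diff[of "frag_of a" "frag_of b :: _ \<Rightarrow>\<^sub>0 int"] unfolding G'(1) by auto
  have H: "subgroup H G"
    unfolding H_def tensor_relations_def G_def[symmetric]
    by (rule G.generate_is_subgroup) (auto intro!: carr3 N)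
  \<comment> \<open>Additivity and linearity of \<open>\<psi>\<close> turn each bilinearity relation
    into one of the same kind.\<close>
  have e\<psi>_H: "e\<psi> h \<in> H" if "h \<in> H'" for h
    using that unfolding H'_def tensor_relations_def G'_def[symmetric]
  proof (induction h rule: generate.induct)
    case one
    then show ?case using subgroup.one_closed[OF H] by (simp add: G(3) G'(3) e\<psi>_def)
  next
    case (incl h)
    then show ?case
      unfolding H_def tensor_relations_def G_def[symmetric]
      by (intro generate.incl) (auto simp: e\<psi>_def frag_extend_diff \<psi> N' intro: \<psi>(1); blast intro: \<psi>(1))
  next
    case (inv h)
    then have "h \<in> carrier G'" by (auto intro!: carr3' N')
    then have "inv\<^bsub>G'\<^esub> h = - h" unfolding G'(1) by (simp add: G'_def tensor_free_def)
    moreover have "e\<psi> h \<in> H"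
      using inv unfolding H_def tensor_relations_def G_def[symmetric]
      by (intro generate.incl) (auto simp: e\<psi>_def frag_extend_diff \<psi> N' intro: \<psi>(1); blast intro: \<psi>(1))
    then have "inv\<^bsub>G\<^esub> (e\<psi> h) \<in> H" "e\<psi> h \<in> carrier G"
      using subgroup.m_inv_closed[OF H] subgroup.mem_carrier[OF H] by auto
    then have "- e\<psi> h \<in> H" unfolding G(1) by (simp add: G_def tensor_free_def)
    ultimately show ?case by (simp add: e\<psi>_def frag_extend_minus)
  next
    case (eng h1 h2)
    then show ?case using subgroup.m_closed[OF H, of "e\<psi> h1" "e\<psi> h2"]
      by (simp add: G(2) G'(2) e\<psi>_def frag_extend_add)
  qed
  have e\<psi>\<phi>: "e\<psi> (e\<phi> c) = c" if "c \<in> carrier G" for c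
  proof -
    have "e\<psi> (e\<phi> c) = frag_extend (\<lambda>(x, y). frag_of (x, \<psi> (\<phi> y))) c"
    proof -
      have "e\<phi> c = frag_extend (frag_of \<circ> (\<lambda>(x, y). (x, \<phi> y))) c"
        unfolding e\<phi>_def by (rule frag_extend_eq) auto
      then have "e\<psi> (e\<phi> c) = frag_extend ((\<lambda>(x, y). frag_of (x, \<psi> y)) \<circ> (\<lambda>(x, y). (x, \<phi> y))) c"
        unfolding e\<psi>_def by (simp only: frag_extend_compose)
      also have "\<dots> = frag_extend (\<lambda>(x, y). frag_of (x, \<psi> (\<phi> y))) c"
        by (rule frag_extend_eq) auto
      finally show ?thesis .
    qed
    also have "\<dots> = frag_extend frag_of c"
      using that unfolding G(1) by (intro frag_extend_eq) (auto simp: \<psi>\<phi>)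
    finally show ?thesis using frag_expansion[of c] by simp
  qed
  show ?thesis
  proof (rule inj_onI)
    fix C1 C2 assume C: "C1 \<in> carrier (tensor_product A M N)" "C2 \<in> carrier (tensor_product A M N)"
      and eq: "tensor_map A M N' \<phi> C1 = tensor_map A M N' \<phi> C2"
    from C obtain c1 c2 where c: "c1 \<in> carrier G" "C1 = H #>\<^bsub>G\<^esub> c1" "c2 \<in> carrier G" "C2 = H #>\<^bsub>G\<^esub> c2"
      unfolding tensor_product_def FactGroup_def G_def[symmetric] H_def[symmetric] RCOSETS_def by auto
    have tm: "tensor_map A M N' \<phi> C = {h + e\<phi> c | h c. h \<in> H' \<and> c \<in> C}" for C
      unfolding tensor_map_def set_mult_def G'_def[symmetric] H'_def[symmetric] e\<phi>_def[symmetric] G'(2) by blast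
    have "0 \<in> H'" unfolding H'_def tensor_relations_def G'_def[symmetric]
      using generate.one[of G'] by (simp add: G'(3))
    moreover have "c1 \<in> C1" unfolding c(2) using G.rcos_self[OF c(1) H] .
    ultimately have "e\<phi> c1 \<in> tensor_map A M N' \<phi> C1" unfolding tm by force
    then have "e\<phi> c1 \<in> tensor_map A M N' \<phi> C2" unfolding eq .
    then obtain h c' where h: "e\<phi> c1 = h + e\<phi> c'" "h \<in> H'" "c' \<in> C2" unfolding tm by blast
    then obtain h2 where h2: "c' = h2 + c2" "h2 \<in> H" unfolding c(4) r_coset_def G(2) by blast
    have c': "c' \<in> carrier G" using h2 c(3) subgroup.mem_carrier[OF H h2(2)] G.m_closed[of h2 c2] by (simp add: G(2))
    have "e\<psi> (e\<phi> c1) = e\<psi> h + e\<psi> (e\<phi> c')" by (simp add: h(1) e\<psi>_def frag_extend_add)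
    then have "c1 = e\<psi> h + (h2 + c2)" using e\<psi>\<phi>[OF c(1)] e\<psi>\<phi>[OF c'] h2(1) by simp
    moreover have "e\<psi> h + h2 \<in> H" using subgroup.m_closed[OF H e\<psi>_H[OF h(2)] h2(2)] by (simp add: G(2))
    ultimately have "c1 \<in> C2" unfolding c(4) r_coset_def G(2) by (auto simp: add.assoc[symmetric])
    then show "C1 = C2" using G.repr_independence[OF _ c(3) H] c(2,4) by simp
  qed
qed

section \<open>Quotients with a compatible splitting are F-pure\<close>

lemma mpoly_a_minus:
  fixes x y :: "'a::comm_ring_1 mpoly"
  assumes "x \<in> mpolys V" "y \<in> mpolys V"
  shows "x \<ominus>\<^bsub>mpoly_ring V\<^esub> y = x - y"
proof -
  have "\<ominus>\<^bsub>mpoly_ring V\<^esub> y = - y"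
    by (rule mpoly_ring.minus_equality) (use assms in auto)
  then show ?thesis by (simp add: a_minus_def)
qed

text \<open>\<open>\<sigma>\<close> preserves I and so descends to the quotient, where it is a
  linear retraction of Frobenius; \<open>tensor_map_inj\<close> makes Frobenius pure.\<close>

lemma F_pure_quotient:
  fixes I :: "'a::field mpoly set"
  assumes I: "ideal I (mpoly_ring V)" and "1 \<notin> I" and p: "CHAR('a) = p" "0 < p"
    and \<sigma>V: "\<And>x. x \<in> mpolys V \<Longrightarrow> \<sigma> x \<in> mpolys V"
    and \<sigma>_add: "\<And>x y. \<sigma> (x + y) = \<sigma> x + \<sigma> y"
    and \<sigma>_frob: "\<And>x y. x \<in> mpolys V \<Longrightarrow> \<sigma> (x ^ p * y) = x * \<sigma> y"
    and \<sigma>_one: "\<sigma> 1 = 1" and \<sigma>I: "\<And>x. x \<in> I \<Longrightarrow> \<sigma> x \<in> I"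
  shows "F_pure TYPE('m) (mpoly_ring V Quot I)"
proof -
  define Q where "Q = mpoly_ring V Quot I"
  define cs where "cs x = I +>\<^bsub>mpoly_ring V\<^esub> x" for x
  interpret I: ideal I "mpoly_ring V" by fact
  interpret Q: cring Q unfolding Q_def by (rule I.quotient_is_cring[OF mpoly_ring.cring_axioms])
  have hom: "cs \<in> Ring.ring_hom (mpoly_ring V) Q"
    unfolding Q_def cs_def[abs_def] by (rule I.rcos_ring_hom)
  have cs: "x \<in> mpolys V \<Longrightarrow> cs x \<in> carrier Q"
    "x \<in> mpolys V \<Longrightarrow> y \<in> mpolys V \<Longrightarrow> cs x \<otimes>\<^bsub>Q\<^esub> cs y = cs (x * y)"
    "x \<in> mpolys V \<Longrightarrow> y \<in> mpolys V \<Longrightarrow> cs x \<oplus>\<^bsub>Q\<^esub> cs y = cs (x + y)" "\<one>\<^bsub>Q\<^esub> = cs 1" for x y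
    using ring_hom_closed[OF hom] ring_hom_mult[OF hom] ring_hom_add[OF hom] ring_hom_one[OF hom] by simp_all
  have cs_eq: "cs x = cs y \<longleftrightarrow> x - y \<in> I" if "x \<in> mpolys V" "y \<in> mpolys V" for x y
    using mpoly_ring.quotient_eq_iff_same_a_r_cos[OF I that] mpoly_a_minus[OF that] by (simp add: cs_def)
  have cs_zero: "\<zero>\<^bsub>Q\<^esub> = cs 0"
    using cs(3)[of 0 0] cs(1)[of 0] Q.add.l_cancel_one'[of "cs 0" "cs 0"] by auto
  have repr: "\<exists>x\<in>mpolys V. C = cs x" if "C \<in> carrier Q" for C
    using that unfolding Q_def cs_def FactRing_def A_RCOSETS_def' by auto
  have cs_pow: "cs x [^]\<^bsub>Q\<^esub> n = cs (x ^ n)" if "x \<in> mpolys V" for x and n :: nat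
    by (induction n) (use that cs mpolys_power[OF that] in \<open>auto simp: mult.commute\<close>)
  have char: "ring_char Q = p"
  proof -
    have pow: "[n] \<cdot>\<^bsub>Q\<^esub> \<one>\<^bsub>Q\<^esub> = cs (of_nat n)" for n :: nat
    proof (induction n)
      case (Suc n)
      have "of_nat n \<in> mpolys V" by (metis mpolys_of_int of_int_of_nat_eq)
      then show ?case using Suc cs(3)[of "of_nat n" 1] cs(4) by (simp add: add.commute)
    qed (simp add: cs_zero)
    \<comment> \<open>A nonzero constant in I would be a unit, so the quotient has the
      characteristic of the coefficient field.\<close>
    have "cs (of_nat n) = \<zero>\<^bsub>Q\<^esub> \<longleftrightarrow> p dvd n" for n :: nat
    proof -
      have V: "of_nat n \<in> mpolys V" by (metis mpolys_of_int of_int_of_nat_eq)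
      have c: "of_nat n = (single 0 (of_nat n) :: 'a mpoly)" by simp
      have "of_nat n \<in> I \<longleftrightarrow> (of_nat n :: 'a) = 0"
      proof
        assume n: "of_nat n \<in> I"
        show "(of_nat n :: 'a) = 0"
        proof (rule ccontr)
          assume "(of_nat n :: 'a) \<noteq> 0"
          then have "single 0 (inverse (of_nat n)) * of_nat n = (1 :: 'a mpoly)"
            unfolding c mult_single by simp
          moreover have "single 0 (inverse (of_nat n)) * of_nat n \<in> I"
            by (rule mpoly_ideal_mult[OF I mpolys_single[OF monomials_zero] n])
          ultimately show False using assms(2) by simp
        qed
      next
        assume "(of_nat n :: 'a) = 0"
        then have "of_nat n = (0 :: 'a mpoly)" unfolding c by (simp only: single_zero)
        then show "of_nat n \<in> I" using mpoly_ideal_zero[OF I] by simp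
      qed
      then show ?thesis using cs_eq[OF V mpolys_zero] by (simp add: cs_zero of_nat_eq_0_iff_char_dvd p)
    qed
    then have "p = group.ord (add_monoid Q) \<one>\<^bsub>Q\<^esub>"
      using pow Q.add.ord_unique[OF Q.one_closed, of p] by simp
    then show ?thesis by (simp add: ring_char_def)
  qed
  have frob: "frobenius Q (cs x) = cs (x ^ p)" if "x \<in> mpolys V" for x
    using cs_pow[OF that] by (simp add: frobenius_def char)
  \<comment> \<open>The value does not depend on the chosen representative, because
    \<open>\<sigma>\<close> is additive and maps I into I.\<close>
  define \<psi> where "\<psi> C = cs (\<sigma> (SOME x. x \<in> mpolys V \<and> C = cs x))" for C
  have \<psi>: "\<psi> (cs x) = cs (\<sigma> x)" if "x \<in> mpolys V" for x
  proof -
    define y where "y = (SOME y. y \<in> mpolys V \<and> cs x = cs y)"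
    have y: "y \<in> mpolys V" "cs x = cs y"
      using someI[of "\<lambda>y. y \<in> mpolys V \<and> cs x = cs y" x] that by (auto simp: y_def)
    have "\<sigma> x - \<sigma> y = \<sigma> (x - y)" using \<sigma>_add[of "x - y" y] by simp
    then have "cs (\<sigma> x) = cs (\<sigma> y)"
      using y cs_eq[OF that y(1)] \<sigma>I by (subst cs_eq) (auto intro: \<sigma>V that)
    then show ?thesis by (simp add: \<psi>_def y_def)
  qed
  have "pure_map TYPE('m) Q (module_via Q id) (module_via Q (frobenius Q)) (frobenius Q)"
    unfolding pure_map_def
  proof (intro allI impI tensor_map_inj[where \<psi> = \<psi>])
    have "frobenius Q a \<in> carrier Q" if "a \<in> carrier Q" for a
      using that by (simp add: frobenius_def)
    then show "a \<odot>\<^bsub>module_via Q (frobenius Q)\<^esub> y \<in> carrier (module_via Q (frobenius Q))"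
      if "a \<in> carrier Q" "y \<in> carrier (module_via Q (frobenius Q))" for a y
      using that by (simp add: module_via_def)
    show "frobenius Q y \<in> carrier (module_via Q (frobenius Q))" if "y \<in> carrier (module_via Q id)" for y
      using that by (simp add: module_via_def frobenius_def)
    show "\<psi> y \<in> carrier (module_via Q id)" if "y \<in> carrier (module_via Q (frobenius Q))" for y
      using that repr[of y] cs(1) \<sigma>V \<psi> by (auto simp: module_via_def)
    show "\<psi> (y \<oplus>\<^bsub>module_via Q (frobenius Q)\<^esub> z) = \<psi> y \<oplus>\<^bsub>module_via Q id\<^esub> \<psi> z"
      if yz: "y \<in> carrier (module_via Q (frobenius Q))" "z \<in> carrier (module_via Q (frobenius Q))" for y z
    proof -
      obtain u v where uv: "u \<in> mpolys V" "y = cs u" "v \<in> mpolys V" "z = cs v"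
        using repr[of y] repr[of z] yz by (auto simp: module_via_def)
      show ?thesis using uv \<psi> \<sigma>V mpolys_add[OF uv(1,3)] by (simp add: module_via_def cs \<sigma>_add)
    qed
    show "\<psi> (a \<odot>\<^bsub>module_via Q (frobenius Q)\<^esub> y) = a \<odot>\<^bsub>module_via Q id\<^esub> \<psi> y"
      if ay: "a \<in> carrier Q" "y \<in> carrier (module_via Q (frobenius Q))" for a y
    proof -
      obtain u v where uv: "u \<in> mpolys V" "a = cs u" "v \<in> mpolys V" "y = cs v"
        using repr[of a] repr[of y] ay by (auto simp: module_via_def)
      show ?thesis
        using uv \<psi> \<sigma>V mpolys_mult[OF mpolys_power[OF uv(1)] uv(3), of p]
        by (simp add: module_via_def frob cs mpolys_power \<sigma>_frob)
    qed
    show "\<psi> (frobenius Q y) = y" if y: "y \<in> carrier (module_via Q id)" for y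
    proof -
      obtain u where u: "u \<in> mpolys V" "y = cs u" using repr[of y] y by (auto simp: module_via_def)
      have "\<sigma> (u ^ p) = u" using \<sigma>_frob[OF u(1), of 1] by (simp add: \<sigma>_one)
      then show ?thesis using \<psi>[OF mpolys_power[OF u(1)], of p] frob[OF u(1)] u(2) by simp
    qed
  qed (auto simp: module_via_def)
  then show ?thesis using p(2) by (simp add: F_pure_def char flip: Q_def)
qed

section \<open>The polynomial whose initial term is the product of all indeterminates\<close>

lemma pick_interval:
  assumes "x < n"
  shows "pick {lo..<lo + n} x = lo + x"
proof -
  have "{a \<in> {lo..<lo + n}. a < lo + x} = {lo..<lo + x}" using assms by auto
  then have "card {a \<in> {lo..<lo + n}. a < lo + x} = x" by simp
  then show ?thesis using pick_card_in_set[of "lo + x" "{lo..<lo + n}"] assms by simp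
qed

lemma det_submatrix_generic:
  assumes "I \<subseteq> {..<k}" "J \<subseteq> {..<l}" "card I = card J"
  shows "det (submatrix (generic_matrix k l) I J) = (minor (pick I) (pick J) (card I) :: 'a::comm_ring_1 mpoly)"
proof -
  have IJ: "{i. i < k \<and> i \<in> I} = I" "{j. j < l \<and> j \<in> J} = J" using assms by auto
  have pick: "pick I x < k" "pick J x < l" if "x < card I" for x
    using pick_in_set_le[of x I] pick_in_set_le[of x J] that assms by auto
  have "(submatrix (generic_matrix k l) I J :: 'a mpoly mat) =
      mat (card I) (card I) (\<lambda>(a, b). var (pick I a) (pick J b))"
    using pick assms(3) by (intro eq_matI) (auto simp: submatrix_def generic_matrix_def IJ var_def)
  then show ?thesis by (simp add: minor_def)
qed

lemma det_block_generic:
  assumes "lo + n \<le> k" "lo' + n \<le> l"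
  shows "det (block (generic_matrix k l) (Suc lo') (lo' + n) (Suc lo) (lo + n)) =
    (minor (\<lambda>x. lo + x) (\<lambda>x. lo' + x) n :: 'a::comm_ring_1 mpoly)"
proof -
  have "{i. Suc lo \<le> Suc i \<and> Suc i \<le> lo + n} = {lo..<lo + n}"
    "{j. Suc lo' \<le> Suc j \<and> Suc j \<le> lo' + n} = {lo'..<lo' + n}" by auto
  then have "det (block (generic_matrix k l) (Suc lo') (lo' + n) (Suc lo) (lo + n)) =
      (minor (pick {lo..<lo + n}) (pick {lo'..<lo' + n}) n :: 'a mpoly)"
    unfolding block_def using assms by (subst det_submatrix_generic) auto
  also have "\<dots> = minor (\<lambda>x. lo + x) (\<lambda>x. lo' + x) n"
    by (rule minor_cong) (simp_all add: pick_interval)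
  finally show ?thesis .
qed

text \<open>Sorted by antidiagonal: the northwest minors give d from 0 to k - 2, the maximal minors
  d from k - 1 to l - 1, and the southeast minors d from l to k + l - 2.\<close>

lemma knutson_poly_diag_minors:
  assumes "1 \<le> k" "1 \<le> l" "k \<le> l + 1"
  shows "knutson_poly k l = (\<Prod>d<k + l - 1. diag_minor k l d :: 'a::field mpoly)"
proof -
  let ?X = "generic_matrix k l :: 'a mpoly mat"
  have 1: "det (block ?X 1 (j + 1) 1 (j + 1)) = diag_minor k l j" if "j < k - 1" for j
  proof -
    have "j + 1 - l = 0" "min (k - 1) j = j" "Suc j \<le> k" "Suc j \<le> l" using that assms by auto
    then show ?thesis using det_block_generic[of 0 "Suc j" k 0 l, where 'a='a]
      by (simp add: diag_minor_def One_nat_def)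
  qed
  have 2: "det (block ?X (l - j) l (k - j) k) = diag_minor k l (k + l - 2 - j)" if "j < k - 1" for j
  proof -
    have eqs: "k + l - 2 - j + 1 - l = k - 1 - j" "min (k - 1) (k + l - 2 - j) = k - 1"
      "k + l - 2 - j - (k - 1) = l - 1 - j" "Suc (k - 1) - (k - 1 - j) = Suc j"
      "Suc (l - 1 - j) = l - j" "l - 1 - j + Suc j = l" "Suc (k - 1 - j) = k - j" "k - 1 - j + Suc j = k"
      using that assms by auto
    have "det (block ?X (l - j) l (k - j) k) = minor (\<lambda>x. k - 1 - j + x) (\<lambda>x. l - 1 - j + x) (Suc j)"
      by (rule det_block_generic[of "k - 1 - j" "Suc j" k "l - 1 - j" l, unfolded eqs]) simp_all
    then show ?thesis unfolding diag_minor_def eqs .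
  qed
  have 3: "det (block ?X j (k + j - 1) 1 k) = diag_minor k l (k + j - 2)" if "j \<in> {1..l + 1 - k}" for j
  proof -
    have eqs: "k + j - 2 + 1 - l = 0" "min (k - 1) (k + j - 2) = k - 1"
      "k + j - 2 - (k - 1) = j - 1" "Suc (k - 1) - 0 = k" "Suc (j - 1) = j" "j - 1 + k = k + j - 1"
      using that assms by auto
    have "det (block ?X j (k + j - 1) 1 k) = minor (\<lambda>x. x) (\<lambda>x. j - 1 + x) k"
      by (rule det_block_generic[of 0 k k "j - 1" l, unfolded eqs One_nat_def[symmetric] add_0])
        (use that assms in auto)
    then show ?thesis unfolding diag_minor_def eqs add_0 .
  qed
  have "(knutson_poly k l :: 'a mpoly) = (\<Prod>j<k - 1. diag_minor k l j * diag_minor k l (k + l - 2 - j)) *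
      (\<Prod>j = 1..l + 1 - k. diag_minor k l (k + j - 2))"
    unfolding knutson_poly_def Let_def
    by (intro arg_cong2[where f = "(*)"] prod.cong refl) (simp_all only: 1 2 3 lessThan_iff)
  also have "(\<Prod>j<k - 1. diag_minor k l j * diag_minor k l (k + l - 2 - j)) =
      (\<Prod>j<k - 1. diag_minor k l j) * (\<Prod>d\<in>{l..<k + l - 1}. diag_minor k l d :: 'a mpoly)"
  proof -
    have "(\<Prod>j<k - 1. diag_minor k l (k + l - 2 - j)) = (\<Prod>d\<in>{l..<k + l - 1}. diag_minor k l d :: 'a mpoly)"
      by (rule prod.reindex_bij_witness[of _ "\<lambda>d. k + l - 2 - d" "\<lambda>j. k + l - 2 - j"]) (use assms in auto)
    then show ?thesis by (simp add: prod.distrib)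
  qed
  also have "(\<Prod>j = 1..l + 1 - k. diag_minor k l (k + j - 2)) = (\<Prod>d\<in>{k - 1..<l}. diag_minor k l d :: 'a mpoly)"
    by (rule prod.reindex_bij_witness[of _ "\<lambda>d. d + 2 - k" "\<lambda>j. k + j - 2"]) (use assms in auto)
  also have "(\<Prod>j<k - 1. diag_minor k l j) * (\<Prod>d\<in>{l..<k + l - 1}. diag_minor k l d :: 'a mpoly) *
      (\<Prod>d\<in>{k - 1..<l}. diag_minor k l d) = (\<Prod>d<k + l - 1. diag_minor k l d :: 'a mpoly)"
  proof -
    \<comment> \<open>For k = l + 1 the middle range is empty and the other two are
      adjacent.\<close>
    have "{..<k + l - 1} = {..<k - 1} \<union> ({k - 1..<l} \<union> {l..<k + l - 1})" using assms by auto
    moreover have "prod (diag_minor k l) ({..<k - 1} \<union> ({k - 1..<l} \<union> {l..<k + l - 1})) =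
        (prod (diag_minor k l) {..<k - 1} * prod (diag_minor k l) ({k - 1..<l} \<union> {l..<k + l - 1}) :: 'a mpoly)"
      using assms by (intro prod.union_disjoint) auto
    moreover have "prod (diag_minor k l) ({k - 1..<l} \<union> {l..<k + l - 1}) =
        (prod (diag_minor k l) {k - 1..<l} * prod (diag_minor k l) {l..<k + l - 1} :: 'a mpoly)"
      by (rule prod.union_disjoint) auto
    ultimately show ?thesis by (simp add: mult_ac)
  qed
  finally show ?thesis .
qed

lemma unit_lead_diag_minor:
  assumes "antidiagonal_exchange (vars k l) ord" "d < k + l - 1" "1 \<le> k" "1 \<le> l"
  shows "unit_lead ord (diag_minor k l d :: 'a::comm_ring_1 mpoly)
    (\<Sum>v\<in>{v \<in> vars k l. fst v + snd v = d}. single v 1)"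
proof -
  let ?r = "d + 1 - l" and ?c = "d - min (k - 1) d" and ?n = "Suc (min (k - 1) d) - (d + 1 - l)"
  have "antidiag (\<lambda>a. ?r + a) (\<lambda>b. ?c + b) ?n = (\<Sum>v\<in>{v \<in> vars k l. fst v + snd v = d}. single v 1)"
    unfolding antidiag_def
    by (rule sum.reindex_bij_witness[of _ "\<lambda>v. fst v - ?r" "\<lambda>a. (?r + a, ?c + (?n - 1 - a))"])
      (use assms in \<open>auto simp: min_def split: if_splits\<close>)
  moreover have "unit_lead ord (diag_minor k l d :: 'a mpoly) (antidiag (\<lambda>a. ?r + a) (\<lambda>b. ?c + b) ?n)"
    unfolding diag_minor_def
    by (rule unit_lead_minor[OF assms(1)]) (use assms in \<open>auto simp: strict_mono_on_def min_def split: if_splits\<close>)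
  ultimately show ?thesis by simp
qed

text \<open>Every cell lies on exactly one antidiagonal i + j = d, so each variable occurs exactly
  once in the product of the leading terms.\<close>

lemma unit_lead_diag_minors:
  assumes "antidiagonal_exchange (vars k l) ord" "1 \<le> k" "1 \<le> l"
  shows "unit_lead ord (\<Prod>d<k + l - 1. diag_minor k l d :: 'a::idom mpoly) (\<Sum>v\<in>vars k l. single v 1)"
proof -
  have T: "term_order (vars k l) ord" using assms(1) by (simp add: antidiagonal_exchange_def)
  have "(\<Sum>v\<in>vars k l. single v (1::nat)) =
      (\<Sum>d<k + l - 1. \<Sum>v\<in>{v \<in> vars k l. fst v + snd v = d}. single v 1)"
    by (rule sum.group[symmetric]) auto
  then show ?thesis
    using unit_lead_prod[OF T unit_lead_diag_minor[OF assms(1) _ assms(2,3)], of "{..<k + l - 1}"] by simp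
qed

lemma diag_minor_dvd:
  assumes "1 \<le> k" "1 \<le> l" "d < k + l - 1"
  shows "\<exists>g\<in>mpolys (vars k l). (\<Prod>d<k + l - 1. diag_minor k l d :: 'a::comm_ring_1 mpoly) = diag_minor k l d * g"
proof (intro bexI)
  show "(\<Prod>d<k + l - 1. diag_minor k l d :: 'a mpoly) =
      diag_minor k l d * (\<Prod>d\<in>{..<k + l - 1} - {d}. diag_minor k l d)"
    using assms(3) by (simp add: prod.remove[of "{..<k + l - 1}" d])
  show "(\<Prod>d\<in>{..<k + l - 1} - {d}. diag_minor k l d :: 'a mpoly) \<in> mpolys (vars k l)"
    using assms by (intro mpolys_prod mpolys_diag_minor) auto
qed

context frobenius_residue
begin

lemma frobenius_splitting_diag_minors:
  assumes "1 \<le> k" "1 \<le> l" "antidiagonal_exchange (vars k l) ord"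
  shows "frobenius_splitting \<pi> p \<tau> k l ord (\<Prod>d<k + l - 1. diag_minor k l d)"
  by unfold_locales
    (use assms unit_lead_diag_minors in \<open>auto intro!: mpolys_prod mpolys_diag_minor\<close>)

text \<open>By compatibility a leading monomial of the sum already leads in one summand, where the
  rank parametrisation produces the antidiagonal.\<close>

lemma lead_det_ideal_Union:
  assumes kl: "1 \<le> k" "1 \<le> l" and E: "antidiagonal_exchange (vars k l) ord"
    and A: "A \<subseteq> {1..k} \<times> {1..l}"
    and g: "g \<in> det_ideal k l (\<Union>(r, s)\<in>A. box_minors r s (Suc (t r s)))" and lead: "lead \<pi> ord g m"
  shows "\<exists>(r, s)\<in>A. has_antidiag r s (Suc (t r s)) m"
proof -
  interpret frobenius_splitting \<pi> p \<tau> k l ord "\<Prod>d<k + l - 1. diag_minor k l d"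
    by (rule frobenius_splitting_diag_minors[OF kl E])
  have "finite A" using A by (rule finite_subset) simp
  moreover have "(case a of (r, s) \<Rightarrow> box_minors r s (Suc (t r s))) \<subseteq> (mpolys (vars k l) :: 'a mpoly set)"
    if "a \<in> A" for a
  proof -
    obtain r s where a: "a = (r, s)" by (cases a)
    then have "r \<le> k" "s \<le> l" using A that by auto
    then show ?thesis unfolding a prod.case by (rule box_minors_mpolys)
  qed
  moreover have "compatible (det_ideal k l (case a of (r, s) \<Rightarrow> box_minors r s (Suc (t r s))))" if "a \<in> A" for a
    using A that diag_minor_dvd[OF kl] by (cases a) (auto intro!: compatible_box)
  ultimately obtain a where "a \<in> A" "lead_in (det_ideal k l (case a of (r, s) \<Rightarrow> box_minors r s (Suc (t r s)))) m"
    using lead_in_Union[of A "\<lambda>(r, s). box_minors r s (Suc (t r s))"] g lead unfolding lead_in_def by blast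
  then show ?thesis
    using A lead_det_ideal[OF E] by (cases a) (force simp: lead_in_def)
qed

end

section \<open>Schubert determinantal ideals\<close>

lemma sorted_in_pick:
  assumes "I \<subseteq> {..<r}"
  shows "sorted_in r (card I) (pick I)"
  using pick_mono_le[of _ I] pick_in_set_le[of _ I] assms
  by (auto simp: sorted_in_def strict_mono_on_def)

lemma pick_image:
  assumes "strict_mono_on {..<n} \<rho>" "a < n"
  shows "pick (\<rho> ` {..<n}) a = \<rho> a"
proof -
  have inj: "inj_on \<rho> {..<n}" using assms(1) by (rule strict_mono_on_imp_inj_on)
  have "{x \<in> \<rho> ` {..<n}. x < \<rho> a} = \<rho> ` {..<a}"
    using assms strict_mono_on_less[OF assms(1)] by (auto simp: image_iff)
  then have "card {x \<in> \<rho> ` {..<n}. x < \<rho> a} = a"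
    using inj assms(2) by (simp add: card_image inj_on_subset)
  then show ?thesis using pick_card_in_set[of "\<rho> a" "\<rho> ` {..<n}"] assms(2) by simp
qed

lemma minors_northwest:
  assumes "r \<le> k" "s \<le> l"
  shows "minors n (northwest (generic_matrix k l) r s) = (box_minors r s n :: 'a::comm_ring_1 mpoly set)"
proof -
  let ?A = "northwest (generic_matrix k l) r s :: 'a mpoly mat"
  have A: "?A = generic_matrix r s"
  proof -
    have sets: "{i. 1 \<le> Suc i \<and> Suc i \<le> r} = {..<r}" "{j. 1 \<le> Suc j \<and> Suc j \<le> s} = {..<s}"
      "{i. i < k \<and> i \<in> {..<r}} = {..<r}" "{j. j < l \<and> j \<in> {..<s}} = {..<s}"
      using assms by (auto simp: One_nat_def)
    have "pick {..<n} x = x" if "x < n" for n x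
      using pick_interval[OF that, of 0] by (simp add: lessThan_atLeast0)
    then show ?thesis using assms
      unfolding northwest_def block_def submatrix_def sets
      by (intro eq_matI) (auto simp: generic_matrix_def sets[simplified])
  qed
  have "minors n ?A = {det (submatrix (generic_matrix r s) I J) | I J.
      I \<subseteq> {..<r} \<and> J \<subseteq> {..<s} \<and> card I = n \<and> card J = n}"
    unfolding minors_def A by (simp add: generic_matrix_def)
  also have "\<dots> = box_minors r s n"
  proof safe
    fix I J assume "I \<subseteq> {..<r}" "J \<subseteq> {..<s}" "n = card I" "card J = card I"
    then show "det (submatrix (generic_matrix r s) I J) \<in> (box_minors r s (card I) :: 'a mpoly set)"
      using sorted_in_pick[of I r] sorted_in_pick[of J s] unfolding box_minors_def
      by (auto simp: det_submatrix_generic intro!: exI)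
  next
    fix x :: "'a mpoly" assume "x \<in> box_minors r s n"
    then obtain \<rho> \<sigma> where x: "x = minor \<rho> \<sigma> n" and so: "sorted_in r n \<rho>" "sorted_in s n \<sigma>"
      unfolding box_minors_def by blast
    let ?I = "\<rho> ` {..<n}" and ?J = "\<sigma> ` {..<n}"
    have card: "card ?I = n" "card ?J = n"
      using so by (auto simp: sorted_in_def card_image strict_mono_on_imp_inj_on)
    have "det (submatrix (generic_matrix r s) ?I ?J) = (minor (pick ?I) (pick ?J) n :: 'a mpoly)"
      using so card by (subst det_submatrix_generic) (auto simp: sorted_in_def)
    also have "\<dots> = x" unfolding x
      using so by (intro minor_cong pick_image) (auto simp: sorted_in_def)
    finally show "\<exists>I J. x = det (submatrix (generic_matrix r s) I J) \<and>
        I \<subseteq> {..<r} \<and> J \<subseteq> {..<s} \<and> card I = n \<and> card J = n"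
      using so card by (intro exI[of _ ?I] exI[of _ ?J]) (auto simp: sorted_in_def)
  qed
  finally show ?thesis .
qed

lemma schubert_ideal_box_minors:
  "schubert_ideal k l w =
    gen (vars k l) (\<Union>(r, s)\<in>{1..k} \<times> {1..l}. box_minors r s (Suc (mat_rank (northwest w r s))))"
  unfolding schubert_ideal_def
  by (intro arg_cong[where f = "genideal _"]) (auto simp: minors_northwest Suc_eq_plus1)

section \<open>Semilinear functionals\<close>

lemma residue_field_zero: "residue_field (0 :: 'a::field)"
proof
  show "\<exists>b. 0 dvd c * b - 1" if "\<not> 0 dvd c" for c :: 'a
    using that by (intro exI[of _ "inverse c"]) simp
qed simp

lemma linear_functional_exists:
  fixes scale :: "'k::field \<Rightarrow> 'b::ab_group_add \<Rightarrow> 'b"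
  assumes "vector_space scale" "e \<noteq> 0"
  shows "\<exists>f :: 'b \<Rightarrow> 'k. (\<forall>x y. f (x + y) = f x + f y) \<and> (\<forall>c x. f (scale c x) = c * f x) \<and> f e = 1"
proof -
  interpret vs: vector_space "(*) :: 'k \<Rightarrow> 'k \<Rightarrow> 'k"
    by unfold_locales (simp_all add: algebra_simps)
  interpret vector_space_pair scale "(*) :: 'k \<Rightarrow> 'k \<Rightarrow> 'k"
    by (intro vector_space_pair.intro assms(1) vs.vector_space_axioms)
  have "vs1.independent {e}" using assms(2) by (simp add: vs1.dependent_single)
  then obtain f where f: "Vector_Spaces.linear scale (*) f" "\<forall>x\<in>{e}. f x = (\<lambda>_. 1) x"
    using linear_independent_extend[of "{e}" "\<lambda>_. 1"] by auto
  interpret f: Vector_Spaces.linear scale "(*)" f by (rule f(1))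
  show ?thesis using f(2) f.add f.scale by (intro exI[of _ f]) auto
qed

text \<open>The field is a vector space over itself with scalars acting through their p-th powers; a
  linear functional on it with value 1 at 1 is the required \<open>\<tau>\<close>. Perfectness of
  the field is not assumed.\<close>

lemma frobenius_residue_field:
  assumes "0 < CHAR('a::field)"
  shows "\<exists>\<tau> :: 'a \<Rightarrow> 'a. frobenius_residue 0 CHAR('a) \<tau>"
proof -
  let ?p = "CHAR('a)"
  have p: "prime ?p" using assms by (rule prime_CHAR_semidom)
  have add: "(a + b) ^ ?p = a ^ ?p + b ^ ?p" for a b :: 'a
    using freshman[OF p, of a b] by auto
  have "vector_space (\<lambda>a x. a ^ ?p * x :: 'a)"
    by unfold_locales (simp_all add: algebra_simps power_mult_distrib add)
  from linear_functional_exists[OF this, of 1] obtain \<tau> :: "'a \<Rightarrow> 'a" where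
    "\<forall>x y. \<tau> (x + y) = \<tau> x + \<tau> y" "\<forall>c x. \<tau> (c ^ ?p * x) = c * \<tau> x" "\<tau> 1 = 1" by auto
  moreover from this(1) have "\<tau> 0 = 0" by (metis add.right_neutral add_left_cancel)
  ultimately have "frobenius_residue 0 ?p \<tau>"
    using p by (intro frobenius_residue.intro residue_field_zero frobenius_residue_axioms.intro) auto
  then show ?thesis by blast
qed

text \<open>By Fermat's little theorem the p-th power map is the identity modulo p, so the identity
  serves as \<open>\<tau>\<close>.\<close>

lemma frobenius_residue_int:
  assumes p: "prime p"
  shows "frobenius_residue (int p) p id"
proof (intro frobenius_residue.intro residue_field.intro frobenius_residue_axioms.intro)
  show "\<not> int p dvd 1" using p by (auto simp: prime_nat_iff)
  show "\<exists>b. int p dvd c * b - 1" if "\<not> int p dvd c" for c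
  proof -
    have "coprime (int p) c" using p that by (simp add: prime_imp_coprime)
    then obtain u v where "u * int p + v * c = 1" using bezout_int[of "int p" c] by auto
    then have "c * v - 1 = int p * - u" by (simp add: algebra_simps)
    then show ?thesis by (metis dvd_triv_left)
  qed
  have dvd: "int p dvd a ^ p - a" for a :: int
  proof (induction a rule: int_induct[where k = 0])
    case base
    then show ?case using prime_gt_0_nat[OF p] by (simp add: zero_power)
  next
    case (step1 i)
    obtain z :: int where "(i + 1) ^ p = i ^ p + 1 ^ p + of_nat p * z" using freshman[OF p] by blast
    then have "(i + 1) ^ p - (i + 1) = (i ^ p - i) + int p * z" by simp
    then show ?case using step1(2) by (simp only: dvd_add dvd_triv_left)
  next
    case (step2 i)
    obtain z :: int where "(i - 1 + 1) ^ p = (i - 1) ^ p + 1 ^ p + of_nat p * z" using freshman[OF p] by blast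
    then have "(i - 1) ^ p - (i - 1) = (i ^ p - i) - int p * z" by simp
    then show ?case using step2(2) by (simp only: dvd_diff dvd_triv_left)
  qed
  show "int p dvd id (a ^ p * b) - a * id b" for a b
    using dvd[of a] by (simp flip: left_diff_distrib)
qed (use p in auto)

section \<open>Leading monomials in characteristic zero\<close>

text \<open>A field of characteristic 0 is a rational vector space, and the functional that is 1 at
  1 extends to it.\<close>

lemma rational_functional_exists:
  assumes "CHAR('a::field) = 0"
  shows "\<exists>f :: 'a \<Rightarrow> rat. (\<forall>x y. f (x + y) = f x + f y) \<and> f 1 = 1"
proof -
  have nz: "(of_int n :: 'a) = 0 \<longleftrightarrow> n = 0" for n
    using of_int_eq_0_iff_char_dvd[of n, where 'a='a] assms by simp
  \<comment> \<open>The embedding of the rationals into the field; denominators stay nonzero because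
    the characteristic is 0.\<close>
  define h :: "rat \<Rightarrow> 'a" where "h q = of_int (fst (quotient_of q)) / of_int (snd (quotient_of q))" for q
  have h: "h (Rat.Fract a b) = of_int a / of_int b" if "b \<noteq> 0" for a b
  proof -
    obtain c d where cd: "quotient_of (Rat.Fract a b) = (c, d)" by fastforce
    then have d: "d > 0" "Rat.Fract a b = Rat.Fract c d"
      using quotient_of_denom_pos[OF cd] quotient_of_div[OF cd] by (simp_all add: Fract_of_int_quotient)
    then have "a * d = c * b" using that by (simp add: eq_rat)
    then have "of_int a * of_int d = (of_int c * of_int b :: 'a)" by (metis of_int_mult)
    then show ?thesis using that d(1) by (simp add: h_def cd nz frac_eq_eq)
  qed
  have "vector_space (\<lambda>q x. h q * x :: 'a)"
  proof
    fix p q :: rat and x y :: 'a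
    obtain a b c d where pq: "p = Rat.Fract a b" "b \<noteq> 0" "q = Rat.Fract c d" "d \<noteq> 0"
      by (metis Rat_cases less_irrefl)
    show "h (p + q) * x = h p * x + h q * x"
      using pq(2,4) unfolding pq(1,3) by (simp add: h nz field_simps)
    show "h p * (h q * x) = h (p * q) * x"
      using pq(2,4) unfolding pq(1,3) by (simp add: h nz field_simps)
    show "h 1 * x = x" unfolding One_rat_def by (simp add: h)
  qed (simp add: distrib_left)
  from linear_functional_exists[OF this, of 1] show ?thesis by auto
qed

lemma lookup_minor_of_int:
  "lookup (minor \<rho> \<sigma> n :: 'a::comm_ring_1 mpoly) w = of_int (lookup (minor \<rho> \<sigma> n :: int mpoly) w)"
  unfolding minor_expand lookup_sum of_int_sum
  by (intro sum.cong) (auto simp: lookup_single when_def)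

text \<open>
  A rational functional maps an element of the ideal to an integral one with the same leading
  monomial, up to a common denominator; its leading coefficient is a unit modulo large primes.
\<close>

lemma lead_box_minors_char_0:
  fixes g :: "'a::field mpoly"
  assumes char: "CHAR('a) = 0" and kl: "1 \<le> k" "1 \<le> l" and E: "antidiagonal_exchange (vars k l) ord"
    and A: "A \<subseteq> {1..k} \<times> {1..l}"
    and g: "g \<in> gen (vars k l) (\<Union>(r, s)\<in>A. box_minors r s (Suc (t r s)))" and lead: "lead 0 ord g m"
  shows "\<exists>(r, s)\<in>A. has_antidiag r s (Suc (t r s)) m"
proof -
  define Ga where "Ga = (\<Union>(r, s)\<in>A. box_minors r s (Suc (t r s)) :: 'a mpoly set)"
  define Gi where "Gi = (\<Union>(r, s)\<in>A. box_minors r s (Suc (t r s)) :: int mpoly set)"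
  have GaV: "Ga \<subseteq> mpolys (vars k l)" and GiV: "Gi \<subseteq> mpolys (vars k l)"
    unfolding Ga_def Gi_def by (rule box_minors_Union_mpolys[OF A])+
  note Ia = ideal_gen[OF GaV] and Ii = ideal_gen[OF GiV]
  obtain f :: "'a \<Rightarrow> rat" where f: "\<And>x y. f (x + y) = f x + f y" "f 1 = 1"
    using rational_functional_exists[OF char] by blast
  have f0: "f 0 = 0" using f(1)[of 0 0] by simp
  have f_int: "f (c * of_int z) = of_int z * f c" for c z
  proof (induction z rule: int_induct[where k = 0])
    case (step1 i)
    then show ?case using f(1)[of "c * of_int i" c] by (simp add: algebra_simps)
  next
    case (step2 i)
    then show ?case using f(1)[of "c * of_int (i - 1)" c] by (simp add: algebra_simps)
  qed (simp add: f0)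
  \<comment> \<open>The minors have integer coefficients, so applying \<open>f\<close>
    coefficientwise to a combination of minors only changes the multipliers, to rational ones; N
    clears their denominators.\<close>
  have lift: "\<exists>N>0. \<exists>h\<in>gen (vars k l) Gi. \<forall>w. of_int N * f (lookup x w) = of_int (lookup h w)"
    if "x \<in> gen (vars k l) Ga" for x
    using that GaV
  proof (induction x rule: gen_induct)
    case zero
    show ?case using mpoly_ideal_zero[OF Ii] f0 by (intro exI[of _ 1] conjI bexI[of _ 0]) auto
  next
    case (add x y)
    then obtain M N h h' where h: "0 < M" "h \<in> gen (vars k l) Gi" "\<And>w. of_int M * f (lookup x w) = of_int (lookup h w)"
      and h': "0 < N" "h' \<in> gen (vars k l) Gi" "\<And>w. of_int N * f (lookup y w) = of_int (lookup h' w)" by blast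
    let ?h = "single 0 N * h + single 0 M * h'"
    have "?h \<in> gen (vars k l) Gi"
      by (intro mpoly_ideal_add[OF Ii] mpoly_ideal_mult[OF Ii] mpolys_single monomials_zero h(2) h'(2))
    moreover have "of_int (M * N) * f (lookup (x + y) w) = of_int (lookup ?h w)" for w
      by (simp add: lookup_add lookup_const_mult f(1) flip: h(3) h'(3)) (simp add: algebra_simps)
    ultimately show ?case using h(1) h'(1) by (intro exI[of _ "M * N"] conjI bexI[of _ ?h]) auto
  next
    case (single u c x)
    then obtain \<rho> \<sigma> n where x: "x = minor \<rho> \<sigma> n" "minor \<rho> \<sigma> n \<in> Gi"
      by (auto simp: Ga_def Gi_def box_minors_def) blast
    obtain a b where ab: "f c = of_int a / of_int b" "0 < b"
      using quotient_of_denom_pos' quotient_of_div by (metis surj_pair snd_conv)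
    let ?h = "Poly_Mapping.single u a * minor \<rho> \<sigma> n"
    have "of_int b * f (lookup (Poly_Mapping.single u c * x) w) = of_int (lookup ?h w)" for w
    proof (cases "\<exists>v. w = u + v")
      case True
      then show ?thesis using ab
        by (auto simp: x(1) lookup_single_mult lookup_minor_of_int[where 'a='a] f_int)
    next
      case False
      then show ?thesis by (simp add: lookup_single_mult_eq_0 f0)
    qed
    moreover have "?h \<in> gen (vars k l) Gi"
      by (intro mpoly_ideal_mult[OF Ii] mpolys_single single(1) gen_self[OF GiV] x(2))
    ultimately show ?case using ab(2) by blast
  qed
  have gm: "lookup g m \<noteq> 0" using lead by (simp add: lead_def)
  \<comment> \<open>\<open>f\<close> might kill the leading coefficient; scaled to 1 it is mapped to
    1, and becomes N in \<open>h\<close>.\<close>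
  let ?g = "single 0 (inverse (lookup g m)) * g"
  have "?g \<in> gen (vars k l) Ga"
    using g unfolding Ga_def[symmetric] by (intro mpoly_ideal_mult[OF Ia] mpolys_single monomials_zero)
  then obtain N h where h: "0 < N" "h \<in> gen (vars k l) Gi" "\<And>w. of_int N * f (lookup ?g w) = of_int (lookup h w)"
    using lift by blast
  have hm: "lookup h m = N"
    using h(3)[of m] gm by (simp add: lookup_const_mult f(2))
  \<comment> \<open>A prime larger than N does not divide the leading coefficient N of
    \<open>h\<close>.\<close>
  obtain q where q: "prime q" "nat N < q" using bigger_prime by blast
  interpret frobenius_residue "int q" q id by (rule frobenius_residue_int[OF q(1)])
  have "\<not> int q dvd N" using h(1) q(2) zdvd_not_zless[of N "int q"] by linarith
  moreover have "(w, m) \<in> ord" if "\<not> int q dvd lookup h w" for w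
  proof -
    have "lookup g w \<noteq> 0"
    proof
      assume "lookup g w = 0"
      then have "lookup h w = 0" using h(3)[of w] by (simp add: lookup_const_mult f0)
      then show False using that by simp
    qed
    then show ?thesis using lead by (simp add: lead_def)
  qed
  ultimately have "lead (int q) ord h m" by (simp add: lead_def hm)
  moreover have "h \<in> det_ideal k l Gi"
    unfolding det_ideal_def using h(2) gen_mono[OF det_ideal_gens[OF GiV]] by blast
  ultimately show ?thesis using lead_det_ideal_Union[OF kl E A] unfolding Gi_def by blast
qed

lemma lead_box_minors:
  fixes g :: "'a::field mpoly"
  assumes kl: "1 \<le> k" "1 \<le> l" and E: "antidiagonal_exchange (vars k l) ord"
    and A: "A \<subseteq> {1..k} \<times> {1..l}"
    and g: "g \<in> gen (vars k l) (\<Union>(r, s)\<in>A. box_minors r s (Suc (t r s)))" and lead: "lead 0 ord g m"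
  shows "\<exists>(r, s)\<in>A. has_antidiag r s (Suc (t r s)) m"
proof (cases "CHAR('a) = 0")
  case True
  then show ?thesis using lead_box_minors_char_0[OF True kl E A g lead] by blast
next
  case False
  then obtain \<tau> :: "'a \<Rightarrow> 'a" where "frobenius_residue 0 CHAR('a) \<tau>"
    using frobenius_residue_field by auto
  then interpret frobenius_residue 0 "CHAR('a)" \<tau> .
  note V = box_minors_Union_mpolys[OF A, of t, where 'a='a]
  have "g \<in> det_ideal k l (\<Union>(r, s)\<in>A. box_minors r s (Suc (t r s)))"
    unfolding det_ideal_def using g gen_mono[OF det_ideal_gens[OF V]] by blast
  then show ?thesis by (rule lead_det_ideal_Union[OF kl E A _ lead])
qed

section \<open>Antidiagonal term orders\<close>

lemma lead_mon_lead:
  fixes p :: "'a::field mpoly"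
  assumes T: "term_order V ord" and p: "p \<in> mpolys V" "p \<noteq> 0"
  shows "lead 0 ord p (lead_mon ord p)"
proof -
  obtain m where m: "m \<in> keys p" "\<And>n. n \<in> keys p \<Longrightarrow> (n, m) \<in> ord"
    using term_order_max[OF T, of "keys p"] p by (auto simp: mpolys_iff)
  have "lead_mon ord p = m"
    unfolding lead_mon_def using m term_order_antisym[OF T] by (intro the_equality) blast+
  then show ?thesis using m by (simp add: lead_def in_keys_iff)
qed

lemma lead_unique: "term_order V ord \<Longrightarrow> lead c ord p m \<Longrightarrow> lead c ord p n \<Longrightarrow> m = n"
  unfolding lead_def using term_order_antisym by blast

text \<open>The leading monomial of a two-by-two minor is its antidiagonal by hypothesis, and the
  diagonal monomial occurs in that minor, hence is below it.\<close>

lemma antidiagonal_exchange_of_term_order: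
  assumes "antidiagonal_term_order TYPE('a::field) k l ord"
  shows "antidiagonal_exchange (vars k l) ord"
proof -
  have T: "term_order (vars k l) ord" using assms by (simp add: antidiagonal_term_order_def)
  have "(single (i, j) 1 + single (i', j') 1, single (i, j') 1 + single (i', j) 1) \<in> ord"
    if ij: "i < i'" "j < j'" "{(i, j), (i', j'), (i, j'), (i', j)} \<subseteq> vars k l" for i i' j j'
  proof -
    define \<rho> where "\<rho> a = (if a = 0 then i else i')" for a :: nat
    define \<sigma> where "\<sigma> a = (if a = 0 then j else j')" for a :: nat
    have two: "{..<2::nat} = {0, 1}" by auto
    have mono: "strict_mono_on {..<2} \<rho>" "strict_mono_on {..<2} \<sigma>"
      using ij by (auto simp: strict_mono_on_def \<rho>_def \<sigma>_def)
    then have inj: "inj_on \<rho> {..<2}" "inj_on \<sigma> {..<2}" by (auto intro: strict_mono_on_imp_inj_on)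
    let ?I = "\<rho> ` {..<2}" and ?J = "\<sigma> ` {..<2}"
    have card: "card ?I = 2" "card ?J = 2" using inj by (simp_all add: card_image)
    have sub: "?I \<subseteq> {..<k}" "?J \<subseteq> {..<l}" using ij by (auto simp: \<rho>_def \<sigma>_def)
    have det: "det (submatrix (generic_matrix k l) ?I ?J) = (minor \<rho> \<sigma> 2 :: 'a mpoly)"
    proof -
      have "det (submatrix (generic_matrix k l) ?I ?J) = (minor (pick ?I) (pick ?J) 2 :: 'a mpoly)"
        using det_submatrix_generic[OF sub, where 'a='a] card by simp
      then show ?thesis using minor_cong[of 2 "pick ?I" \<rho> "pick ?J" \<sigma>] pick_image[OF mono(1)] pick_image[OF mono(2)]
        by metis
    qed
    have "lead_mon ord (det (submatrix (generic_matrix k l :: 'a mpoly mat) ?I ?J)) =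
        (\<Sum>a<card ?I. single (pick ?I a, pick ?J (card ?I - 1 - a)) 1)"
      using assms sub card unfolding antidiagonal_term_order_def by simp
    then have lm: "lead_mon ord (minor \<rho> \<sigma> 2 :: 'a mpoly) = single (i, j') 1 + single (i', j) 1"
    proof -
      have "(\<Sum>a<2. single (pick ?I a, pick ?J (2 - 1 - a)) 1) = (\<Sum>a<2. single (\<rho> a, \<sigma> (2 - 1 - a)) (1::nat))"
        by (intro sum.cong refl) (simp add: pick_image[OF mono(1)] pick_image[OF mono(2)])
      also have "\<dots> = single (i, j') 1 + single (i', j) 1"
        unfolding two by (simp add: \<rho>_def \<sigma>_def)
      finally show ?thesis
        using \<open>lead_mon ord _ = _\<close> unfolding det card by simp
    qed
    have key: "lookup (minor \<rho> \<sigma> 2 :: 'a mpoly) (single (i, j) 1 + single (i', j') 1) = 1"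
      using lookup_minor_id[OF inj, where 'a='a] by (simp add: two \<rho>_def \<sigma>_def)
    have V: "(minor \<rho> \<sigma> 2 :: 'a mpoly) \<in> mpolys (vars k l)"
      using ij by (intro mpolys_minor) (auto simp: \<rho>_def \<sigma>_def)
    have "minor \<rho> \<sigma> 2 \<noteq> (0 :: 'a mpoly)" using key by auto
    from lead_mon_lead[OF T V this] show ?thesis
      unfolding lm lead_def using key by simp
  qed
  then show ?thesis using T by (simp add: antidiagonal_exchange_def)
qed

section \<open>Schubert determinantal ideals are Knutson ideals\<close>

lemma colon_PIdl:
  fixes I :: "'a::comm_ring_1 mpoly set"
  assumes I: "ideal I (mpoly_ring V)" and h: "h \<in> mpolys V"
  shows "ideal_colon (mpoly_ring V) I (PIdl\<^bsub>mpoly_ring V\<^esub> h) = {x \<in> mpolys V. x * h \<in> I}"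
proof -
  have "x * (c * h) \<in> I" if "x * h \<in> I" "c \<in> mpolys V" for x c
    using mpoly_ideal_mult[OF I that(2,1)] by (simp add: mult_ac)
  moreover have "h \<in> PIdl\<^bsub>mpoly_ring V\<^esub> h" using mpoly_ring.cgenideal_self[OF h] .
  ultimately show ?thesis by (auto simp: ideal_colon_def cgenideal_def)
qed

lemma PIdl_mpoly: "PIdl\<^bsub>mpoly_ring V\<^esub> f = {c * f | c. c \<in> mpolys V}"
  by (simp add: cgenideal_def)

text \<open>The base of the induction is the identity (F) : (F / g) = (g) for each factor g of F.
  With \<open>\<pi>\<close> = 0 the extra generator of \<open>det_ideal\<close> is 0.\<close>

lemma (in residue_field) knutson_ideals_box_minors:
  fixes F :: "'a mpoly"
  assumes \<pi>: "\<pi> = 0" and kl: "1 \<le> k" "1 \<le> l"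
    and F: "F = (\<Prod>d<k + l - 1. diag_minor k l d)" "F \<noteq> 0"
    and rs: "t < r" "r \<le> k" "t < s" "s \<le> l"
  shows "det_ideal k l (box_minors r s (Suc t)) \<in> knutson_ideals (mpoly_ring (vars k l)) F"
proof (rule det_ideal_closure[OF kl _ _ _ rs])
  let ?V = "vars k l"
  have FV: "F \<in> mpolys ?V" unfolding F(1) using kl by (intro mpolys_prod mpolys_diag_minor) auto
  note PF = mpoly_ring.cgenideal_ideal[OF FV]
  show "det_ideal k l {diag_minor k l d} \<in> knutson_ideals (mpoly_ring ?V) F" if d: "d < k + l - 1" for d
  proof -
    let ?f = "diag_minor k l d :: 'a mpoly"
    have f: "?f \<in> mpolys ?V" by (rule mpolys_diag_minor[OF d kl])
    obtain h where h: "h \<in> mpolys ?V" "F = ?f * h" using diag_minor_dvd[OF kl d] F(1) by metis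
    have "{x \<in> mpolys ?V. x * h \<in> PIdl\<^bsub>mpoly_ring ?V\<^esub> F} = PIdl\<^bsub>mpoly_ring ?V\<^esub> ?f"
    proof -
      have "h \<noteq> 0" using h(2) F(2) by auto
      then have eq: "x * h = c * F \<longleftrightarrow> x = c * ?f" for x c
        using h(2) by (simp flip: mult.assoc)
      then show ?thesis using mpolys_mult[OF _ f] by (auto simp: PIdl_mpoly)
    qed
    moreover have "det_ideal k l {?f} = PIdl\<^bsub>mpoly_ring ?V\<^esub> ?f"
    proof
      have PI: "ideal (PIdl\<^bsub>mpoly_ring ?V\<^esub> ?f) (mpoly_ring ?V)" by (rule mpoly_ring.cgenideal_ideal[OF f])
      show "det_ideal k l {?f} \<subseteq> PIdl\<^bsub>mpoly_ring ?V\<^esub> ?f"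
        using mpoly_ring.cgenideal_self[OF f] mpoly_ideal_zero[OF PI]
        by (intro det_ideal_minimal[OF PI]) (auto simp: \<pi>)
      show "PIdl\<^bsub>mpoly_ring ?V\<^esub> ?f \<subseteq> det_ideal k l {?f}"
        using f by (intro mpoly_ring.cgenideal_minimal ideal_det_ideal det_ideal_self) auto
    qed
    moreover have "{x \<in> mpolys ?V. x * h \<in> PIdl\<^bsub>mpoly_ring ?V\<^esub> F} \<in> knutson_ideals (mpoly_ring ?V) F"
      unfolding colon_PIdl[OF PF h(1), symmetric]
      by (intro knutson_ideals.colon knutson_ideals.principal mpoly_ring.cgenideal_ideal h(1))
    ultimately show ?thesis by simp
  qed
  show "det_ideal k l (G \<union> H) \<in> knutson_ideals (mpoly_ring ?V) F"
    if "G \<subseteq> mpolys ?V" "H \<subseteq> mpolys ?V" "det_ideal k l G \<in> knutson_ideals (mpoly_ring ?V) F"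
      "det_ideal k l H \<in> knutson_ideals (mpoly_ring ?V) F" for G H
    unfolding det_ideal_Un[OF that(1,2)] by (rule knutson_ideals.add[OF that(3,4)])
  show "{x \<in> mpolys ?V. x * h \<in> I} \<in> knutson_ideals (mpoly_ring ?V) F"
    if "I \<in> knutson_ideals (mpoly_ring ?V) F" "ideal I (mpoly_ring ?V)" "h \<in> mpolys ?V" for I h
    unfolding colon_PIdl[OF that(2,3), symmetric]
    by (intro knutson_ideals.colon that(1) mpoly_ring.cgenideal_ideal that(3))
qed

text \<open>Sums of Knutson ideals exist only for nonempty families. A nonzero Schubert ideal
  guarantees that at least one block has minors of the required size.\<close>

lemma schubert_ideal_knutson:
  fixes w :: "'a::field mat"
  assumes kl: "1 \<le> k" "1 \<le> l" "k \<le> l + 1" and nz: "schubert_ideal k l w \<noteq> {0}"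
  shows "schubert_ideal k l w \<in> knutson_ideals (mpoly_ring (vars k l)) (knutson_poly k l)"
proof -
  interpret residue_field "0 :: 'a" by (rule residue_field_zero)
  let ?V = "vars k l"
  let ?K = "knutson_ideals (mpoly_ring ?V) (knutson_poly k l :: 'a mpoly)"
  obtain ord where E: "antidiagonal_exchange ?V ord" using antidiagonal_exchange_exists[of ?V] by auto
  have F: "knutson_poly k l = (\<Prod>d<k + l - 1. diag_minor k l d :: 'a mpoly)"
    by (rule knutson_poly_diag_minors[OF kl])
  have "knutson_poly k l \<noteq> (0 :: 'a mpoly)"
    unfolding F by (rule unit_lead_nonzero[OF unit_lead_diag_minors[OF E kl(1,2)]])
  note box = knutson_ideals_box_minors[OF refl kl(1,2) F this]
  define t where "t r s = mat_rank (northwest w r s)" for r s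
  \<comment> \<open>Only blocks that have minors of size rank + 1 are kept: the others would
    contribute the zero ideal, which is not a Knutson ideal.\<close>
  define A where "A = {(r, s). r \<in> {1..k} \<and> s \<in> {1..l} \<and> t r s < r \<and> t r s < s}"
  have det_gen: "det_ideal k l G = gen ?V G" if "G \<subseteq> mpolys ?V" for G
  proof
    show "det_ideal k l G \<subseteq> gen ?V G"
      using gen_self[OF that] mpoly_ideal_zero[OF ideal_gen[OF that]]
      by (intro det_ideal_minimal ideal_gen that) auto
    show "gen ?V G \<subseteq> det_ideal k l G" unfolding det_ideal_def
      by (rule gen_mono[OF det_ideal_gens[OF that]]) auto
  qed
  note V = box_minors_Union_mpolys[of _ k l t, where 'a='a]
  have AB: "A \<subseteq> {1..k} \<times> {1..l}" by (auto simp: A_def)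
  have "schubert_ideal k l w = gen ?V (\<Union>(r, s)\<in>{1..k} \<times> {1..l}. box_minors r s (Suc (t r s)))"
    by (simp add: schubert_ideal_box_minors t_def)
  also have "(\<Union>(r, s)\<in>{1..k} \<times> {1..l}. box_minors r s (Suc (t r s)) :: 'a mpoly set) =
      (\<Union>(r, s)\<in>A. box_minors r s (Suc (t r s)))"
  proof -
    have "box_minors r s (Suc (t r s)) = ({} :: 'a mpoly set)"
      if "r \<in> {1..k}" "s \<in> {1..l}" "(r, s) \<notin> A" for r s
    proof -
      have "r < Suc (t r s) \<or> s < Suc (t r s)" using that by (auto simp: A_def)
      then show ?thesis using box_minors_empty by blast
    qed
    then have "(r, s) \<in> A" if "(r, s) \<in> {1..k} \<times> {1..l}" "x \<in> box_minors r s (Suc (t r s))"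
      for r s and x :: "'a mpoly" using that by blast
    then show ?thesis using AB by (intro equalityI subsetI; elim UN_E; clarify) blast+
  qed
  finally have eq: "schubert_ideal k l w = det_ideal k l (\<Union>(r, s)\<in>A. box_minors r s (Suc (t r s)))"
    using det_gen[OF V[OF AB]] by simp
  have "A \<noteq> {}"
  proof
    assume "A = {}"
    then have "schubert_ideal k l w \<subseteq> {0}"
      unfolding eq by (intro det_ideal_minimal mpoly_idealI) auto
    then show False using nz mpoly_ideal_zero[OF ideal_det_ideal[OF V[OF AB]]] eq by auto
  qed
  moreover have "finite A" using AB by (rule finite_subset) simp
  moreover have "det_ideal k l (\<Union>(r, s)\<in>B. box_minors r s (Suc (t r s))) \<in> ?K"
    if "finite B" "B \<noteq> {}" "B \<subseteq> A" for B
    using that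
  proof (induction B rule: finite_ne_induct)
    case (singleton a)
    then show ?case by (auto simp: A_def intro!: box)
  next
    case (insert a B)
    have BV: "B \<subseteq> {1..k} \<times> {1..l}" "{a} \<subseteq> {1..k} \<times> {1..l}" using insert.prems AB by auto
    have "det_ideal k l (\<Union>(r, s)\<in>{a}. box_minors r s (Suc (t r s))) \<in> ?K"
      using insert.prems by (auto simp: A_def intro!: box)
    then have "det_ideal k l ((\<Union>(r, s)\<in>{a}. box_minors r s (Suc (t r s))) \<union>
        (\<Union>(r, s)\<in>B. box_minors r s (Suc (t r s)))) \<in> ?K"
      using insert unfolding det_ideal_Un[OF V[OF BV(2)] V[OF BV(1)]] by (intro knutson_ideals.add) auto
    then show ?case by simp
  qed
  ultimately have "det_ideal k l (\<Union>(r, s)\<in>A. box_minors r s (Suc (t r s))) \<in> ?K" by blast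
  then show ?thesis by (simp add: eq)
qed

text \<open>The antidiagonal terms of the defining minors generate, by
  \<open>lead_box_minors\<close>. They are squarefree because the cells of an antidiagonal lie in
  distinct rows.\<close>

lemma schubert_initial_ideal:
  fixes w :: "'a::field mat"
  assumes kl: "1 \<le> k" "1 \<le> l" and ord: "antidiagonal_term_order TYPE('a) k l ord"
  shows "squarefree_monomial_ideal (vars k l) (initial_ideal (vars k l) ord (schubert_ideal k l w))"
proof -
  let ?V = "vars k l"
  have E: "antidiagonal_exchange ?V ord" by (rule antidiagonal_exchange_of_term_order[OF ord])
  then have T: "term_order ?V ord" by (simp add: antidiagonal_exchange_def)
  define t where "t r s = mat_rank (northwest w r s)" for r s
  define A where "A = {1..k} \<times> {1..l}"
  have AV: "A \<subseteq> {1..k} \<times> {1..l}" by (simp add: A_def)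
  define I where "I = schubert_ideal k l w"
  define M where "M = {antidiag \<rho> \<sigma> (Suc (t r s)) | \<rho> \<sigma> r s.
    (r, s) \<in> A \<and> sorted_in r (Suc (t r s)) \<rho> \<and> sorted_in s (Suc (t r s)) \<sigma>}"
  note GV = box_minors_Union_mpolys[OF AV, of t, where 'a='a]
  have I_eq: "I = gen ?V (\<Union>(r, s)\<in>A. box_minors r s (Suc (t r s)))"
    by (simp add: I_def schubert_ideal_box_minors t_def A_def)
  have I: "ideal I (mpoly_ring ?V)" unfolding I_eq by (rule ideal_gen[OF GV])
  have MV: "M \<subseteq> monomials ?V"
  proof
    fix m assume "m \<in> M"
    then obtain \<rho> \<sigma> r s where m: "m = antidiag \<rho> \<sigma> (Suc (t r s))" "(r, s) \<in> A"
      "sorted_in r (Suc (t r s)) \<rho>" "sorted_in s (Suc (t r s)) \<sigma>" unfolding M_def by blast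
    have "\<rho> a < k" "\<sigma> a < l" if "a < Suc (t r s)" for a
      using sorted_in_less[OF m(3) that] sorted_in_less[OF m(4) that] m(2) by (auto simp: A_def)
    then show "m \<in> monomials ?V"
      unfolding m(1) antidiag_def by (intro monomials_sum monomials_single) auto
  qed
  have LV: "{monom (lead_mon ord p) | p. p \<in> I \<and> p \<noteq> 0} \<subseteq> (mpolys ?V :: 'a mpoly set)"
  proof safe
    fix p assume "p \<in> I" "p \<noteq> 0"
    then have "lead 0 ord p (lead_mon ord p)"
      using mpoly_ideal_subset[OF I] by (intro lead_mon_lead[OF T]) auto
    then have "lead_mon ord p \<in> monomials ?V"
      using term_order_carrier[OF T] unfolding lead_def by blast
    then show "monom (lead_mon ord p) \<in> mpolys ?V" by (rule mpolys_monom)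
  qed
  have MMV: "monom ` M \<subseteq> (mpolys ?V :: 'a mpoly set)" using MV by auto
  have "initial_ideal ?V ord I = gen ?V (monom ` M)"
  proof
    show "initial_ideal ?V ord I \<subseteq> gen ?V (monom ` M)"
      unfolding initial_ideal_def
    proof (rule gen_minimal[OF ideal_gen[OF MMV]], safe)
      fix p assume p: "p \<in> I" "p \<noteq> 0"
      have lead: "lead 0 ord p (lead_mon ord p)"
        using p mpoly_ideal_subset[OF I] by (intro lead_mon_lead[OF T]) auto
      obtain r s where "(r, s) \<in> A" "has_antidiag r s (Suc (t r s)) (lead_mon ord p)"
        using lead_box_minors[OF kl E AV _ lead] p(1) unfolding I_eq by blast
      then obtain u m where m: "m \<in> M" "lead_mon ord p = u + m"
        unfolding has_antidiag_def M_def by blast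
      have "lead_mon ord p \<in> monomials ?V" using lead term_order_carrier[OF T] unfolding lead_def by blast
      then have "u \<in> monomials ?V" unfolding m(2) monomials_iff lookup_add by simp
      then have "monom u * monom m \<in> gen ?V (monom ` M :: 'a mpoly set)"
        using m(1) by (intro mpoly_ideal_mult[OF ideal_gen[OF MMV]] gen_self[OF MMV]) auto
      then show "monom (lead_mon ord p) \<in> gen ?V (monom ` M :: 'a mpoly set)"
        by (simp add: m(2) monom_def mult_single)
    qed
    show "gen ?V (monom ` M) \<subseteq> initial_ideal ?V ord I"
      unfolding initial_ideal_def
    proof (rule gen_minimal[OF ideal_gen[OF LV]], safe)
      fix m assume "m \<in> M"
      then obtain \<rho> \<sigma> r s where m: "m = antidiag \<rho> \<sigma> (Suc (t r s))" "(r, s) \<in> A"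
        "sorted_in r (Suc (t r s)) \<rho>" "sorted_in s (Suc (t r s)) \<sigma>" unfolding M_def by blast
      let ?g = "minor \<rho> \<sigma> (Suc (t r s)) :: 'a mpoly"
      have "(\<rho> a, \<sigma> b) \<in> ?V" if "a < Suc (t r s)" "b < Suc (t r s)" for a b
        using sorted_in_less[OF m(3) that(1)] sorted_in_less[OF m(4) that(2)] m(2) by (auto simp: A_def)
      then have lead: "unit_lead ord ?g m"
        unfolding m(1) using m(3,4) by (intro unit_lead_minor[OF E]) (auto simp: sorted_in_def)
      have "?g \<in> (\<Union>(r, s)\<in>A. box_minors r s (Suc (t r s)))" using m by (auto simp: box_minors_def)
      then have g: "?g \<in> I" unfolding I_eq by (rule gen_self[OF GV])
      moreover have nz: "?g \<noteq> 0" using unit_lead_nonzero[OF lead] .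
      moreover have "lead_mon ord ?g = m"
        using g nz mpoly_ideal_subset[OF I]
        by (intro lead_unique[OF T lead_mon_lead[OF T] unit_lead_lead[OF lead]]) auto
      ultimately show "(monom m :: 'a mpoly) \<in> gen ?V {monom (lead_mon ord p) | p. p \<in> I \<and> p \<noteq> (0 :: 'a mpoly)}"
        by (intro gen_self[OF LV]) blast
    qed
  qed
  moreover have "squarefree_mon m" if "m \<in> M" for m
    using that unfolding M_def squarefree_mon_def
    by (auto simp: lookup_antidiag sorted_in_def strict_mono_on_imp_inj_on)
  ultimately show ?thesis
    unfolding squarefree_monomial_ideal_def I_def using MV by blast
qed

lemma schubert_F_pure:
  fixes w :: "'a::field mat"
  assumes kl: "1 \<le> k" "1 \<le> l" and char: "0 < CHAR('a)"
  shows "F_pure TYPE('m) (mpoly_ring (vars k l) Quot schubert_ideal k l w)"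
proof -
  let ?V = "vars k l" and ?p = "CHAR('a)"
  obtain \<tau> :: "'a \<Rightarrow> 'a" where "frobenius_residue 0 ?p \<tau>"
    using frobenius_residue_field[OF char] by blast
  then interpret frobenius_residue 0 ?p \<tau> .
  obtain ord where E: "antidiagonal_exchange ?V ord" using antidiagonal_exchange_exists[of ?V] by auto
  interpret frobenius_splitting 0 ?p \<tau> k l ord "\<Prod>d<k + l - 1. diag_minor k l d"
    by (rule frobenius_splitting_diag_minors[OF kl E])
  define A where "A = {1..k} \<times> {1..l}"
  have AV: "A \<subseteq> {1..k} \<times> {1..l}" by (simp add: A_def)
  define t where "t r s = mat_rank (northwest w r s)" for r s
  define I where "I = schubert_ideal k l w"
  note GV = box_minors_Union_mpolys[OF AV, of t, where 'a='a]
  have I_eq: "I = gen ?V (\<Union>(r, s)\<in>A. box_minors r s (Suc (t r s)))"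
    by (simp add: I_def schubert_ideal_box_minors t_def A_def)
  have I: "ideal I (mpoly_ring ?V)" unfolding I_eq by (rule ideal_gen[OF GV])
  have det: "I = det_ideal k l (\<Union>(r, s)\<in>A. box_minors r s (Suc (t r s)))"
  proof
    show "I \<subseteq> det_ideal k l (\<Union>(r, s)\<in>A. box_minors r s (Suc (t r s)))"
      unfolding I_eq det_ideal_def by (rule gen_mono[OF det_ideal_gens[OF GV]]) auto
    show "det_ideal k l (\<Union>(r, s)\<in>A. box_minors r s (Suc (t r s))) \<subseteq> I"
      using mpoly_ideal_zero[OF I] gen_self[OF GV] by (intro det_ideal_minimal[OF I]) (auto simp: I_eq)
  qed
  have "compatible (det_ideal k l (\<Union>(r, s)\<in>A. box_minors r s (Suc (t r s))))"
  proof -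
    have "finite A" by (simp add: A_def)
    moreover have "(case a of (r, s) \<Rightarrow> box_minors r s (Suc (t r s))) \<subseteq> (mpolys ?V :: 'a mpoly set)"
      if "a \<in> A" for a using GV that by blast
    moreover have "compatible (det_ideal k l (case a of (r, s) \<Rightarrow> box_minors r s (Suc (t r s))))" if "a \<in> A" for a
      using that diag_minor_dvd[OF kl] by (cases a) (auto simp: A_def intro!: compatible_box)
    ultimately show ?thesis using lead_in_Union[of A "\<lambda>(r, s). box_minors r s (Suc (t r s))"] by blast
  qed
  then have split_I: "split x \<in> I" if "x \<in> I" for x
    using that unfolding det compatible_def by blast
  \<comment> \<open>With \<open>\<pi>\<close> = 0 congruence modulo \<open>residual\<close> is
    equality.\<close>
  have residual: "x = y" if "x - y \<in> residual" for x y :: "'a mpoly"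
    using that by (intro poly_mapping_eqI) (auto simp: residual_def lookup_minus)
  have "lead 0 ord (1 :: 'a mpoly) 0"
    by (rule unit_lead_lead[OF unit_lead_one[OF T]]) simp
  then have lead_split_one: "lead 0 ord (split 1) 0"
    by (intro lead_split) (simp_all add: lookup_one)
  define u where "u = lookup (split 1) 0"
  have u: "u \<noteq> 0" using lead_split_one by (simp add: u_def lead_def)
  \<comment> \<open>The leading monomial 0 is the smallest one, so \<open>split 1\<close> is a
    nonzero constant; dividing by it turns \<open>split\<close> into a splitting.\<close>
  have split_one: "split 1 = single 0 u"
  proof (rule poly_mapping_eqI)
    fix n show "lookup (split 1) n = lookup (single 0 u) n"
    proof (cases "n = 0")
      case False
      have "lookup (split 1) n = 0"
      proof (rule ccontr)
        assume "lookup (split 1) n \<noteq> 0"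
        then have "(n, 0) \<in> ord" using lead_split_one by (simp add: lead_def)
        then have "n = 0"
          using term_order_antisym[OF T _ term_order_zero[OF T]] term_order_carrier[OF T] by blast
        then show False using False by contradiction
      qed
      then show ?thesis using False by (simp add: lookup_single)
    qed (simp add: u_def)
  qed
  \<comment> \<open>The monomial 0 contains no antidiagonal, since the minors have size at least
    1.\<close>
  have "1 \<notin> I"
  proof
    assume "1 \<in> I"
    then obtain r s where "has_antidiag r s (Suc (t r s)) 0"
      using lead_box_minors[OF kl E AV _ \<open>lead 0 ord 1 0\<close>, of t] unfolding I_eq by blast
    then obtain \<rho> \<sigma> v where h: "sorted_in r (Suc (t r s)) \<rho>" "0 = v + antidiag \<rho> \<sigma> (Suc (t r s))"
      unfolding has_antidiag_def by blast
    have "lookup (antidiag \<rho> \<sigma> (Suc (t r s))) (\<rho> 0, \<sigma> (t r s)) = 1"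
      using h(1) by (subst lookup_antidiag) (auto simp: sorted_in_def strict_mono_on_imp_inj_on intro!: exI[of _ 0])
    then have "lookup (v + antidiag \<rho> \<sigma> (Suc (t r s))) (\<rho> 0, \<sigma> (t r s)) \<noteq> 0"
      by (simp add: lookup_add)
    then show False by (simp flip: h(2))
  qed
  then show ?thesis
    unfolding I_def[symmetric]
  proof (rule F_pure_quotient[OF I _ refl char, where \<sigma> = "\<lambda>x. single 0 (inverse u) * split x"])
    show "single 0 (inverse u) * split x \<in> mpolys ?V" for x
      by (intro mpolys_mult mpolys_single mpolys_split) simp
    show "single 0 (inverse u) * split (x + y) = single 0 (inverse u) * split x + single 0 (inverse u) * split y"
      for x y by (simp add: split_add distrib_left)
    show "single 0 (inverse u) * split (x ^ ?p * y) = x * (single 0 (inverse u) * split y)"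
      if "x \<in> mpolys ?V" for x y
      using residual[OF split_power_mult[OF that]] by (simp add: mult_ac)
    show "single 0 (inverse u) * split 1 = 1"
      using u by (simp add: split_one mult_single)
    show "single 0 (inverse u) * split x \<in> I" if "x \<in> I" for x
      by (intro mpoly_ideal_mult[OF I] mpolys_single split_I that) simp
  qed
qed

theorem corollary5p4:
  fixes k l :: nat and w :: "'a::field mat"
  assumes "1 \<le> k" and "1 \<le> l" and "k \<le> l + 1"
    and "partial_permutation k l w"
  shows "(schubert_ideal k l w \<noteq> {0} \<longrightarrow>
            schubert_ideal k l w \<in> knutson_ideals (mpoly_ring (vars k l)) (knutson_poly k l)) \<and>
         (\<forall>ord. antidiagonal_term_order TYPE('a) k l ord \<longrightarrow>
            squarefree_monomial_ideal (vars k l)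
              (initial_ideal (vars k l) ord (schubert_ideal k l w))) \<and>
         (0 < CHAR('a) \<longrightarrow>
            F_pure TYPE('m) (mpoly_ring (vars k l) Quot schubert_ideal k l w))"
  using schubert_ideal_knutson[OF assms(1-3)] schubert_initial_ideal[OF assms(1,2)]
    schubert_F_pure[OF assms(1,2)] by blast

end
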